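(* Let $\mathcal{A}$ be a central multiarrangement (all hyperplanes linear) in $\mathbb{R}^n$, and let $2\mathcal{A}$ be the multiarrangement obtained from $\mathcal{A}$ by adding one additional copy of each member of $\mathcal{A}$ (so all multiplicities are doubled). Let $\mathcal{E}_{\mathcal{A}}=\Omega_n/I_{\mathcal{A}}$. Then $$\operatorname{Hilb}(\mathcal{E}_{\mathcal{A}};q,t)\big|_{(q,t)=(q^2,q)}=\operatorname{Hilb}(\mathbb{C}[x_1,\dots,x_n]/J_{2\mathcal{A},1};q).$$ Thus $\dim_{\mathbb{C}}(\mathcal{E}_{\mathcal{A}})$ equals the number of regions of the generic arrangement $2\mathcal{A}^{\mathrm{gen}}$ in $\mathbb{R}^n$ determined by $2\mathcal{A}$.
   Context: Superspace: $\Omega_n=\mathbb{C}[x_1,\dots,x_n]\otimes\wedge\{\theta_1,\dots,\theta_n\}$, where the $x_i$ commute and the $\theta_i$ anticommute; bigraded with $x_i$ in degree $(1,0)$ and $\theta_i$ in degree $(0,1)$. The Euler operator is $df=\sum_{i=1}^n(\partial f/\partial x_i)\cdot\theta_i$ (with $\theta$-variables treated as constants). A multiarrangement is a finite collection $\mathcal{A}=\{H_1,\dots,H_m\}$ of hyperplanes, repeats allowed. A real multiarrangement is regarded as a multiarrangement in $\mathbb{C}^n$ by complexification. For a line $L=\mathbb{C}\cdot(\ell_1,\dots,\ell_n)$ in $\mathbb{C}^n$ put $\lambda_L=\ell_1x_1+\cdots+\ell_nx_n$ and $\rho_{\mathcal{A}}(L)=\#\{1\le i\le m:L\not\subseteq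 H_i\}$. Then $$J_{\mathcal{A},1}=\left(\lambda_L^{\rho_{\mathcal{A}}(L)+1}: L\subseteq\mathbb{C}^n\text{ a line}\right)\subseteq\mathbb{C}[x_1,\dots,x_n],$$ $$I_{\mathcal{A}}=\left(\lambda_L^{\rho_{\mathcal{A}}(L)+1},\ d\big(\lambda_L^{\rho_{\mathcal{A}}(L)+1}\big)\ :\ L\subseteq\mathbb{C}^n\text{ a line}\right)\subseteq\Omega_n .$$ Hilbert series: $\operatorname{Hilb}(V;q)=\sum_i\dim(V_i)q^i$ and $\operatorname{Hilb}(V;q,t)=\sum_{i,j}\dim(V_{i,j})q^it^j$, with $q$ tracking bosonic and $t$ tracking fermionic degree. Generic arrangement: for a real linear multiarrangement $\mathcal{C}$, $\mathcal{C}^{\mathrm{gen}}$ is an affine hyperplane arrangement in $\mathbb{R}^n$ whose hyperplanes are affine translates of the members of $\mathcal{C}$ (one translate for each member counted with multiplicity) such that any $k$ of these hyperplanes have nonempty intersection if and only if their normal vectors form a linearly independent family. $2\mathcal{A}^{\mathrm{gen}}$ means $(2\mathcal{A})^{\mathrm{gen}}$. Regions are the connected components of the complement in $\mathbb{R}^n$ of the union of the hyperplanes. *)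

theory Defs
  imports
    "HOL-Analysis.Analysis"
    "HOL-Algebra.Algebraic_Closure_Type"
    "HOL-Algebra.QuotRing"
    "HOL-Algebra.Embedded_Algebras"
    "HOL-Computational_Algebra.Formal_Power_Series"
    "HOL-Library.Poly_Mapping"
    "HOL-Library.Multiset"
begin

section \<open>Complex polynomials in variables indexed by a finite type\<close>

text \<open>An exponent vector is an element of \<^typ>\<open>'n \<Rightarrow>\<^sub>0 nat\<close>; products of finitely supported
  functions are convolutions, so this is the polynomial ring with one variable for each
  element of \<open>'n\<close>.\<close>

type_synonym 'n mpoly = "('n \<Rightarrow>\<^sub>0 nat) \<Rightarrow>\<^sub>0 complex"

definition mconst :: "complex \<Rightarrow> 'n mpoly"
  where "mconst c = Poly_Mapping.single 0 c"

definition mvar :: "'n \<Rightarrow> 'n mpoly"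
  where "mvar i = Poly_Mapping.single (Poly_Mapping.single i 1) 1"

definition monom_degree :: "('n::finite \<Rightarrow>\<^sub>0 nat) \<Rightarrow> nat"
  where "monom_degree m = (\<Sum>i\<in>UNIV. Poly_Mapping.lookup m i)"

definition mpoly_component :: "nat \<Rightarrow> 'n::finite mpoly set"
  where "mpoly_component k = {p. \<forall>m\<in>Poly_Mapping.keys p. monom_degree m = k}"

text \<open>The partial derivative with respect to the variable \<open>i\<close>. Subtraction of exponent vectors is
  truncated, but it is only truncated on terms that get the coefficient 0.\<close>

definition mpderiv :: "'n \<Rightarrow> 'n mpoly \<Rightarrow> 'n mpoly"
  where "mpderiv i p =
    (\<Sum>m\<in>Poly_Mapping.keys p.
      Poly_Mapping.single (m - Poly_Mapping.single i 1)
        (of_nat (Poly_Mapping.lookup m i) * Poly_Mapping.lookup p m))"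

section \<open>Superspace\<close>

text \<open>
  The tensor product of the polynomial ring with the exterior algebra is the free module over the
  polynomial ring with basis \<open>\<theta>\<^sub>S\<close> for \<open>S \<subseteq> 'n\<close>, where \<open>\<theta>\<^sub>S\<close> is the product of the \<open>\<theta>\<^sub>i\<close>,
  \<open>i \<in> S\<close>, in increasing order. An element is given by its coefficient function, and
  \<open>\<theta>\<^sub>S \<theta>\<^sub>T\<close> is 0 if \<open>S\<close> and \<open>T\<close> meet and is \<open>(-1)\<^sup>k \<theta>\<^bsub>S \<union> T\<^esub>\<close> otherwise, where \<open>k\<close> is the
  number of pairs \<open>(s, t) \<in> S \<times> T\<close> with \<open>t < s\<close>.\<close>

typedef 'n superspace = "UNIV :: ('n set \<Rightarrow> 'n mpoly) set"
  morphisms theta_coeff Superspace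
  by simp

setup_lifting type_definition_superspace

lemma superspace_eqI: "(\<And>S. theta_coeff f S = theta_coeff g S) \<Longrightarrow> f = g"
  by (metis theta_coeff_inject ext)

definition inversions :: "'n::linorder set \<Rightarrow> 'n set \<Rightarrow> ('n \<times> 'n) set"
  where "inversions S T = {(s, t). s \<in> S \<and> t \<in> T \<and> t < s}"

definition theta_sign :: "'n::linorder set \<Rightarrow> 'n set \<Rightarrow> 'n mpoly"
  where "theta_sign S T = (- 1) ^ card (inversions S T)"

instantiation superspace :: ("{finite, linorder}") ring_1
begin

lift_definition zero_superspace :: "'a superspace" is "\<lambda>S. 0" .
lift_definition one_superspace :: "'a superspace" is "\<lambda>S. if S = {} then 1 else 0" .
lift_definition plus_superspace :: "'a superspace \<Rightarrow> 'a superspace \<Rightarrow> 'a superspace"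
  is "\<lambda>f g S. f S + g S" .
lift_definition minus_superspace :: "'a superspace \<Rightarrow> 'a superspace \<Rightarrow> 'a superspace"
  is "\<lambda>f g S. f S - g S" .
lift_definition uminus_superspace :: "'a superspace \<Rightarrow> 'a superspace"
  is "\<lambda>f S. - f S" .
lift_definition times_superspace :: "'a superspace \<Rightarrow> 'a superspace \<Rightarrow> 'a superspace"
  is "\<lambda>f g U. \<Sum>S\<in>Pow U. theta_sign S (U - S) * f S * g (U - S)" .

instance
proof
  fix f g h :: "'a superspace"
  have card_left: "card (inversions (A \<union> B) C) = card (inversions A C) + card (inversions B C)"
    if "A \<inter> B = {}" for A B C :: "'a set"
  proof -
    have "inversions (A \<union> B) C = inversions A C \<union> inversions B C"
      by (auto simp: inversions_def)
    moreover have "inversions A C \<inter> inversions B C = {}"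
      using that by (auto simp: inversions_def)
    ultimately show ?thesis by (simp add: card_Un_disjoint)
  qed
  have card_right: "card (inversions A (B \<union> C)) = card (inversions A B) + card (inversions A C)"
    if "B \<inter> C = {}" for A B C :: "'a set"
  proof -
    have "inversions A (B \<union> C) = inversions A B \<union> inversions A C"
      by (auto simp: inversions_def)
    moreover have "inversions A B \<inter> inversions A C = {}"
      using that by (auto simp: inversions_def)
    ultimately show ?thesis by (simp add: card_Un_disjoint)
  qed
  show "f * g * h = f * (g * h)"
  proof (rule superspace_eqI)
    fix U :: "'a set"
    let ?F = "theta_coeff f" and ?G = "theta_coeff g" and ?H = "theta_coeff h"
    have "theta_coeff (f * g * h) U =
        (\<Sum>S\<in>Pow U. \<Sum>A\<in>Pow S. theta_sign S (U - S) * theta_sign A (S - A) *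
           ?F A * ?G (S - A) * ?H (U - S))"
      by (simp add: times_superspace.rep_eq sum_distrib_left sum_distrib_right mult_ac)
    also have "\<dots> = (\<Sum>(S, A)\<in>Sigma (Pow U) Pow. theta_sign S (U - S) * theta_sign A (S - A) *
           ?F A * ?G (S - A) * ?H (U - S))"
      by (rule sum.Sigma) auto
    also have "\<dots> = (\<Sum>(A, B)\<in>(SIGMA A:Pow U. Pow (U - A)). theta_sign A (U - A) *
           theta_sign B (U - A - B) * ?F A * ?G B * ?H (U - A - B))"
    proof (rule sum.reindex_bij_witness[where i = "\<lambda>(A, B). (A \<union> B, A)" and j = "\<lambda>(S, A). (A, S - A)"],
        goal_cases)
      case (5 p)
      obtain S A where p: "p = (S, A)" by (cases p)
      with 5 have SU: "S \<subseteq> U" "A \<subseteq> S" by auto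
      have eqs: "U - A - (S - A) = U - S" "A \<union> (S - A) = S" "(S - A) \<union> (U - S) = U - A"
        using SU by auto
      have "card (inversions S (U - S)) + card (inversions A (S - A)) =
            card (inversions A (U - A)) + card (inversions (S - A) (U - S))"
      proof -
        have "A \<inter> (S - A) = {}" "(S - A) \<inter> (U - S) = {}" by auto
        from card_left[OF this(1), of "U - S"] card_right[OF this(2), of A] show ?thesis
          unfolding eqs by linarith
      qed
      then have "theta_sign S (U - S) * theta_sign A (S - A) =
            theta_sign A (U - A) * theta_sign (S - A) (U - S)"
        by (simp add: theta_sign_def flip: power_add)
      then show ?case using eqs by (simp add: p)
    qed auto
    also have "\<dots> = (\<Sum>A\<in>Pow U. \<Sum>B\<in>Pow (U - A). theta_sign A (U - A) *
           theta_sign B (U - A - B) * ?F A * ?G B * ?H (U - A - B))"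
      by (rule sum.Sigma[symmetric]) auto
    also have "\<dots> = theta_coeff (f * (g * h)) U"
      by (simp add: times_superspace.rep_eq sum_distrib_left sum_distrib_right mult_ac)
    finally show "theta_coeff (f * g * h) U = theta_coeff (f * (g * h)) U" .
  qed
  have sum_empty: "(\<Sum>S\<in>Pow U. if S = {} then k S else 0) = k {}"
    for U :: "'a set" and k :: "'a set \<Rightarrow> 'a mpoly"
    by (simp add: sum.delta)
  show "1 * f = f"
  proof (rule superspace_eqI)
    fix U :: "'a set"
    have "theta_coeff (1 * f) U =
        (\<Sum>S\<in>Pow U. if S = {} then theta_sign S (U - S) * theta_coeff f (U - S) else 0)"
      unfolding times_superspace.rep_eq one_superspace.rep_eq
      by (rule sum.cong) auto
    then show "theta_coeff (1 * f) U = theta_coeff f U"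
      by (simp add: sum_empty theta_sign_def inversions_def)
  qed
  show "f * 1 = f"
  proof (rule superspace_eqI)
    fix U :: "'a set"
    have "theta_coeff (f * 1) U =
        (\<Sum>S\<in>Pow U. if S = U then theta_sign S (U - S) * theta_coeff f S else 0)"
      unfolding times_superspace.rep_eq one_superspace.rep_eq
      by (rule sum.cong) auto
    also have "\<dots> = theta_sign U {} * theta_coeff f U"
      by (simp add: sum.delta)
    finally show "theta_coeff (f * 1) U = theta_coeff f U"
      by (simp add: theta_sign_def inversions_def)
  qed
  show "(f + g) * h = f * h + g * h" "f * (g + h) = f * g + f * h"
    by (auto intro!: superspace_eqI
        simp: times_superspace.rep_eq plus_superspace.rep_eq algebra_simps sum.distrib)
  show "(0::'a superspace) \<noteq> 1"
  proof
    assume "(0::'a superspace) = 1"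
    then have "theta_coeff (0::'a superspace) {} = theta_coeff 1 {}" by simp
    then show False by (simp add: zero_superspace.rep_eq one_superspace.rep_eq)
  qed
qed (auto intro!: superspace_eqI simp: plus_superspace.rep_eq zero_superspace.rep_eq
      minus_superspace.rep_eq uminus_superspace.rep_eq)

end

definition of_mpoly :: "'n mpoly \<Rightarrow> 'n superspace"
  where "of_mpoly p = Superspace (\<lambda>S. if S = {} then p else 0)"

definition theta :: "'n \<Rightarrow> 'n superspace"
  where "theta i = Superspace (\<lambda>S. if S = {i} then 1 else 0)"

definition spderiv :: "'n \<Rightarrow> 'n superspace \<Rightarrow> 'n superspace"
  where "spderiv i f = Superspace (\<lambda>S. mpderiv i (theta_coeff f S))"

lemma theta_coeff_of_mpoly: "theta_coeff (of_mpoly p) S = (if S = {} then p else 0)"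
  by (simp add: of_mpoly_def Superspace_inverse)

lemma theta_coeff_theta: "theta_coeff (theta i) S = (if S = {i} then 1 else 0)"
  by (simp add: theta_def Superspace_inverse)

lemma theta_coeff_spderiv: "theta_coeff (spderiv i f) S = mpderiv i (theta_coeff f S)"
  by (simp add: spderiv_def Superspace_inverse)

definition euler :: "'n::{finite, linorder} superspace \<Rightarrow> 'n superspace"
  where "euler f = (\<Sum>i\<in>UNIV. spderiv i f * theta i)"

definition superspace_component :: "nat \<Rightarrow> nat \<Rightarrow> 'n::finite superspace set"
  where "superspace_component i j =
    {f. \<forall>S. \<forall>m\<in>Poly_Mapping.keys (theta_coeff f S). monom_degree m = i \<and> card S = j}"

lemma theta_coeff_theta_mult:
  fixes i j :: "'n::{finite, linorder}"
  shows "theta_coeff (theta i * theta j) U =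
    (if i \<noteq> j \<and> U = {i, j} then if j < i then - 1 else 1 else 0)"
proof -
  have "theta_coeff (theta i * theta j) U =
      (\<Sum>S\<in>Pow U. if S = {i} then (if U - {i} = {j} then theta_sign {i} {j} else 0) else 0)"
    unfolding times_superspace.rep_eq theta_coeff_theta
    by (rule sum.cong) simp_all
  also have "\<dots> = (if i \<in> U \<and> U - {i} = {j} then theta_sign {i} {j} else 0)"
    by (simp add: sum.delta)
  also have "i \<in> U \<and> U - {i} = {j} \<longleftrightarrow> i \<noteq> j \<and> U = {i, j}"
    by auto
  also have "inversions {i} {j} = (if j < i then {(i, j)} else {})"
    by (auto simp: inversions_def)
  then have "theta_sign {i} {j} = (if j < i then - 1 else 1)"
    by (simp add: theta_sign_def)
  finally show ?thesis by simp
qed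

lemma theta_anticommute: "theta i * theta j = - (theta j * theta i)"
  for i j :: "'n::{finite, linorder}"
proof (rule superspace_eqI)
  fix U
  have "{i, j} = {j, i}" by blast
  then show "theta_coeff (theta i * theta j) U = theta_coeff (- (theta j * theta i)) U"
    unfolding uminus_superspace.rep_eq theta_coeff_theta_mult
    by (cases i j rule: linorder_cases) (auto dest: less_asym)
qed

lemma theta_square: "theta i * theta i = 0"
  for i :: "'n::{finite, linorder}"
  by (rule superspace_eqI) (simp add: zero_superspace.rep_eq theta_coeff_theta_mult)

lemma theta_coeff_of_mpoly_mult: "theta_coeff (of_mpoly p * f) U = p * theta_coeff f U"
  for p :: "'n::{finite, linorder} mpoly"
proof -
  have "theta_coeff (of_mpoly p * f) U =
      (\<Sum>S\<in>Pow U. if S = {} then theta_sign S (U - S) * p * theta_coeff f (U - S) else 0)"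
    unfolding times_superspace.rep_eq theta_coeff_of_mpoly
    by (rule sum.cong) simp_all
  then show ?thesis
    by (simp add: sum.delta theta_sign_def inversions_def)
qed

lemma of_mpoly_mult: "of_mpoly (p * q) = of_mpoly p * of_mpoly q"
  for p q :: "'n::{finite, linorder} mpoly"
  by (rule superspace_eqI) (simp add: theta_coeff_of_mpoly_mult theta_coeff_of_mpoly)

section \<open>Ideals, quotients and Hilbert series\<close>

abbreviation type_ring :: "'a::ring_1 ring"
  where "type_ring \<equiv> ring_of_type_algebra"

definition generated_ideal :: "'a::ring_1 set \<Rightarrow> 'a set"
  where "generated_ideal G = Idl\<^bsub>type_ring\<^esub> G"

definition quotient_by :: "'a::ring_1 set \<Rightarrow> 'a set ring"
  where "quotient_by I = type_ring Quot I"

text \<open>The image in the quotient by \<open>I\<close> of a set \<open>V\<close> of ring elements.\<close>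

definition quotient_image :: "'a::ring_1 set \<Rightarrow> 'a set \<Rightarrow> 'a set set"
  where "quotient_image I V = (\<lambda>f. I +>\<^bsub>type_ring\<^esub> f) ` V"

definition hilb :: "'r ring \<Rightarrow> 'r set \<Rightarrow> (nat \<Rightarrow> 'r set) \<Rightarrow> int fps"
  where "hilb R K V = Abs_fps (\<lambda>i. int (ring.dim R K (V i)))"

text \<open>A series in \<open>q\<close> and \<open>t\<close> is a series in \<open>t\<close> whose coefficients are series in \<open>q\<close>: the
  coefficient of \<open>q\<^sup>i t\<^sup>j\<close> in \<open>F\<close> is \<open>fps_nth (fps_nth F j) i\<close>.\<close>

definition hilb2 :: "'r ring \<Rightarrow> 'r set \<Rightarrow> (nat \<Rightarrow> nat \<Rightarrow> 'r set) \<Rightarrow> int fps fps"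
  where "hilb2 R K V = Abs_fps (\<lambda>j. Abs_fps (\<lambda>i. int (ring.dim R K (V i j))))"

text \<open>The specialization \<open>(q, t) = (a, b)\<close>, where \<open>a\<close> has no constant term. The sum over the
  powers of \<open>b\<close> is taken in the topology of formal power series; it is finite for the
  superspace quotients, whose fermionic degree is bounded.\<close>

definition fps_specialize :: "int fps fps \<Rightarrow> int fps \<Rightarrow> int fps \<Rightarrow> int fps"
  where "fps_specialize F a b = suminf (\<lambda>j. (fps_nth F j oo a) * b ^ j)"

section \<open>Arrangements\<close>

definition linear_hyperplane :: "(real ^ 'n::finite) set \<Rightarrow> bool"
  where "linear_hyperplane H \<longleftrightarrow> (\<exists>a. a \<noteq> 0 \<and> H = {x. a \<bullet> x = 0})"

definition complexification :: "(real ^ 'n::finite) set \<Rightarrow> (complex ^ 'n) set"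
  where "complexification H = {z. (\<chi> i. Re (z $ i)) \<in> H \<and> (\<chi> i. Im (z $ i)) \<in> H}"

definition cline :: "complex ^ 'n::finite \<Rightarrow> (complex ^ 'n) set"
  where "cline l = range (\<lambda>c. c *s l)"

definition rho :: "(real ^ 'n::finite) set multiset \<Rightarrow> (complex ^ 'n) set \<Rightarrow> nat"
  where "rho A L = size {#H \<in># A. \<not> L \<subseteq> complexification H#}"

definition linform :: "complex ^ 'n::finite \<Rightarrow> 'n mpoly"
  where "linform l = (\<Sum>i\<in>UNIV. mconst (l $ i) * mvar i)"

text \<open>A line determines its linear form only up to a nonzero scalar. The generators below use all
  nonzero direction vectors of all lines, which does not change the ideals.\<close>

definition power_gen :: "(real ^ 'n::finite) set multiset \<Rightarrow> complex ^ 'n \<Rightarrow> 'n mpoly"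
  where "power_gen A l = linform l ^ (rho A (cline l) + 1)"

definition J_ideal :: "(real ^ 'n::finite) set multiset \<Rightarrow> 'n mpoly set"
  where "J_ideal A = generated_ideal {power_gen A l |l. l \<noteq> 0}"

definition I_ideal :: "(real ^ 'n::{finite, linorder}) set multiset \<Rightarrow> 'n superspace set"
  where "I_ideal A = generated_ideal
    ({of_mpoly (power_gen A l) |l. l \<noteq> 0} \<union> {euler (of_mpoly (power_gen A l)) |l. l \<noteq> 0})"

definition mpoly_quotient :: "(real ^ 'n::finite) set multiset \<Rightarrow> 'n mpoly set ring"
  where "mpoly_quotient A = quotient_by (J_ideal A)"

definition mpoly_quotient_scalars :: "(real ^ 'n::finite) set multiset \<Rightarrow> 'n mpoly set set"
  where "mpoly_quotient_scalars A = quotient_image (J_ideal A) (range mconst)"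

definition mpoly_quotient_hilb :: "(real ^ 'n::finite) set multiset \<Rightarrow> int fps"
  where "mpoly_quotient_hilb A = hilb (mpoly_quotient A) (mpoly_quotient_scalars A)
    (\<lambda>k. quotient_image (J_ideal A) (mpoly_component k))"

definition super_quotient ::
    "(real ^ 'n::{finite, linorder}) set multiset \<Rightarrow> 'n superspace set ring"
  where "super_quotient A = quotient_by (I_ideal A)"

definition super_quotient_scalars ::
    "(real ^ 'n::{finite, linorder}) set multiset \<Rightarrow> 'n superspace set set"
  where "super_quotient_scalars A = quotient_image (I_ideal A) (range (\<lambda>c. of_mpoly (mconst c)))"

definition super_quotient_hilb ::
    "(real ^ 'n::{finite, linorder}) set multiset \<Rightarrow> int fps fps"
  where "super_quotient_hilb A = hilb2 (super_quotient A) (super_quotient_scalars A)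
    (\<lambda>i j. quotient_image (I_ideal A) (superspace_component i j))"

text \<open>\<open>a\<close>, \<open>b\<close> describe affine hyperplanes \<open>{x. a i \<bullet> x = b i}\<close>, \<open>i < m\<close>, one translate for each
  member of \<open>C\<close> counted with multiplicity. The normal vectors of a subfamily are linearly
  independent as a family, so in particular pairwise distinct.\<close>

definition generic_arrangement ::
    "(real ^ 'n::finite) set multiset \<Rightarrow> nat \<Rightarrow> (nat \<Rightarrow> real ^ 'n) \<Rightarrow> (nat \<Rightarrow> real) \<Rightarrow> bool"
  where "generic_arrangement C m a b \<longleftrightarrow>
    (\<forall>i<m. a i \<noteq> 0) \<and>
    image_mset (\<lambda>i. {x. a i \<bullet> x = 0}) (mset_set {..<m}) = C \<and>
    (\<forall>S\<subseteq>{..<m}. (\<Inter>i\<in>S. {x. a i \<bullet> x = b i}) \<noteq> {} \<longleftrightarrow>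
       inj_on a S \<and> independent (a ` S))"

definition regions :: "nat \<Rightarrow> (nat \<Rightarrow> real ^ 'n::finite) \<Rightarrow> (nat \<Rightarrow> real) \<Rightarrow> (real ^ 'n) set set"
  where "regions m a b = components (- (\<Union>i<m. {x. a i \<bullet> x = b i}))"

end

theory Submission
  imports Defs
begin

unbundle no fps_syntax

text \<open>
  Under the pairing that makes the monomials \<open>x\<^sup>m \<theta>\<^sub>S\<close> orthogonal with squared length \<open>m!\<close>,
  multiplication by \<open>x\<^sub>i\<close> and \<open>\<theta>\<^sub>i\<close> is adjoint to differentiation \<open>\<partial>\<^sub>i\<close> and contraction \<open>\<iota>\<^sub>i\<close>. Hence the
  orthogonal complement of the ideal consists of the \<open>f\<close> such that, for every direction \<open>\<lambda>\<close> on which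
  \<open>r\<close> of the normals do not vanish, \<open>\<partial>\<^sub>\<lambda>\<^bsup>r+1\<^esup> f = 0\<close> and \<open>\<partial>\<^sub>\<lambda>\<^bsup>r\<^esup> \<iota>\<^sub>\<lambda> f = 0\<close>. This space is spanned by the
  products that use each normal \<open>a\<close> at most once, either as \<open>x\<^sub>a\<close> or as \<open>\<theta>\<^sub>a\<close>: restrict \<open>f\<close> to the
  hyperplane \<open>x\<^sub>a = \<theta>\<^sub>a = 0\<close>, lift the restriction by induction, do the same for the coefficient of
  \<open>\<theta>\<^sub>a\<close>, and observe that the rest is \<open>x\<^sub>a\<close> times an element for the arrangement without \<open>a\<close>. Writing
  \<open>h\<close> for the bigraded dimension, this gives \<open>h(A) = (1 + t) h(A/a) + q h(A - a)\<close>. The part of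
  fermionic degree 0 satisfies the recursion with \<open>t = 0\<close>; applying that twice to a doubled normal
  gives \<open>(1 + q) h(2(A/a)) + q\<^sup>2 h(2(A - a))\<close>, which is the first recursion at \<open>(q\<^sup>2, q)\<close>. At \<open>q = 1\<close>,
  \<open>t = 0\<close> the recursion counts independent subfamilies, and these also count the regions of a generic
  arrangement, because each new hyperplane cuts in two exactly the regions that it meets.
\<close>

section \<open>Scalars and the elementary operators on superspace\<close>

text \<open>The second dual condition has one derivative fewer because d of lambda^(r+1) is r+1
  times lambda^r times the odd form of lambda. Products of normals obey it: the contraction uses up
  a normal that does not vanish on lambda, which leaves at most r-1 to differentiate. The obstacle
  is the converse, that the conditions admit nothing but such products. It is overcome with a
  direction e such that a(e) = 1: after substituting x - a(x) e, a derivative along l becomes one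
  along l - a(l) e, where a vanishes, so the conditions for A become those for A/a. This must hold
  for every complex l, so these lists are complex; the recursion itself uses only field operations
  and can be evaluated on real normals, which are the ones that count regions. The recursion works
  with chosen normals and pivots. Its values in fermionic degree 0 are nevertheless invariants of
  the arrangement, being dimensions of a quotient that depends on A only through \<open>rho\<close>.
  This is what allows the doubled normals to be exchanged for those of a given generic
  arrangement.\<close>

abbreviation coef :: "'n superspace \<Rightarrow> 'n set \<Rightarrow> ('n \<Rightarrow>\<^sub>0 nat) \<Rightarrow> complex"
  where "coef f S m \<equiv> Poly_Mapping.lookup (theta_coeff f S) m"

lemma superspace_coef_eqI: "(\<And>S m. coef f S m = coef g S m) \<Longrightarrow> f = g"
  by (rule superspace_eqI, rule poly_mapping_eqI)

lemma lookup_single_times: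
  fixes p :: "'n mpoly"
  shows "Poly_Mapping.lookup (Poly_Mapping.single k c * p) (k + q) = c * Poly_Mapping.lookup p q"
    and "(\<And>q. m \<noteq> k + q) \<Longrightarrow> Poly_Mapping.lookup (Poly_Mapping.single k c * p) m = 0"
proof -
  have "Poly_Mapping.lookup (Poly_Mapping.single k c * p) m
      = c * (\<Sum>q. Poly_Mapping.lookup p q when m = k + q)" for m
    by (simp add: lookup_mult lookup_single when_mult)
  then show "Poly_Mapping.lookup (Poly_Mapping.single k c * p) (k + q) = c * Poly_Mapping.lookup p q"
    and "(\<And>q. m \<noteq> k + q) \<Longrightarrow> Poly_Mapping.lookup (Poly_Mapping.single k c * p) m = 0"
    by simp_all
qed

lemma lookup_mconst_mult:
  "Poly_Mapping.lookup (mconst c * p) m = c * Poly_Mapping.lookup p m"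
  using lookup_single_times(1)[of 0 c p m] by (simp add: mconst_def)

lemma exponent_split:
  fixes m :: "'n \<Rightarrow>\<^sub>0 nat"
  assumes "Poly_Mapping.lookup m i \<noteq> 0"
  shows "Poly_Mapping.single i 1 + (m - Poly_Mapping.single i 1) = m"
  using assms by (intro poly_mapping_eqI) (auto simp: lookup_add lookup_minus lookup_single when_def)

lemma lookup_mvar_mult:
  "Poly_Mapping.lookup (mvar i * p) m =
    (if Poly_Mapping.lookup m i = 0 then 0 else Poly_Mapping.lookup p (m - Poly_Mapping.single i 1))"
proof (cases "Poly_Mapping.lookup m i = 0")
  case True
  then have "m \<noteq> Poly_Mapping.single i 1 + q" for q by (auto simp: lookup_add)
  from lookup_single_times(2)[OF this] True show ?thesis by (simp add: mvar_def)
next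
  case False
  with lookup_single_times(1)[of "Poly_Mapping.single i 1" 1 p "m - Poly_Mapping.single i 1"]
  show ?thesis by (simp add: exponent_split[OF False] mvar_def del: One_nat_def)
qed

lemma lookup_mpderiv:
  "Poly_Mapping.lookup (mpderiv i p) m =
    of_nat (Suc (Poly_Mapping.lookup m i)) * Poly_Mapping.lookup p (m + Poly_Mapping.single i 1)"
proof -
  let ?e = "Poly_Mapping.single i (1::nat)"
  have "Poly_Mapping.lookup (mpderiv i p) m = (\<Sum>k\<in>Poly_Mapping.keys p.
      (if k = m + ?e then of_nat (Poly_Mapping.lookup k i) * Poly_Mapping.lookup p k else 0))"
    unfolding mpderiv_def lookup_sum
  proof (rule sum.cong[OF refl])
    fix k
    show "Poly_Mapping.lookup (Poly_Mapping.single (k - ?e)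
        (of_nat (Poly_Mapping.lookup k i) * Poly_Mapping.lookup p k)) m =
      (if k = m + ?e then of_nat (Poly_Mapping.lookup k i) * Poly_Mapping.lookup p k else 0)"
    proof (cases "Poly_Mapping.lookup k i = 0")
      case True
      then have "k \<noteq> m + ?e" by (auto simp: lookup_add)
      with True show ?thesis by simp
    next
      case False
      then have "k - ?e = m \<longleftrightarrow> k = m + ?e"
        using exponent_split[of k i] by (auto simp: add.commute)
      then show ?thesis by (simp add: lookup_single when_def)
    qed
  qed
  also have "\<dots> = of_nat (Suc (Poly_Mapping.lookup m i)) * Poly_Mapping.lookup p (m + ?e)"
    by (simp add: sum.delta lookup_add in_keys_iff)
  finally show ?thesis .
qed

section \<open>Coordinate operators and their coefficients\<close>

definition sscale :: "complex \<Rightarrow> 'n::{finite, linorder} superspace \<Rightarrow> 'n superspace"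
  where "sscale c f = of_mpoly (mconst c) * f"

definition mulx :: "'n \<Rightarrow> 'n::{finite, linorder} superspace \<Rightarrow> 'n superspace"
  where "mulx i f = of_mpoly (mvar i) * f"

definition multheta :: "'n \<Rightarrow> 'n::{finite, linorder} superspace \<Rightarrow> 'n superspace"
  where "multheta i f = theta i * f"

text \<open>The sign picked up when \<open>theta i\<close>, placed in front of the product over
  \<open>S\<close>, is moved to its position in increasing order.\<close>

definition position_sign :: "'n::linorder \<Rightarrow> 'n set \<Rightarrow> complex"
  where "position_sign i S = (- 1) ^ card {t\<in>S. t < i}"

text \<open>Left derivative with respect to \<open>theta i\<close>. It carries the same sign as left
  multiplication, which makes the two adjoint in \<open>pairing_multheta\<close>.\<close>

definition contract_theta :: "'n \<Rightarrow> 'n::{finite, linorder} superspace \<Rightarrow> 'n superspace"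
  where "contract_theta i f =
    Superspace (\<lambda>S. if i \<in> S then 0 else mconst (position_sign i S) * theta_coeff f (insert i S))"

lemma coef_zero [simp]: "coef 0 S m = 0"
  by (simp add: zero_superspace.rep_eq)

lemma coef_one: "coef 1 S m = (if S = {} \<and> m = 0 then 1 else 0)"
  by (simp add: one_superspace.rep_eq lookup_one when_def)

lemma coef_add [simp]: "coef (f + g) S m = coef f S m + coef g S m"
  by (simp add: plus_superspace.rep_eq lookup_add)

lemma coef_minus [simp]: "coef (f - g) S m = coef f S m - coef g S m"
  by (simp add: minus_superspace.rep_eq lookup_minus)

lemma coef_uminus [simp]: "coef (- f) S m = - coef f S m"
  by (simp add: uminus_superspace.rep_eq)

lemma coef_sum [simp]: "coef (sum F A) S m = (\<Sum>a\<in>A. coef (F a) S m)"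
  by (induction A rule: infinite_finite_induct) auto

lemma coef_sscale [simp]: "coef (sscale c f) S m = c * coef f S m"
  by (simp add: sscale_def theta_coeff_of_mpoly_mult lookup_mconst_mult)

lemma coef_mulx:
  "coef (mulx i f) S m =
    (if Poly_Mapping.lookup m i = 0 then 0 else coef f S (m - Poly_Mapping.single i 1))"
  by (simp add: mulx_def theta_coeff_of_mpoly_mult lookup_mvar_mult)

lemma coef_spderiv:
  "coef (spderiv i f) S m =
    of_nat (Suc (Poly_Mapping.lookup m i)) * coef f S (m + Poly_Mapping.single i 1)"
  by (simp add: theta_coeff_spderiv lookup_mpderiv)

lemma coef_contract_theta:
  "coef (contract_theta i f) S m = (if i \<in> S then 0 else position_sign i S * coef f (insert i S) m)"
  by (simp add: contract_theta_def Superspace_inverse lookup_mconst_mult)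

lemma lookup_neg_one_power_mult:
  fixes p :: "'n mpoly"
  shows "Poly_Mapping.lookup ((- 1) ^ k * p) m = (- 1) ^ k * Poly_Mapping.lookup p m"
  by (induction k) auto

lemma coef_multheta:
  "coef (multheta i f) S m =
    (if i \<in> S then position_sign i (S - {i}) * coef f (S - {i}) m else 0)"
proof -
  have "theta_coeff (theta i * f) S =
      (\<Sum>A\<in>Pow S. if A = {i} then theta_sign A (S - A) * theta_coeff f (S - A) else 0)"
    unfolding times_superspace.rep_eq theta_coeff_theta by (rule sum.cong) auto
  also have "\<dots> = (if i \<in> S then theta_sign {i} (S - {i}) * theta_coeff f (S - {i}) else 0)"
    by (simp add: sum.delta)
  finally have *: "theta_coeff (theta i * f) S = \<dots>" .
  have "inversions {i} (S - {i}) = Pair i ` {t \<in> S - {i}. t < i}"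
    by (auto simp: inversions_def)
  then have "card (inversions {i} (S - {i})) = card {t \<in> S - {i}. t < i}"
    by (simp add: card_image inj_on_def)
  then show ?thesis
    by (simp add: multheta_def * theta_sign_def position_sign_def lookup_neg_one_power_mult)
qed

interpretation ss: vector_space "sscale :: complex \<Rightarrow> 'n::{finite, linorder} superspace \<Rightarrow> 'n superspace"
  by unfold_locales (auto intro!: superspace_coef_eqI simp: algebra_simps)

interpretation ss_pair: vector_space_pair
  "sscale :: complex \<Rightarrow> 'n::{finite, linorder} superspace \<Rightarrow> 'n superspace"
  "sscale :: complex \<Rightarrow> 'n::{finite, linorder} superspace \<Rightarrow> 'n superspace" ..

abbreviation slinear :: "('n::{finite, linorder} superspace \<Rightarrow> 'n superspace) \<Rightarrow> bool"
  where "slinear \<equiv> Vector_Spaces.linear sscale sscale"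

lemma slinearI:
  assumes "\<And>f g. F (f + g) = F f + F g" "\<And>c f. F (sscale c f) = sscale c (F f)"
  shows "slinear F"
  using assms by unfold_locales auto

lemma slinear_mulx: "slinear (mulx i)"
  by (rule slinearI; rule superspace_coef_eqI) (auto simp: coef_mulx)

lemma slinear_spderiv: "slinear (spderiv i)"
  by (rule slinearI; rule superspace_coef_eqI) (auto simp: coef_spderiv algebra_simps)

lemma slinear_multheta: "slinear (multheta i)"
  by (rule slinearI; rule superspace_coef_eqI) (auto simp: coef_multheta algebra_simps)

lemma slinear_contract_theta: "slinear (contract_theta i)"
  by (rule slinearI; rule superspace_coef_eqI) (auto simp: coef_contract_theta algebra_simps)

section \<open>Weyl and Clifford relations\<close>

text \<open>Evaluation of a linear form at a direction; bilinear, without conjugation, since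
  directions range over all complex vectors.\<close>

definition dotp :: "complex ^ 'n::finite \<Rightarrow> complex ^ 'n \<Rightarrow> complex"
  where "dotp a l = (\<Sum>i\<in>UNIV. a $ i * l $ i)"

definition op_comb :: "('n \<Rightarrow> 'n superspace \<Rightarrow> 'n superspace) \<Rightarrow>
    complex ^ 'n::{finite, linorder} \<Rightarrow> 'n superspace \<Rightarrow> 'n superspace"
  where "op_comb F v f = (\<Sum>i\<in>UNIV. sscale (v $ i) (F i f))"

lemma slinear_op_comb:
  assumes "\<And>i. slinear (F i)"
  shows "slinear (op_comb F v)"
proof (rule slinearI)
  interpret F: Vector_Spaces.linear sscale sscale "F i" for i by (rule assms)
  show "op_comb F v (f + g) = op_comb F v f + op_comb F v g" for f g
    by (simp add: op_comb_def F.add ss.scale_right_distrib sum.distrib)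
  show "op_comb F v (sscale c f) = sscale c (op_comb F v f)" for c f
    by (simp add: op_comb_def F.scale ss.scale_sum_right mult.commute)
qed

text \<open>One computation serves all pairs of coordinate operators: \<open>s\<close> is 1 for
  commuting and -1 for anticommuting families, and \<open>c\<close> is 1 for the Weyl pair
  \<open>spderiv\<close>, \<open>mulx\<close> and the Clifford pair \<open>contract_theta\<close>,
  \<open>multheta\<close>, and 0 otherwise.\<close>

lemma op_comb_relation:
  assumes "\<And>i. slinear (F i)" "\<And>j. slinear (G j)"
    and rel: "\<And>i j f. F i (G j f) = sscale s (G j (F i f)) + (if i = j then sscale c f else 0)"
  shows "op_comb F l (op_comb G a f) = sscale s (op_comb G a (op_comb F l f)) + sscale (c * dotp a l) f"
proof -
  interpret F: Vector_Spaces.linear sscale sscale "F i" for i by (rule assms)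
  interpret G: Vector_Spaces.linear sscale sscale "G i" for i by (rule assms)
  have "op_comb F l (op_comb G a f) = (\<Sum>i\<in>UNIV. \<Sum>j\<in>UNIV. sscale (l $ i * a $ j) (F i (G j f)))"
    by (simp add: op_comb_def F.sum F.scale ss.scale_sum_right)
  also have "\<dots> = (\<Sum>i\<in>UNIV. \<Sum>j\<in>UNIV. sscale (s * (l $ i * a $ j)) (G j (F i f))) +
      (\<Sum>i\<in>UNIV. \<Sum>j\<in>UNIV. if i = j then sscale (l $ i * a $ j * c) f else 0)"
    unfolding sum.distrib[symmetric]
    by (intro sum.cong refl) (auto simp: rel ss.scale_right_distrib mult_ac)
  also have "(\<Sum>i\<in>UNIV. \<Sum>j\<in>UNIV. if i = j then sscale (l $ i * a $ j * c) f else 0)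
      = sscale (c * dotp a l) f"
    by (simp add: dotp_def ss.scale_sum_left sum_distrib_left mult_ac)
  also have "(\<Sum>i\<in>UNIV. \<Sum>j\<in>UNIV. sscale (s * (l $ i * a $ j)) (G j (F i f))) =
      (\<Sum>j\<in>UNIV. \<Sum>i\<in>UNIV. sscale (s * (l $ i * a $ j)) (G j (F i f)))"
    by (rule sum.swap)
  also have "\<dots> = sscale s (op_comb G a (op_comb F l f))"
    by (simp add: op_comb_def G.sum G.scale ss.scale_sum_right mult_ac)
  finally show ?thesis .
qed

definition mulX :: "complex ^ 'n::{finite, linorder} \<Rightarrow> 'n superspace \<Rightarrow> 'n superspace"
  where "mulX = op_comb mulx"

definition mulT :: "complex ^ 'n::{finite, linorder} \<Rightarrow> 'n superspace \<Rightarrow> 'n superspace"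
  where "mulT = op_comb multheta"

definition dd :: "complex ^ 'n::{finite, linorder} \<Rightarrow> 'n superspace \<Rightarrow> 'n superspace"
  where "dd = op_comb spderiv"

definition ii :: "complex ^ 'n::{finite, linorder} \<Rightarrow> 'n superspace \<Rightarrow> 'n superspace"
  where "ii = op_comb contract_theta"

lemmas op_defs = mulX_def mulT_def dd_def ii_def
lemmas slinear_gens = slinear_mulx slinear_multheta slinear_spderiv slinear_contract_theta

lemma slinear_ops: "slinear (mulX a)" "slinear (mulT a)" "slinear (dd l)" "slinear (ii l)"
  unfolding op_defs by (intro slinear_op_comb slinear_gens)+

global_interpretation mulX: Vector_Spaces.linear sscale sscale "mulX a" for a by (rule slinear_ops)
global_interpretation mulT: Vector_Spaces.linear sscale sscale "mulT a" for a by (rule slinear_ops)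
global_interpretation dd: Vector_Spaces.linear sscale sscale "dd l" for l by (rule slinear_ops)
global_interpretation ii: Vector_Spaces.linear sscale sscale "ii l" for l by (rule slinear_ops)

lemma position_sign_cancel [simp]: "position_sign i S * (position_sign i S * c) = c"
  by (simp add: position_sign_def flip: power_add mult.assoc)

lemma position_sign_insert:
  fixes i j :: "'n::{finite, linorder}"
  assumes "j \<notin> S"
  shows "position_sign i (insert j S) = (if j < i then - position_sign i S else position_sign i S)"
proof -
  have "{t \<in> insert j S. t < i} = (if j < i then insert j {t\<in>S. t < i} else {t\<in>S. t < i})"
    by auto
  with assms show ?thesis by (simp add: position_sign_def)
qed

lemma multheta_multheta: "multheta i (multheta j f) = - multheta j (multheta i f)"
  by (simp add: multheta_def theta_anticommute[of i j] flip: mult.assoc)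

lemma mulx_mulx: "mulx i (mulx j f) = mulx j (mulx i f)"
  by (simp add: mulx_def mult.commute flip: mult.assoc of_mpoly_mult)

lemma mulx_multheta: "mulx i (multheta j f) = multheta j (mulx i f)"
  by (rule superspace_coef_eqI) (auto simp: coef_mulx coef_multheta)

lemma spderiv_multheta: "spderiv i (multheta j f) = multheta j (spderiv i f)"
  by (rule superspace_coef_eqI) (auto simp: coef_spderiv coef_multheta)

lemma spderiv_contract_theta: "spderiv i (contract_theta j f) = contract_theta j (spderiv i f)"
  by (rule superspace_coef_eqI) (auto simp: coef_spderiv coef_contract_theta)

lemma contract_theta_mulx: "contract_theta i (mulx j f) = mulx j (contract_theta i f)"
  by (rule superspace_coef_eqI) (auto simp: coef_mulx coef_contract_theta)

lemma spderiv_spderiv: "spderiv i (spderiv j f) = spderiv j (spderiv i f)"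
proof (rule superspace_coef_eqI)
  fix S and m :: "'a \<Rightarrow>\<^sub>0 nat"
  show "coef (spderiv i (spderiv j f)) S m = coef (spderiv j (spderiv i f)) S m"
    by (cases "i = j") (simp_all add: coef_spderiv lookup_add lookup_single add_ac)
qed

lemma spderiv_mulx: "spderiv i (mulx j f) = mulx j (spderiv i f) + (if i = j then f else 0)"
proof (rule superspace_coef_eqI)
  fix S and m :: "'a \<Rightarrow>\<^sub>0 nat"
  let ?e = "\<lambda>i. Poly_Mapping.single i (1::nat)"
  show "coef (spderiv i (mulx j f)) S m = coef (mulx j (spderiv i f) + (if i = j then f else 0)) S m"
  proof (cases "i = j")
    case True
    have "m - ?e i + ?e i = m" if "Poly_Mapping.lookup m i \<noteq> 0"
      using exponent_split[OF that] by (simp add: add.commute)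
    moreover have "m + ?e i - ?e i = m" by simp
    moreover have "Poly_Mapping.lookup (m - ?e i) i = Poly_Mapping.lookup m i - 1"
      "Poly_Mapping.lookup (m + ?e i) i = Poly_Mapping.lookup m i + 1"
      by (simp_all add: lookup_add lookup_minus)
    ultimately show ?thesis
      using True by (cases "Poly_Mapping.lookup m i") (simp_all add: coef_spderiv coef_mulx ring_distribs)
  next
    case False
    have 1: "m + ?e i - ?e j = m - ?e j + ?e i" if "Poly_Mapping.lookup m j \<noteq> 0"
      using that False by (intro poly_mapping_eqI) (auto simp: lookup_add lookup_minus lookup_single when_def)
    have 2: "Poly_Mapping.lookup (m - ?e j) i = Poly_Mapping.lookup m i"
      "Poly_Mapping.lookup (m + ?e i) j = Poly_Mapping.lookup m j"
      using False by (simp_all add: lookup_add lookup_minus lookup_single)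
    show ?thesis
    proof (cases "Poly_Mapping.lookup m j = 0")
      case True
      then show ?thesis using False by (simp add: coef_spderiv coef_mulx 2 del: One_nat_def)
    next
      case nz: False
      then show ?thesis
        by (simp only: coef_spderiv coef_mulx coef_add 2 if_False 1[OF nz])
          (simp only: False if_False simp_thms coef_zero add_0_right)
    qed
  qed
qed

lemma contract_theta_multheta_same:
  "contract_theta i (multheta i f) = - multheta i (contract_theta i f) + f"
proof (rule superspace_coef_eqI)
  fix S m
  show "coef (contract_theta i (multheta i f)) S m = coef (- multheta i (contract_theta i f) + f) S m"
  proof (cases "i \<in> S")
    case True
    then show ?thesis
      by (simp only: coef_contract_theta coef_multheta coef_add coef_uminus if_True)
        (simp add: insert_absorb)
  next
    case False
    then show ?thesis
      by (simp only: coef_contract_theta coef_multheta coef_add coef_uminus if_False) simp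
  qed
qed

text \<open>The two orders of inserting \<open>i\<close> and deleting \<open>j\<close> compare the
  indices in opposite ways, and exactly one of the comparisons flips a sign.\<close>

lemma contract_theta_multheta_distinct:
  assumes "i \<noteq> j"
  shows "contract_theta i (multheta j f) = - multheta j (contract_theta i f)"
proof (rule superspace_coef_eqI)
  fix S and m :: "'a \<Rightarrow>\<^sub>0 nat"
  show "coef (contract_theta i (multheta j f)) S m = coef (- multheta j (contract_theta i f)) S m"
  proof (cases "i \<notin> S \<and> j \<in> S")
    case True
    define R where "R = S - {j}"
    have S: "S = insert j R" "j \<notin> R" "i \<notin> R" using True by (auto simp: R_def)
    have eqs: "insert i (insert j R) - {j} = insert i R" "insert j R - {j} = R"
      using assms S(2,3) by blast+
    have "position_sign i (insert j R) * position_sign j (insert i R) =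
        - (position_sign j R * position_sign i R)"
      using assms S(2,3) by (cases "i < j") (simp_all add: position_sign_insert not_less_iff_gr_or_eq)
    then show ?thesis
      using assms S(2,3) unfolding S(1)
      by (simp add: coef_contract_theta coef_multheta eqs flip: mult.assoc)
  next
    case False
    then show ?thesis
      using assms by (auto simp: coef_contract_theta coef_multheta)
  qed
qed

lemma contract_theta_multheta:
  "contract_theta i (multheta j f) = - multheta j (contract_theta i f) + (if i = j then f else 0)"
  by (cases "i = j")
    (simp_all only: contract_theta_multheta_same contract_theta_multheta_distinct if_True if_False
      add_0_right simp_thms)

lemma contract_theta_contract_theta:
  "contract_theta i (contract_theta j f) = - contract_theta j (contract_theta i f)"
  by (rule superspace_coef_eqI)
    (auto simp: coef_contract_theta position_sign_insert insert_commute neq_iff)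

lemma mulX_mulX: "mulX a (mulX b f) = mulX b (mulX a f)"
  using op_comb_relation[of mulx mulx 1 0 a b f] by (simp add: op_defs slinear_gens mulx_mulx)

lemma mulX_mulT: "mulX a (mulT b f) = mulT b (mulX a f)"
  using op_comb_relation[of mulx multheta 1 0 a b f]
  by (simp add: op_defs slinear_gens mulx_multheta)

lemma mulT_mulT: "mulT a (mulT b f) = - mulT b (mulT a f)"
proof -
  have "op_comb multheta a (op_comb multheta b f) =
      sscale (- 1) (op_comb multheta b (op_comb multheta a f)) + sscale (0 * dotp b a) f"
    by (rule op_comb_relation[OF slinear_multheta slinear_multheta]) (subst multheta_multheta, simp)
  then show ?thesis by (simp add: mulT_def)
qed

lemma dd_dd: "dd a (dd b f) = dd b (dd a f)"
  using op_comb_relation[of spderiv spderiv 1 0 a b f]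
  by (simp add: op_defs slinear_gens spderiv_spderiv)

lemma dd_ii: "dd a (ii b f) = ii b (dd a f)"
  using op_comb_relation[of spderiv contract_theta 1 0 a b f]
  by (simp add: op_defs slinear_gens spderiv_contract_theta)

lemma ii_ii: "ii a (ii b f) = - ii b (ii a f)"
proof -
  have "op_comb contract_theta a (op_comb contract_theta b f) =
      sscale (- 1) (op_comb contract_theta b (op_comb contract_theta a f)) + sscale (0 * dotp b a) f"
    by (rule op_comb_relation[OF slinear_contract_theta slinear_contract_theta])
      (subst contract_theta_contract_theta, simp)
  then show ?thesis by (simp add: ii_def)
qed

lemma dd_mulX: "dd l (mulX a f) = mulX a (dd l f) + sscale (dotp a l) f"
  using op_comb_relation[of spderiv mulx 1 1 l a f]
  by (simp add: op_defs slinear_gens spderiv_mulx)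

lemma dd_mulT: "dd l (mulT a f) = mulT a (dd l f)"
  using op_comb_relation[of spderiv multheta 1 0 l a f]
  by (simp add: op_defs slinear_gens spderiv_multheta)

lemma ii_mulX: "ii l (mulX a f) = mulX a (ii l f)"
  using op_comb_relation[of contract_theta mulx 1 0 l a f]
  by (simp add: op_defs slinear_gens contract_theta_mulx)

lemma ii_mulT: "ii l (mulT a f) = - mulT a (ii l f) + sscale (dotp a l) f"
  using op_comb_relation[of contract_theta multheta "- 1" 1 l a f]
  by (simp add: op_defs slinear_gens contract_theta_multheta)

lemma op_comb_diff: "op_comb F (v - w) f = op_comb F v f - op_comb F w f"
  by (simp add: op_comb_def ss.scale_left_diff_distrib sum_subtractf)

lemma op_comb_smult: "op_comb F (c *s v) f = sscale c (op_comb F v f)"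
  by (simp add: op_comb_def ss.scale_sum_right)

lemma op_comb_zero: "op_comb F 0 f = 0"
  by (simp add: op_comb_def)

lemma op_comb_axis: "op_comb F (axis i 1) f = F i f"
proof -
  have "op_comb F (axis i 1) f = (\<Sum>j\<in>UNIV. if j = i then F j f else 0)"
    unfolding op_comb_def by (rule sum.cong) (auto simp: axis_def)
  then show ?thesis by simp
qed

lemma op_zero [simp]: "mulX 0 f = 0" "mulT 0 f = 0" "dd 0 f = 0" "ii 0 f = 0"
  by (simp_all add: op_defs op_comb_zero)

lemma ii_ii_same [simp]: "ii e (ii e f) = 0"
proof -
  have "sscale 2 (ii e (ii e f)) = ii e (ii e f) + ii e (ii e f)"
    by (rule superspace_coef_eqI) simp
  also have "\<dots> = 0" using ii_ii[of e e f] by (metis add.left_inverse)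
  finally show ?thesis by simp
qed

lemma mulT_mulT_same [simp]: "mulT e (mulT e f) = 0"
proof -
  have "sscale 2 (mulT e (mulT e f)) = mulT e (mulT e f) + mulT e (mulT e f)"
    by (rule superspace_coef_eqI) simp
  also have "\<dots> = 0" using mulT_mulT[of e e f] by (metis add.left_inverse)
  finally show ?thesis by simp
qed

section \<open>Homogeneous components\<close>

abbreviation bideg :: "nat \<Rightarrow> nat \<Rightarrow> 'n::finite superspace set"
  where "bideg \<equiv> superspace_component"

lemma bideg_iff:
  "f \<in> bideg i j \<longleftrightarrow> (\<forall>S m. coef f S m \<noteq> 0 \<longrightarrow> monom_degree m = i \<and> card S = j)"
  by (auto simp: superspace_component_def in_keys_iff)

lemma monom_degree_add: "monom_degree (m + n) = monom_degree m + monom_degree n"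
  by (simp add: monom_degree_def lookup_add sum.distrib)

lemma monom_degree_single [simp]: "monom_degree (Poly_Mapping.single i k) = k"
proof -
  have "monom_degree (Poly_Mapping.single i k) = (\<Sum>t\<in>UNIV. if t = i then k else 0)"
    unfolding monom_degree_def by (rule sum.cong) (auto simp: lookup_single when_def)
  then show ?thesis by simp
qed

lemma monom_degree_zero_iff [simp]: "monom_degree m = 0 \<longleftrightarrow> m = 0"
  by (auto simp: monom_degree_def intro!: poly_mapping_eqI)

lemma subspace_bideg: "ss.subspace (bideg i j)"
proof (rule ss.subspaceI, goal_cases)
  case (2 f g)
  then have "monom_degree m = i \<and> card S = j" if "coef f S m \<noteq> 0 \<or> coef g S m \<noteq> 0" for S m
    using that by (auto simp: bideg_iff)
  moreover have "coef f S m \<noteq> 0 \<or> coef g S m \<noteq> 0" if "coef (f + g) S m \<noteq> 0" for S m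
    using that by auto
  ultimately show ?case unfolding bideg_iff by blast
qed (auto simp: bideg_iff)

lemmas bideg_closed =
  ss.subspace_0[OF subspace_bideg] ss.subspace_add[OF subspace_bideg]
  ss.subspace_diff[OF subspace_bideg] ss.subspace_neg[OF subspace_bideg]
  ss.subspace_scale[OF subspace_bideg] ss.subspace_sum[OF subspace_bideg]

lemma mulx_component: "f \<in> bideg i j \<Longrightarrow> mulx k f \<in> bideg (Suc i) j"
  unfolding bideg_iff coef_mulx
proof (intro allI impI)
  fix S and m :: "'a \<Rightarrow>\<^sub>0 nat"
  assume f: "\<forall>S m. coef f S m \<noteq> 0 \<longrightarrow> monom_degree m = i \<and> card S = j"
    and "(if Poly_Mapping.lookup m k = 0 then 0 else coef f S (m - Poly_Mapping.single k 1)) \<noteq> 0"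
  then have "Poly_Mapping.lookup m k \<noteq> 0" and nz: "coef f S (m - Poly_Mapping.single k 1) \<noteq> 0"
    by (auto split: if_splits)
  from exponent_split[OF this(1)] have "monom_degree m = Suc (monom_degree (m - Poly_Mapping.single k 1))"
    by (metis monom_degree_add monom_degree_single plus_1_eq_Suc)
  with f nz show "monom_degree m = Suc i \<and> card S = j" by auto
qed

lemma spderiv_component:
  "f \<in> bideg (Suc i) j \<Longrightarrow> spderiv k f \<in> bideg i j"
  by (fastforce simp: bideg_iff coef_spderiv monom_degree_add)

lemma spderiv_component_0: "f \<in> bideg 0 j \<Longrightarrow> spderiv k f = 0"
  by (rule superspace_coef_eqI) (force simp: bideg_iff coef_spderiv monom_degree_add
      simp del: monom_degree_zero_iff)

lemma multheta_component:
  "f \<in> bideg i j \<Longrightarrow> multheta k f \<in> bideg i (Suc j)"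
  unfolding bideg_iff coef_multheta
  by (auto simp: card_Suc_Diff1 split: if_splits) (metis card_Suc_Diff1 finite)

lemma contract_theta_component:
  "f \<in> bideg i (Suc j) \<Longrightarrow> contract_theta k f \<in> bideg i j"
  by (fastforce simp: bideg_iff coef_contract_theta)

lemma contract_theta_component_0: "f \<in> bideg i 0 \<Longrightarrow> contract_theta k f = 0"
  by (rule superspace_coef_eqI) (force simp: bideg_iff coef_contract_theta)

lemma op_comb_component:
  assumes "\<And>k. F k f \<in> bideg i j"
  shows "op_comb F v f \<in> bideg i j"
  unfolding op_comb_def by (intro bideg_closed assms)

lemma mulX_component: "f \<in> bideg i j \<Longrightarrow> mulX a f \<in> bideg (Suc i) j"
  unfolding mulX_def by (intro op_comb_component mulx_component)

lemma mulT_component: "f \<in> bideg i j \<Longrightarrow> mulT a f \<in> bideg i (Suc j)"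
  unfolding mulT_def by (intro op_comb_component multheta_component)

lemma dd_component: "f \<in> bideg (Suc i) j \<Longrightarrow> dd l f \<in> bideg i j"
  unfolding dd_def by (intro op_comb_component spderiv_component)

lemma dd_component_0: "f \<in> bideg 0 j \<Longrightarrow> dd l f = 0"
  unfolding dd_def op_comb_def by (simp add: spderiv_component_0)

lemma ii_component: "f \<in> bideg i (Suc j) \<Longrightarrow> ii l f \<in> bideg i j"
  unfolding ii_def by (intro op_comb_component contract_theta_component)

lemma ii_component_0: "f \<in> bideg i 0 \<Longrightarrow> ii l f = 0"
  unfolding ii_def op_comb_def by (simp add: contract_theta_component_0)

text \<open>For \<open>j = 0\<close> the truncated index is harmless: the contraction is then 0,
  which lies in every component.\<close>

lemma ii_component_pred: "f \<in> bideg i j \<Longrightarrow> ii l f \<in> bideg i (j - 1)"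
  by (cases j) (auto simp: ii_component_0 bideg_closed intro: ii_component)

lemma one_component: "1 \<in> bideg 0 0"
  by (simp add: bideg_iff coef_one)

lemma dd_one [simp]: "dd l 1 = 0" and ii_one [simp]: "ii l 1 = 0"
  using one_component dd_component_0 ii_component_0 by blast+

lemma mulX_pow_component:
  "f \<in> bideg i j \<Longrightarrow> (mulX a ^^ k) f \<in> bideg (i + k) j"
  by (induction k) (auto intro: mulX_component)

lemma dd_pow_component:
  "f \<in> bideg i j \<Longrightarrow> (dd l ^^ k) f \<in> bideg (i - k) j"
proof (induction k)
  case (Suc k)
  then show ?case
    by (cases "i - k") (auto simp: dd_component_0 bideg_closed Suc_diff_Suc
        diff_Suc intro: dd_component split: nat.splits)
qed simp

lemma funpow_eq_0_mono:
  assumes "slinear F" "(F ^^ m) f = 0" "m \<le> n"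
  shows "(F ^^ n) f = 0"
proof -
  interpret Vector_Spaces.linear sscale sscale F by fact
  obtain k where "n = k + m" using assms(3) by (metis le_add_diff_inverse2)
  moreover have "(F ^^ k) 0 = 0" by (induction k) simp_all
  ultimately show ?thesis using assms(2) by (simp add: funpow_add)
qed

lemma dd_pow_0_mono: "(dd l ^^ m) f = 0 \<Longrightarrow> m \<le> n \<Longrightarrow> (dd l ^^ n) f = 0"
  by (rule funpow_eq_0_mono[OF slinear_ops(3)])

lemma dd_pow_nilpotent: "f \<in> bideg i j \<Longrightarrow> i < n \<Longrightarrow> (dd l ^^ n) f = 0"
proof (rule dd_pow_0_mono[where m = "Suc i"])
  assume "f \<in> bideg i j"
  from dd_pow_component[OF this, where l = l and k = i] show "(dd l ^^ Suc i) f = 0"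
    by (simp add: dd_component_0)
qed simp

lemma slinear_funpow:
  assumes "slinear F"
  shows "slinear (F ^^ n)"
proof -
  interpret F: Vector_Spaces.linear sscale sscale F by fact
  show ?thesis by (rule slinearI; induction n) (simp_all add: F.add F.scale)
qed

global_interpretation dd_pow: Vector_Spaces.linear sscale sscale "dd l ^^ n" for l n
  by (rule slinear_funpow[OF slinear_ops(3)])
global_interpretation mulX_pow: Vector_Spaces.linear sscale sscale "mulX a ^^ n" for a n
  by (rule slinear_funpow[OF slinear_ops(1)])

lemma funpow_commute:
  assumes "\<And>f. F (G f) = G (F f)"
  shows "(F ^^ n) (G f) = G ((F ^^ n) f)"
  by (induction n) (simp_all add: assms)

lemmas dd_pow_mulT = funpow_commute[of "dd l" "mulT a", OF dd_mulT] for l a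
lemmas dd_pow_ii = funpow_commute[of "dd l" "ii a", OF dd_ii] for l a
lemmas dd_pow_dd = funpow_commute[of "dd l" "dd a", OF dd_dd] for l a
lemmas mulX_pow_mulX = funpow_commute[of "mulX l" "mulX a", OF mulX_mulX] for l a
lemmas mulX_pow_mulT = funpow_commute[of "mulX l" "mulT a", OF mulX_mulT] for l a
lemmas mulX_pow_ii = funpow_commute[of "mulX a" "ii l", OF ii_mulX[symmetric]] for l a

text \<open>Iterated Weyl relation. At \<open>n = 0\<close> the coefficient vanishes, so the
  truncated exponent \<open>n - 1\<close> is harmless.\<close>

lemma dd_pow_mulX:
  "(dd l ^^ n) (mulX a f) = mulX a ((dd l ^^ n) f) + sscale (of_nat n * dotp a l) ((dd l ^^ (n - 1)) f)"
proof (induction n)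
  case (Suc n)
  have "dd l ((dd l ^^ (n - 1)) f) = (dd l ^^ n) f" if "n \<noteq> 0"
    using that by (cases n) auto
  then have "sscale (of_nat n * dotp a l) (dd l ((dd l ^^ (n - 1)) f)) =
      sscale (of_nat n * dotp a l) ((dd l ^^ n) f)" by (cases "n = 0") auto
  then show ?case
    by (simp add: Suc dd.add dd.scale dd_mulX ring_distribs ss.scale_left_distrib)
qed simp

lemma dd_mulX_pow:
  "dd l ((mulX a ^^ n) f) = (mulX a ^^ n) (dd l f) + sscale (of_nat n * dotp a l) ((mulX a ^^ (n - 1)) f)"
proof (induction n)
  case (Suc n)
  have "mulX a ((mulX a ^^ (n - 1)) f) = (mulX a ^^ n) f" if "n \<noteq> 0"
    using that by (cases n) auto
  then have "sscale (of_nat n * dotp a l) (mulX a ((mulX a ^^ (n - 1)) f)) =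
      sscale (of_nat n * dotp a l) ((mulX a ^^ n) f)" by (cases "n = 0") auto
  then show ?case
    by (simp add: Suc mulX.add mulX.scale dd_mulX ring_distribs ss.scale_left_distrib)
qed simp

text \<open>Let N be the order of nilpotency of the derivative on \<open>u\<close>. If N exceeded
  \<open>n\<close>, applying N derivatives to \<open>mulX a u\<close> would kill the first Weyl term
  and leave N a(l) times the derivative of order N - 1, which is nonzero by minimality and
  characteristic 0.\<close>

lemma dd_pow_mulX_cancel:
  assumes "dotp a l \<noteq> 0" and u: "u \<in> bideg i j"
    and zero: "(dd l ^^ Suc n) (mulX a u) = 0"
  shows "(dd l ^^ n) u = 0"
proof -
  define N where "N = (LEAST N. (dd l ^^ N) u = 0)"
  have N: "(dd l ^^ N) u = 0"
    unfolding N_def by (rule LeastI[of _ "Suc i"]) (use dd_pow_nilpotent[OF u] in blast)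
  have "N \<le> n"
  proof (rule ccontr)
    assume "\<not> N \<le> n"
    then obtain k where k: "N = Suc k" "n \<le> k" by (cases N) auto
    have "0 = (dd l ^^ Suc k) (mulX a u)"
      using dd_pow_0_mono[OF zero, of "Suc k"] k by simp
    also have "\<dots> = sscale (of_nat (Suc k) * dotp a l) ((dd l ^^ k) u)"
      unfolding dd_pow_mulX using N k(1) by simp
    finally have "(dd l ^^ k) u = 0" using assms(1) by (simp del: of_nat_Suc)
    then have "N \<le> k" unfolding N_def by (rule Least_le)
    with k show False by simp
  qed
  with N show ?thesis by (rule dd_pow_0_mono)
qed

section \<open>A transversal direction for a normal, and contraction of forms\<close>

definition pivot :: "'a::field ^ 'n \<Rightarrow> 'n"
  where "pivot a = (SOME i. a $ i \<noteq> 0)"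

lemma pivot_nonzero:
  assumes "a \<noteq> 0"
  shows "a $ pivot a \<noteq> 0"
proof -
  have "\<exists>i. a $ i \<noteq> 0" using assms by (auto simp: vec_eq_iff)
  then show ?thesis unfolding pivot_def by (rule someI_ex)
qed

text \<open>The image of \<open>b\<close> in the quotient by \<open>a\<close>, represented by a form without the variable at the
  pivot of \<open>a\<close>.\<close>

definition contract :: "'a::field ^ 'n \<Rightarrow> 'a ^ 'n \<Rightarrow> 'a ^ 'n"
  where "contract a b = b - (b $ pivot a / a $ pivot a) *s a"

text \<open>The direction e with a(e) = 1 for nonzero \<open>a\<close>, chosen along the pivot
  coordinate so that \<open>contract a b\<close> is b - b(e) a.\<close>

definition pivot_dual :: "complex ^ 'n \<Rightarrow> complex ^ 'n"
  where "pivot_dual a = axis (pivot a) (1 / a $ pivot a)"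

lemma dotp_pivot_dual: "dotp b (pivot_dual a) = b $ pivot a / a $ pivot a"
proof -
  have "dotp b (pivot_dual a) = (\<Sum>i\<in>UNIV. if i = pivot a then b $ i / a $ pivot a else 0)"
    unfolding dotp_def pivot_dual_def by (rule sum.cong) (auto simp: axis_def)
  then show ?thesis by simp
qed

lemma contract_dotp: "contract a b = b - dotp b (pivot_dual a) *s a"
  by (simp add: contract_def dotp_pivot_dual)

lemma dotp_pivot_dual_self: "a \<noteq> 0 \<Longrightarrow> dotp a (pivot_dual a) = 1"
  by (simp add: dotp_pivot_dual pivot_nonzero)

lemma dotp_diff_left: "dotp (a - b) l = dotp a l - dotp b l"
  by (simp add: dotp_def left_diff_distrib sum_subtractf)
lemma dotp_diff_right: "dotp a (l - m) = dotp a l - dotp a m"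
  by (simp add: dotp_def right_diff_distrib sum_subtractf)
lemma dotp_smult_left: "dotp (c *s a) l = c * dotp a l"
  by (simp add: dotp_def sum_distrib_left mult_ac)
lemma dotp_smult_right: "dotp a (c *s l) = c * dotp a l"
  by (simp add: dotp_def sum_distrib_left mult_ac)

text \<open>Cancellation at order 0, in the direction where \<open>a\<close> takes the value
  1.\<close>

lemma mulX_zero_imp:
  assumes "a \<noteq> 0" "u \<in> bideg i j" "mulX a u = 0"
  shows "u = 0"
  using dd_pow_mulX_cancel[of a "pivot_dual a" u i j 0] assms
  by (simp add: dotp_pivot_dual_self)

lemma mulX_diff: "mulX (a - b) f = mulX a f - mulX b f"
  and mulX_smult: "mulX (c *s a) f = sscale c (mulX a f)"
  and dd_diff: "dd (a - b) f = dd a f - dd b f"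
  and dd_smult: "dd (c *s a) f = sscale c (dd a f)"
  and mulT_diff: "mulT (a - b) f = mulT a f - mulT b f"
  and mulT_smult: "mulT (c *s a) f = sscale c (mulT a f)"
  and ii_diff: "ii (a - b) f = ii a f - ii b f"
  and ii_smult: "ii (c *s a) f = sscale c (ii a f)"
  by (simp_all add: op_defs op_comb_diff op_comb_smult)

section \<open>Restriction to a hyperplane\<close>

text \<open>If \<open>a(e) = 1\<close>, the substitution \<open>x \<mapsto> x - a(x) e\<close> acts on polynomials of degree at most \<open>N\<close>
  by the Taylor expansion in the direction \<open>e\<close>, and on the odd variables by
  \<open>f \<mapsto> f - \<theta>\<^sub>a \<iota>\<^sub>e f\<close>.\<close>

definition taylor_coeff :: "nat \<Rightarrow> complex"
  where "taylor_coeff k = (- 1) ^ k / fact k"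

lemma taylor_coeff_Suc: "of_nat (Suc k) * taylor_coeff (Suc k) = - taylor_coeff k"
  by (simp add: taylor_coeff_def field_simps del: of_nat_Suc)

lemma taylor_coeff_0 [simp]: "taylor_coeff 0 = 1"
  by (simp add: taylor_coeff_def)

definition taylor :: "complex ^ 'n::{finite, linorder} \<Rightarrow> complex ^ 'n::{finite, linorder} \<Rightarrow> nat \<Rightarrow> 'n superspace \<Rightarrow> 'n superspace"
  where "taylor a e N f = (\<Sum>k\<le>N. sscale (taylor_coeff k) ((mulX a ^^ k) ((dd e ^^ k) f)))"

definition restrict_along :: "complex ^ 'n::{finite, linorder} \<Rightarrow> complex ^ 'n::{finite, linorder} \<Rightarrow> nat \<Rightarrow> 'n superspace \<Rightarrow> 'n superspace"
  where "restrict_along a e N f = taylor a e N (f - mulT a (ii e f))"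

lemma slinear_taylor: "slinear (taylor a e N)"
  by (rule slinearI)
    (simp_all add: taylor_def dd_pow.add dd_pow.scale mulX_pow.add mulX_pow.scale
      ss.scale_right_distrib sum.distrib ss.scale_sum_right mult.commute)

global_interpretation taylor: Vector_Spaces.linear sscale sscale "taylor a e N" for a e N
  by (rule slinear_taylor)

lemma slinear_restrict: "slinear (restrict_along a e N)"
  by (rule slinearI)
    (simp_all add: restrict_along_def ii.add ii.scale mulT.add mulT.scale taylor.add taylor.scale
      taylor.diff algebra_simps ss.scale_right_diff_distrib)

global_interpretation restrict_along: Vector_Spaces.linear sscale sscale "restrict_along a e N" for a e N
  by (rule slinear_restrict)

lemma taylor_ii: "ii l (taylor a e N f) = taylor a e N (ii l f)"
  by (simp add: taylor_def ii.sum ii.scale dd_pow_ii mulX_pow_ii)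

lemma taylor_mulT: "taylor a e N (mulT b f) = mulT b (taylor a e N f)"
  by (simp add: taylor_def mulT.sum mulT.scale dd_pow_mulT mulX_pow_mulT)

text \<open>The terms with \<open>k\<close> lowered by one, as they come from \<open>[\<partial>, X\<^sup>k]\<close> and \<open>[\<partial>\<^sup>k, X]\<close>.\<close>

lemma taylor_shift:
  "(\<Sum>k\<le>N. sscale (taylor_coeff k * of_nat k) (G (k - 1))) = - (\<Sum>k<N. sscale (taylor_coeff k) (G k))"
proof (cases N)
  case (Suc M)
  have "(\<Sum>k\<le>N. sscale (taylor_coeff k * of_nat k) (G (k - 1))) =
      (\<Sum>k\<le>M. sscale (taylor_coeff (Suc k) * of_nat (Suc k)) (G k))"
    unfolding Suc by (subst sum.atMost_Suc_shift) (simp del: of_nat_Suc)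
  also have "\<dots> = (\<Sum>k\<le>M. - sscale (taylor_coeff k) (G k))"
    by (simp only: mult.commute[of "taylor_coeff (Suc k)" for k] taylor_coeff_Suc ss.scale_minus_left)
  finally show ?thesis unfolding Suc by (simp add: sum_negf lessThan_Suc_atMost)
qed simp

lemma taylor_last:
  "(\<Sum>k\<le>N. G k) = (\<Sum>k<N. G k) + G N"
  for G :: "nat \<Rightarrow> 'n::{finite, linorder} superspace"
  by (metis lessThan_Suc_atMost sum.lessThan_Suc)

text \<open>Chain rule for the substitution: differentiating the powers of x_a supplies the
  correction by a(l) e. The hypothesis kills the term that truncation at \<open>N\<close> would
  leave over.\<close>

lemma taylor_dd:
  assumes "(dd e ^^ Suc N) f = 0"
  shows "dd l (taylor a e N f) = taylor a e N (dd (l - dotp a l *s e) f)"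
proof -
  have "dd l (taylor a e N f) = (\<Sum>k\<le>N. sscale (taylor_coeff k) ((mulX a ^^ k) ((dd e ^^ k) (dd l f)))) +
      sscale (dotp a l) (\<Sum>k\<le>N. sscale (taylor_coeff k * of_nat k) ((mulX a ^^ (k - 1)) ((dd e ^^ k) f)))"
    by (simp add: taylor_def dd.sum dd.scale dd_mulX_pow dd_pow_dd ss.scale_right_distrib
        sum.distrib ss.scale_sum_right mult_ac)
  also have "(\<Sum>k\<le>N. sscale (taylor_coeff k * of_nat k) ((mulX a ^^ (k - 1)) ((dd e ^^ k) f))) =
      (\<Sum>k\<le>N. sscale (taylor_coeff k * of_nat k) ((mulX a ^^ (k - 1)) ((dd e ^^ (k - 1)) (dd e f))))"
  proof (rule sum.cong[OF refl])
    fix k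
    show "sscale (taylor_coeff k * of_nat k) ((mulX a ^^ (k - 1)) ((dd e ^^ k) f)) =
      sscale (taylor_coeff k * of_nat k) ((mulX a ^^ (k - 1)) ((dd e ^^ (k - 1)) (dd e f)))"
      by (cases k) (simp_all only: of_nat_0 mult_zero_right ss.scale_zero_left funpow_Suc_right
          comp_apply diff_Suc_1)
  qed
  also have "\<dots> = - (\<Sum>k<N. sscale (taylor_coeff k) ((mulX a ^^ k) ((dd e ^^ k) (dd e f))))"
    by (rule taylor_shift)
  also have "\<dots> = - taylor a e N (dd e f)"
    using assms unfolding taylor_def taylor_last by (simp only: funpow_Suc_right comp_apply
        mulX_pow.zero ss.scale_zero_right add_0_right)
  finally show ?thesis
    by (simp add: taylor_def[symmetric] dd_diff dd_smult taylor.diff taylor.scale)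
qed

text \<open>Commuting x_b past the derivatives yields b(e) times a shifted sum, which resums to
  minus x_a times the whole Taylor sum. Multiplication by x_b raises the degree by one, so already
  \<open>N\<close> derivatives have to kill \<open>f\<close>.\<close>

lemma taylor_mulX:
  assumes "(dd e ^^ N) f = 0"
  shows "taylor a e N (mulX b f) = mulX (b - dotp b e *s a) (taylor a e N f)"
proof -
  have "taylor a e N (mulX b f) = (\<Sum>k\<le>N. sscale (taylor_coeff k) (mulX b ((mulX a ^^ k) ((dd e ^^ k) f)))) +
      sscale (dotp b e) (\<Sum>k\<le>N. sscale (taylor_coeff k * of_nat k) ((mulX a ^^ k) ((dd e ^^ (k - 1)) f)))"
    by (simp add: taylor_def dd_pow_mulX mulX_pow.add mulX_pow.scale mulX_pow_mulX
        ss.scale_right_distrib sum.distrib ss.scale_sum_right mult_ac)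
  also have "(\<Sum>k\<le>N. sscale (taylor_coeff k * of_nat k) ((mulX a ^^ k) ((dd e ^^ (k - 1)) f))) =
      (\<Sum>k\<le>N. sscale (taylor_coeff k * of_nat k) (mulX a ((mulX a ^^ (k - 1)) ((dd e ^^ (k - 1)) f))))"
  proof (rule sum.cong[OF refl])
    fix k
    show "sscale (taylor_coeff k * of_nat k) ((mulX a ^^ k) ((dd e ^^ (k - 1)) f)) =
      sscale (taylor_coeff k * of_nat k) (mulX a ((mulX a ^^ (k - 1)) ((dd e ^^ (k - 1)) f)))"
      by (cases k) (simp_all only: of_nat_0 mult_zero_right ss.scale_zero_left funpow.simps
          comp_apply diff_Suc_1)
  qed
  also have "\<dots> = - (\<Sum>k<N. sscale (taylor_coeff k) (mulX a ((mulX a ^^ k) ((dd e ^^ k) f))))"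
    by (rule taylor_shift)
  also have "\<dots> = - mulX a (taylor a e N f)"
    using assms unfolding taylor_def taylor_last
    by (simp add: mulX.sum mulX.scale)
  finally have "taylor a e N (mulX b f) =
      (\<Sum>k\<le>N. sscale (taylor_coeff k) (mulX b ((mulX a ^^ k) ((dd e ^^ k) f)))) +
      sscale (dotp b e) (- mulX a (taylor a e N f))" .
  also have "(\<Sum>k\<le>N. sscale (taylor_coeff k) (mulX b ((mulX a ^^ k) ((dd e ^^ k) f)))) =
      mulX b (taylor a e N f)"
    by (simp add: taylor_def mulX.sum mulX.scale)
  finally show ?thesis by (simp add: mulX_diff mulX_smult)
qed

lemma restrict_along_dd:
  assumes "(dd e ^^ Suc N) f = 0"
  shows "dd l (restrict_along a e N f) = restrict_along a e N (dd (l - dotp a l *s e) f)"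
proof -
  have "(dd e ^^ Suc N) (f - mulT a (ii e f)) = 0"
    using assms by (simp only: dd_pow.diff dd_pow_mulT dd_pow_ii ii.zero mulT.zero diff_zero)
  then show ?thesis
    by (simp add: restrict_along_def taylor_dd dd.diff dd_mulT dd_ii del: funpow.simps)
qed

lemma restrict_along_ii: "ii l (restrict_along a e N f) = restrict_along a e N (ii (l - dotp a l *s e) f)"
  unfolding restrict_along_def taylor_ii
  by (simp add: ii.diff ii_mulT ii_diff ii_smult ii.scale ii_ii[of e l] mulT.neg algebra_simps)

lemma restrict_along_mulX:
  assumes "(dd e ^^ N) f = 0"
  shows "restrict_along a e N (mulX b f) = mulX (b - dotp b e *s a) (restrict_along a e N f)"
proof -
  have "(dd e ^^ N) (f - mulT a (ii e f)) = 0"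
    using assms by (simp only: dd_pow.diff dd_pow_mulT dd_pow_ii ii.zero mulT.zero diff_zero)
  from taylor_mulX[OF this, of a b] show ?thesis
    by (simp add: restrict_along_def mulX.diff ii_mulX mulX_mulT)
qed

text \<open>With \<open>b = a\<close> and a(e) = 1 the right side is 0; this is how the restriction
  kills theta_a.\<close>

lemma restrict_along_mulT: "restrict_along a e N (mulT b f) = mulT (b - dotp b e *s a) (restrict_along a e N f)"
  unfolding restrict_along_def taylor_mulT[symmetric]
  by (simp add: mulT.diff ii_mulT mulT_diff mulT_smult mulT.neg mulT.scale mulT_mulT[of a b]
      algebra_simps)

lemma restrict_along_one: "restrict_along a e N (sscale c 1) = sscale c 1"
proof -
  have *: "(dd e ^^ k) 1 = 0" if "k \<noteq> 0" for k
    using that dd_pow_nilpotent[OF one_component, of k e] by simp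
  have "taylor a e N 1 = (\<Sum>k\<le>N. if k = 0 then 1 else 0)"
    unfolding taylor_def by (rule sum.cong) (auto simp: *)
  then show ?thesis by (simp add: restrict_along.scale) (simp add: restrict_along_def)
qed

lemma taylor_component:
  assumes "f \<in> bideg i j"
  shows "taylor a e N f \<in> bideg i j"
  unfolding taylor_def
proof (intro bideg_closed)
  fix k
  show "(mulX a ^^ k) ((dd e ^^ k) f) \<in> bideg i j"
  proof (cases "k \<le> i")
    case True
    with mulX_pow_component[OF dd_pow_component[OF assms, where l = e and k = k], where a = a and k = k] show ?thesis by simp
  next
    case False
    then show ?thesis by (simp add: dd_pow_nilpotent[OF assms] bideg_closed)
  qed
qed

lemma mulT_ii_component:
  "f \<in> bideg i j \<Longrightarrow> mulT a (ii e f) \<in> bideg i j"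
  by (cases j) (auto simp: ii_component_0 bideg_closed intro: mulT_component ii_component)

lemma restrict_along_component:
  "f \<in> bideg i j \<Longrightarrow> restrict_along a e N f \<in> bideg i j"
  unfolding restrict_along_def by (intro taylor_component bideg_closed mulT_ii_component)

text \<open>The term \<open>k = 0\<close> is \<open>f\<close> itself, and every later term contains
  a factor x_a.\<close>

lemma taylor_remainder:
  assumes "f \<in> bideg (Suc i) j"
  obtains g where "g \<in> bideg i j" "taylor a e N f = f + mulX a g"
proof
  let ?g = "\<Sum>k<N. sscale (taylor_coeff (Suc k)) ((mulX a ^^ k) ((dd e ^^ Suc k) f))"
  show "?g \<in> bideg i j"
  proof (intro bideg_closed)
    fix k
    show "(mulX a ^^ k) ((dd e ^^ Suc k) f) \<in> bideg i j"
    proof (cases "k \<le> i")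
      case True
      with mulX_pow_component[OF dd_pow_component[OF assms, where l = e and k = "Suc k"], where a = a and k = k] show ?thesis
        by (simp del: funpow.simps)
    next
      case False
      then have "(dd e ^^ Suc k) f = 0" using dd_pow_nilpotent[OF assms, of "Suc k"] by simp
      then show ?thesis by (simp add: bideg_closed del: funpow.simps)
    qed
  qed
  show "taylor a e N f = f + mulX a ?g"
    by (simp add: taylor_def sum.atMost_shift mulX.sum mulX.scale)
qed

lemma taylor_degree_0: "f \<in> bideg 0 j \<Longrightarrow> taylor a e N f = f"
proof -
  assume "f \<in> bideg 0 j"
  then have "(dd e ^^ Suc k) f = 0" for k using dd_pow_nilpotent by blast
  then show ?thesis by (simp add: taylor_def sum.atMost_shift del: funpow.simps)
qed

text \<open>Without x-variables the Taylor sum is the identity, and \<open>ii e\<close> squares to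
  0. So the vanishing restriction of \<open>ii e f\<close> gives \<open>ii e f = 0\<close>, and the
  other one then gives \<open>f = 0\<close>.\<close>

lemma restrict_along_kernel_0:
  assumes f: "f \<in> bideg 0 j"
    and "restrict_along a e N f = 0" "restrict_along a e N (ii e f) = 0"
  shows "f = 0"
proof -
  have "ii e f = 0"
    using assms(3) taylor_degree_0[OF ii_component_pred[OF f]] by (simp add: restrict_along_def)
  then show ?thesis
    using assms(2) f by (simp add: restrict_along_def taylor_degree_0)
qed

text \<open>Since \<open>ii e\<close> squares to 0, restricting \<open>ii e f\<close> involves no
  odd correction, and the Taylor remainder makes it divisible by x_a. The remainder for
  \<open>f - mulT a (ii e f)\<close> then makes \<open>f\<close> divisible as well.\<close>

lemma restrict_along_kernel_Suc:
  assumes f: "f \<in> bideg (Suc i) j"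
    and zero: "restrict_along a e N f = 0" "restrict_along a e N (ii e f) = 0"
  obtains g where "g \<in> bideg i j" "f = mulX a g"
proof -
  obtain h where h: "mulT a h \<in> bideg i j" "ii e f = mulX a h"
  proof (cases j)
    case 0
    then show ?thesis using that[of 0] f
      by (simp add: ii_component_0 bideg_closed)
  next
    case (Suc j')
    with f have "ii e f \<in> bideg (Suc i) j'" by (simp add: ii_component)
    from taylor_remainder[OF this] obtain h where
      "h \<in> bideg i j'" "taylor a e N (ii e f) = ii e f + mulX a h" by blast
    with zero(2) Suc that[of "- h"] show ?thesis
      by (simp add: restrict_along_def mulX.neg mulT_component bideg_closed
          eq_neg_iff_add_eq_0)
  qed
  have "f - mulT a (ii e f) \<in> bideg (Suc i) j"
    using f by (intro bideg_closed mulT_ii_component)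
  from taylor_remainder[OF this] obtain g where
    g: "g \<in> bideg i j" "restrict_along a e N f = f - mulT a (ii e f) + mulX a g"
    unfolding restrict_along_def by blast
  have "f = mulX a (mulT a h - g)"
    using g(2) zero(1) h(2) by (simp add: mulX.diff mulX_mulT algebra_simps)
  moreover have "mulT a h - g \<in> bideg i j"
    using h g by (intro bideg_closed)
  ultimately show ?thesis using that by blast
qed

section \<open>The inverse system\<close>

definition nonzero_count :: "(complex ^ 'n) list \<Rightarrow> complex ^ 'n \<Rightarrow> nat"
  where "nonzero_count L l = length (filter (\<lambda>a. dotp a l \<noteq> 0) L)"

text \<open>The two conditions say that the generators of the ideal annihilate \<open>f\<close> when \<open>x\<^sub>i\<close> acts as \<open>\<partial>\<^sub>i\<close>
  and \<open>\<theta>\<^sub>i\<close> as \<open>\<iota>\<^sub>i\<close>.\<close>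

definition inverse_system :: "(complex ^ 'n::{finite, linorder}) list \<Rightarrow> 'n superspace set"
  where "inverse_system L = {f. \<forall>l. (dd l ^^ Suc (nonzero_count L l)) f = 0 \<and>
    (dd l ^^ nonzero_count L l) (ii l f) = 0}"

lemma nonzero_count_Cons:
  "nonzero_count (a # L) l = (if dotp a l = 0 then nonzero_count L l else Suc (nonzero_count L l))"
  by (simp add: nonzero_count_def)

lemma inverse_systemD:
  assumes "f \<in> inverse_system L"
  shows "Suc (nonzero_count L l) \<le> n \<Longrightarrow> (dd l ^^ n) f = 0"
    and "nonzero_count L l \<le> n \<Longrightarrow> (dd l ^^ n) (ii l f) = 0"
  using assms dd_pow_0_mono unfolding inverse_system_def by blast+

lemma inverse_systemI:
  assumes "\<And>l. (dd l ^^ Suc (nonzero_count L l)) f = 0"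
    and "\<And>l. (dd l ^^ nonzero_count L l) (ii l f) = 0"
  shows "f \<in> inverse_system L"
  using assms unfolding inverse_system_def by blast

lemma subspace_inverse_system: "ss.subspace (inverse_system L)"
  by (rule ss.subspaceI)
    (auto intro!: inverse_systemI simp: inverse_systemD ii.add ii.scale dd_pow.add dd_pow.scale
      simp del: funpow.simps)

lemma inverse_system_Cons_mono: "f \<in> inverse_system L \<Longrightarrow> f \<in> inverse_system (a # L)"
  by (rule inverse_systemI) (auto simp: nonzero_count_Cons inverse_systemD simp del: funpow.simps)

lemma inverse_system_Cons_0: "inverse_system (0 # L) = inverse_system L"
  by (simp add: inverse_system_def nonzero_count_Cons dotp_def)

lemma inverse_system_mulX:
  assumes "f \<in> inverse_system L"
  shows "mulX a f \<in> inverse_system (a # L)"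
  by (rule inverse_systemI)
    (auto simp: nonzero_count_Cons dd_pow_mulX ii_mulX inverse_systemD[OF assms]
      simp del: funpow.simps)

text \<open>The contraction may consume the new theta_a and return \<open>f\<close>, which needs one
  more derivative than \<open>ii l f\<close>. The count pays for this, since it grows exactly when
  \<open>dotp a l\<close> is nonzero.\<close>

lemma inverse_system_mulT:
  assumes "f \<in> inverse_system L"
  shows "mulT a f \<in> inverse_system (a # L)"
  by (rule inverse_systemI)
    (auto simp: nonzero_count_Cons dd_pow_mulT ii_mulT dd_pow.add dd_pow.diff dd_pow.neg dd_pow.scale
      inverse_systemD[OF assms] simp del: funpow.simps)

lemma inverse_system_ii:
  assumes "f \<in> inverse_system L"
  shows "ii e f \<in> inverse_system L"
  by (rule inverse_systemI)
    (auto simp: dd_pow_ii ii_ii[of _ e] inverse_systemD[OF assms, unfolded dd_pow_ii]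
      inverse_systemD[OF assms] dd_pow.neg
      simp del: funpow.simps)

lemma restrict_along_dd_pow:
  assumes "f \<in> bideg i j" "i \<le> N"
  shows "(dd l ^^ k) (restrict_along a e N f) = restrict_along a e N ((dd (l - dotp a l *s e) ^^ k) f)"
proof (induction k)
  case (Suc k)
  have "(dd e ^^ Suc N) ((dd (l - dotp a l *s e) ^^ k) f) = 0"
    by (rule dd_pow_nilpotent[OF dd_pow_component[OF assms(1)]]) (use assms(2) in simp)
  from restrict_along_dd[OF this] show ?case by (simp only: funpow.simps(2) comp_apply Suc)
qed simp

lemma dotp_contract:
  "dotp (contract a b) l = dotp b (l - dotp a l *s pivot_dual a)"
  by (simp add: contract_dotp dotp_diff_left dotp_diff_right dotp_smult_left dotp_smult_right)

text \<open>The projected direction lies in the kernel of \<open>a\<close>, so \<open>a\<close>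
  itself does not contribute, and the other members take there the values that their contractions
  take at \<open>l\<close>.\<close>

lemma nonzero_count_contract:
  assumes "a \<noteq> 0"
  shows "nonzero_count (map (contract a) L) l = nonzero_count (a # L) (l - dotp a l *s pivot_dual a)"
  by (simp add: nonzero_count_def dotp_contract dotp_diff_right dotp_smult_right
      dotp_pivot_dual_self[OF assms] filter_map comp_def)

text \<open>Restriction intertwines the operators along \<open>l\<close> with those along the
  projection of \<open>l\<close>, so the conditions for the contracted list at \<open>l\<close> are
  those for \<open>a # L\<close> at the projection.\<close>

lemma inverse_system_restrict:
  assumes "a \<noteq> 0" and f: "f \<in> inverse_system (a # L)" "f \<in> bideg i j" "i \<le> N"
  shows "restrict_along a (pivot_dual a) N f \<in> inverse_system (map (contract a) L)"
proof (rule inverse_systemI)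
  fix l
  let ?l = "l - dotp a l *s pivot_dual a"
  show "(dd l ^^ Suc (nonzero_count (map (contract a) L) l)) (restrict_along a (pivot_dual a) N f) = 0"
    unfolding nonzero_count_contract[OF assms(1)] restrict_along_dd_pow[OF f(2,3)]
    using inverse_systemD(1)[OF f(1), of ?l] by (simp only: order_refl restrict_along.zero)
  note * = restrict_along_dd_pow[OF ii_component_pred[OF f(2)] f(3)]
  show "(dd l ^^ nonzero_count (map (contract a) L) l) (ii l (restrict_along a (pivot_dual a) N f)) = 0"
    unfolding nonzero_count_contract[OF assms(1)] restrict_along_ii *
    using inverse_systemD(2)[OF f(1), of ?l] by (simp only: order_refl restrict_along.zero)
qed

text \<open>If a(l) = 0 the operators commute with x_a, which is injective. Otherwise the bound for
  \<open>a # L\<close> is one larger, and \<open>dd_pow_mulX_cancel\<close> removes x_a together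
  with one derivative.\<close>

lemma inverse_system_mulX_cancel:
  assumes "a \<noteq> 0" and g: "g \<in> bideg i j" and f: "mulX a g \<in> inverse_system (a # L)"
  shows "g \<in> inverse_system L"
proof (rule inverse_systemI)
  fix l
  let ?n = "nonzero_count L l"
  note ii = ii_component_pred[OF g]
  have "(dd l ^^ Suc ?n) g = 0 \<and> (dd l ^^ ?n) (ii l g) = 0"
  proof (cases "dotp a l = 0")
    case True
    have "mulX a ((dd l ^^ Suc ?n) g) = (dd l ^^ Suc ?n) (mulX a g)"
      "mulX a ((dd l ^^ ?n) (ii l g)) = (dd l ^^ ?n) (ii l (mulX a g))"
      unfolding ii_mulX dd_pow_mulX using True by simp_all
    moreover have "(dd l ^^ Suc ?n) (mulX a g) = 0" "(dd l ^^ ?n) (ii l (mulX a g)) = 0"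
      using inverse_systemD[OF f] True by (simp_all add: nonzero_count_Cons del: funpow.simps)
    ultimately have "mulX a ((dd l ^^ Suc ?n) g) = 0" "mulX a ((dd l ^^ ?n) (ii l g)) = 0"
      by simp_all
    then show ?thesis
      using mulX_zero_imp[OF assms(1)] dd_pow_component[OF g] dd_pow_component[OF ii] by blast
  next
    case False
    have "(dd l ^^ Suc (Suc ?n)) (mulX a g) = 0" "(dd l ^^ Suc ?n) (mulX a (ii l g)) = 0"
      using inverse_systemD[OF f] False
      by (simp_all add: nonzero_count_Cons ii_mulX[symmetric] del: funpow.simps)
    with dd_pow_mulX_cancel[OF False] g ii show ?thesis by blast
  qed
  then show "(dd l ^^ Suc ?n) g = 0" "(dd l ^^ ?n) (ii l g) = 0" by blast+
qed

lemma spderiv_eq_dd: "spderiv k f = dd (axis k 1) f"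
  by (simp add: dd_def op_comb_axis)

lemma contract_theta_eq_ii: "contract_theta k f = ii (axis k 1) f"
  by (simp add: ii_def op_comb_axis)

text \<open>With no normals every count is 0, so all first derivatives and all contractions
  vanish.\<close>

lemma inverse_system_Nil:
  assumes "f \<in> inverse_system []"
  shows "f = sscale (coef f {} 0) 1"
proof -
  have dd: "spderiv k f = 0" and ii: "contract_theta k f = 0" for k
    using inverse_systemD(1)[OF assms, of "axis k 1" 1] inverse_systemD(2)[OF assms, of "axis k 1" 0]
    by (simp_all add: spderiv_eq_dd contract_theta_eq_ii nonzero_count_def)
  have "m = 0" if nz: "coef f S m \<noteq> 0" for S m
  proof (rule ccontr)
    assume "m \<noteq> 0"
    then obtain k where "Poly_Mapping.lookup m k \<noteq> 0"
      by (metis lookup_zero poly_mapping_eqI)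
    from exponent_split[OF this] have m: "m - Poly_Mapping.single k 1 + Poly_Mapping.single k 1 = m"
      by (simp only: add.commute)
    have "coef (spderiv k f) S (m - Poly_Mapping.single k 1) = 0" by (simp add: dd)
    then have "coef f S m = 0" unfolding coef_spderiv m by (simp del: of_nat_Suc)
    with nz show False by simp
  qed
  moreover have "S = {}" if nz: "coef f S m \<noteq> 0" for S m
  proof (rule ccontr)
    assume "S \<noteq> {}"
    then obtain k where k: "k \<in> S" by blast
    then have "coef (contract_theta k f) (S - {k}) m = position_sign k (S - {k}) * coef f S m"
      by (simp add: coef_contract_theta insert_absorb)
    moreover have "position_sign k (S - {k}) \<noteq> 0" by (simp add: position_sign_def)
    ultimately show False using nz by (simp add: ii)
  qed
  ultimately show ?thesis
    by (intro superspace_coef_eqI) (auto simp: coef_one)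
qed

text \<open>Generated inductively rather than as the span of an explicit set, so that products can
  be rebuilt factor by factor in \<open>product_span_lift\<close>. Scalars enter at the empty list
  and reach longer lists through \<open>skip\<close>, \<open>mulX\<close> and
  \<open>mulT\<close>.\<close>

inductive product_span :: "(complex ^ 'n::{finite, linorder}) list \<Rightarrow> nat \<Rightarrow> nat \<Rightarrow> 'n superspace \<Rightarrow> bool"
  where
    const: "product_span [] 0 0 (sscale c 1)"
  | zero: "product_span L i j 0"
  | add: "product_span L i j f \<Longrightarrow> product_span L i j g \<Longrightarrow> product_span L i j (f + g)"
  | skip: "product_span L i j f \<Longrightarrow> product_span (a # L) i j f"
  | mulX: "product_span L i j f \<Longrightarrow> product_span (a # L) (Suc i) j (mulX a f)"
  | mulT: "product_span L i j f \<Longrightarrow> product_span (a # L) i (Suc j) (mulT a f)"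

lemma product_span_inverse_system:
  "product_span L i j f \<Longrightarrow> f \<in> inverse_system L \<inter> bideg i j"
proof (induction rule: product_span.induct)
  case (const c)
  show ?case
    using one_component
    by (auto intro!: inverse_systemI bideg_closed
        simp: nonzero_count_def dd.scale ii.scale)
qed (auto intro: ss.subspace_0[OF subspace_inverse_system] ss.subspace_add[OF subspace_inverse_system]
    bideg_closed inverse_system_Cons_mono inverse_system_mulX inverse_system_mulT
    mulX_component mulT_component)

text \<open>Each contracted factor is replaced by the original one, and restriction turns it back.
  The bound on \<open>i\<close> leaves room for the additional factor x_b in
  \<open>restrict_along_mulX\<close>.\<close>

lemma product_span_lift:
  assumes "product_span (map (contract a) L) i j f" "i \<le> N"
  shows "\<exists>g. product_span L i j g \<and> restrict_along a (pivot_dual a) N g = f"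
  using assms
proof (induction "map (contract a) L" i j f arbitrary: L rule: product_span.induct)
  case (const c)
  then show ?case using product_span.const restrict_along_one by fastforce
next
  case (zero i j)
  then show ?case using product_span.zero restrict_along.zero by blast
next
  case (add i j f g)
  from add(2)[OF refl add(5)] add(4)[OF refl add(5)]
  obtain f' g' where "product_span L i j f'" "restrict_along a (pivot_dual a) N f' = f"
    "product_span L i j g'" "restrict_along a (pivot_dual a) N g' = g" by blast
  then show ?case using product_span.add restrict_along.add by blast
next
  case (skip L' i j f b')
  then obtain b L0 where L: "L = b # L0" "L' = map (contract a) L0" by (metis map_eq_Cons_conv)
  then show ?case using skip product_span.skip by metis
next
  case (mulX L' i j f b')
  then obtain b L0 where L: "L = b # L0" "b' = contract a b" "L' = map (contract a) L0"
    by (metis map_eq_Cons_conv)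
  from mulX(2)[OF L(3)] mulX(4) obtain g where
    g: "product_span L0 i j g" "restrict_along a (pivot_dual a) N g = f" by auto
  have "(dd (pivot_dual a) ^^ N) g = 0"
    using product_span_inverse_system[OF g(1)] mulX(4) by (intro dd_pow_nilpotent) auto
  then have "restrict_along a (pivot_dual a) N (mulX b g) = mulX b' f"
    by (simp add: restrict_along_mulX g(2) L(2) contract_dotp)
  with g(1) L(1) show ?case using product_span.mulX by blast
next
  case (mulT L' i j f b')
  then obtain b L0 where L: "L = b # L0" "b' = contract a b" "L' = map (contract a) L0"
    by (metis map_eq_Cons_conv)
  from mulT(2)[OF L(3)] mulT(4) obtain g where
    g: "product_span L0 i j g" "restrict_along a (pivot_dual a) N g = f" by auto
  have "restrict_along a (pivot_dual a) N (mulT b g) = mulT b' f"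
    by (simp add: restrict_along_mulT g(2) L(2) contract_dotp)
  with g(1) L(1) show ?case using product_span.mulT by blast
qed

lemma inverse_system_product_span:
  assumes "f \<in> inverse_system L" "f \<in> bideg i j"
  shows "product_span L i j f"
  using assms
proof (induction "length L" arbitrary: L i j f)
  case 0
  then have L: "L = []" by simp
  from inverse_system_Nil 0 L have f: "f = sscale (coef f {} 0) 1" by blast
  show ?case
  proof (cases "f = 0")
    case False
    then have "coef f {} 0 \<noteq> 0" using f by force
    then have "i = 0 \<and> j = 0" using 0(3) unfolding bideg_iff by fastforce
    with L f show ?thesis using product_span.const by metis
  qed (simp add: product_span.zero)
next
  case (Suc n)
  from Suc(2) obtain a L0 where L: "L = a # L0" "length L0 = n" by (metis length_Suc_conv)
  show ?case
  proof (cases "a = 0")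
    case True
    with Suc L show ?thesis by (simp add: inverse_system_Cons_0 product_span.skip)
  next
    case a: False
    let ?e = "pivot_dual a" and ?L = "map (contract a) L0"
    let ?R = "restrict_along a ?e i"
    have lift: "\<exists>g. product_span L0 i j' g \<and> ?R g = ?R f'"
      if "f' \<in> inverse_system L" "f' \<in> bideg i j'" for f' j'
      using Suc(1)[of ?L, OF _ inverse_system_restrict[OF a _ that(2) order_refl]
          restrict_along_component[OF that(2)]] product_span_lift[OF _ order_refl] that L by auto
    note sub = ss.subspace_diff[OF subspace_inverse_system]
    \<comment> \<open>First correction: products without \<open>a\<close> that have the same
      restriction as \<open>f\<close>.\<close>
    obtain g1 where g1: "product_span L0 i j g1" "?R g1 = ?R f" using lift Suc(3,4) by blast
    have g1': "g1 \<in> inverse_system L" "g1 \<in> bideg i j"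
      using product_span_inverse_system[OF g1(1)] L(1) inverse_system_Cons_mono by auto
    define f1 where "f1 = f - g1"
    have f1: "f1 \<in> inverse_system L" "f1 \<in> bideg i j" "?R f1 = 0"
      using Suc(3,4) g1' g1(2) by (auto simp: f1_def restrict_along.diff intro: sub bideg_closed)
    \<comment> \<open>Second correction, for the coefficient of theta_a. The element
      \<open>mulT a g\<close> restricts to 0 and so does not disturb the first correction.\<close>
    obtain g2 where g2: "product_span L i j g2" "?R g2 = 0" "?R (ii ?e g2) = ?R (ii ?e f1)"
    proof (cases j)
      case 0
      with f1 that[of 0] show ?thesis by (simp add: ii_component_0 product_span.zero)
    next
      case (Suc j')
      then obtain g where g: "product_span L0 i j' g" "?R g = ?R (ii ?e f1)"
        using lift[of "ii ?e f1" j'] f1 inverse_system_ii ii_component by blast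
      show ?thesis
      proof (rule that[of "mulT a g"])
        show "product_span L i j (mulT a g)" using g(1) L(1) Suc by (simp add: product_span.mulT)
        show "?R (mulT a g) = 0" by (simp add: restrict_along_mulT dotp_pivot_dual_self[OF a])
        show "?R (ii ?e (mulT a g)) = ?R (ii ?e f1)"
          by (simp add: ii_mulT restrict_along.diff restrict_along_mulT dotp_pivot_dual_self[OF a] g(2))
      qed
    qed
    have g2': "g2 \<in> inverse_system L" "g2 \<in> bideg i j"
      using product_span_inverse_system[OF g2(1)] by auto
    define f2 where "f2 = f1 - g2"
    have f2: "f2 \<in> inverse_system L" "f2 \<in> bideg i j" "?R f2 = 0" "?R (ii ?e f2) = 0"
      using f1 g2' g2 by (auto simp: f2_def restrict_along.diff ii.diff intro: sub bideg_closed)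
    \<comment> \<open>Both restrictions of \<open>f2\<close> vanish, so it is 0 or a multiple of
      x_a, and the induction hypothesis applies to the cofactor.\<close>
    have "product_span L i j f2"
    proof (cases i)
      case 0
      with f2 have "f2 = 0" by (blast intro: restrict_along_kernel_0)
      then show ?thesis by (simp add: product_span.zero)
    next
      case (Suc i')
      with f2(2) have "f2 \<in> bideg (Suc i') j" by simp
      from restrict_along_kernel_Suc[OF this f2(3,4)] obtain g where
        g: "g \<in> bideg i' j" "f2 = mulX a g" by blast
      then have "product_span L0 i' j g"
        using inverse_system_mulX_cancel[OF a g(1)] f2(1) L Suc.hyps(1) by blast
      with g(2) L(1) Suc show ?thesis by (simp add: product_span.mulX)
    qed
    moreover have "f = g1 + (g2 + f2)" by (simp add: f2_def f1_def)
    ultimately show ?thesis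
      using g1(1) g2(1) L(1) by (metis product_span.add product_span.skip)
  qed
qed

section \<open>The dimensions of the inverse system\<close>

text \<open>A relation carrying an explicit finite basis: superspace is infinite dimensional, and
  the dual families are built from such a basis.\<close>

definition has_dim :: "'n::{finite, linorder} superspace set \<Rightarrow> nat \<Rightarrow> bool"
  where "has_dim S n \<longleftrightarrow> (\<exists>B. finite B \<and> ss.independent B \<and> ss.span B = S \<and> card B = n)"

lemma has_dim_zero: "has_dim {0} 0"
  unfolding has_dim_def by (rule exI[of _ "{}"]) (simp add: ss.independent_empty ss.span_empty)

text \<open>Rank-nullity: a basis of the kernel together with preimages of a basis of the
  image.\<close>

lemma has_dim_kernel_image:
  assumes F: "slinear F" and S: "ss.subspace S"
    and ker: "has_dim {x\<in>S. F x = 0} m" and im: "has_dim (F ` S) n"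
  shows "has_dim S (m + n)"
proof -
  interpret F: Vector_Spaces.linear sscale sscale F by fact
  obtain K where K: "finite K" "ss.independent K" "ss.span K = {x\<in>S. F x = 0}" "card K = m"
    using ker unfolding has_dim_def by blast
  obtain C where C: "finite C" "ss.independent C" "ss.span C = F ` S" "card C = n"
    using im unfolding has_dim_def by blast
  have "\<exists>x\<in>S. F x = c" if "c \<in> C" for c
    using ss.span_base[OF that] unfolding C(3) by blast
  then obtain s where s: "\<And>c. c \<in> C \<Longrightarrow> s c \<in> S" "\<And>c. c \<in> C \<Longrightarrow> F (s c) = c" by metis
  have KS: "x \<in> S" "F x = 0" if "x \<in> K" for x using ss.span_base[OF that] K(3) by auto
  have inj: "inj_on s C" by (rule inj_on_inverseI[of _ F]) (rule s(2))
  have Fs: "F (\<Sum>c\<in>C. sscale (u c) (s c)) = (\<Sum>c\<in>C. sscale (u c) c)" for u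
    unfolding F.sum F.scale by (rule sum.cong) (simp_all only: s(2))
  have FK: "F (\<Sum>x\<in>K. sscale (u x) x) = 0" for u
    unfolding F.sum F.scale by (rule sum.neutral) (simp add: KS(2))
  have disj: "K \<inter> s ` C = {}"
  proof (rule ccontr)
    assume "K \<inter> s ` C \<noteq> {}"
    then obtain c where c: "c \<in> C" "s c \<in> K" by blast
    then have "c = 0" using KS(2) s(2) by metis
    with c(1) C(2) show False using ss.dependent_zero by blast
  qed
  have "ss.independent (K \<union> s ` C)"
  proof (rule ss.independent_if_scalars_zero)
    fix f x assume sum: "(\<Sum>x\<in>K \<union> s ` C. sscale (f x) x) = 0" and x: "x \<in> K \<union> s ` C"
    have split: "(\<Sum>x\<in>K. sscale (f x) x) + (\<Sum>c\<in>C. sscale (f (s c)) (s c)) = 0"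
      using sum
      unfolding sum.union_disjoint[OF K(1) finite_imageI[OF C(1)] disj] sum.reindex[OF inj] comp_def .
    have "F ((\<Sum>x\<in>K. sscale (f x) x) + (\<Sum>c\<in>C. sscale (f (s c)) (s c))) = 0"
      by (simp only: split F.zero)
    then have "(\<Sum>c\<in>C. sscale (f (s c)) c) = 0"
      by (simp only: F.add Fs FK add_0_left)
    from ss.independentD[OF C(2,1) subset_refl this] have fC: "f (s c) = 0" if "c \<in> C" for c
      using that .
    then have "(\<Sum>x\<in>K. sscale (f x) x) = 0" using split by simp
    from ss.independentD[OF K(2,1) subset_refl this] have "f x = 0" if "x \<in> K" for x
      using that .
    with fC x show "f x = 0" by auto
  qed (simp add: K(1) C(1))
  moreover have "ss.span (K \<union> s ` C) = S"
  proof
    show "ss.span (K \<union> s ` C) \<subseteq> S"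
      by (rule ss.span_minimal[OF _ S]) (use KS s in auto)
    show "S \<subseteq> ss.span (K \<union> s ` C)"
    proof
      fix x assume x: "x \<in> S"
      then have "F x \<in> ss.span C" unfolding C(3) by (rule imageI)
      then obtain u where u: "F x = (\<Sum>c\<in>C. sscale (u c) c)"
        unfolding ss.span_finite[OF C(1)] by blast
      let ?y = "\<Sum>c\<in>C. sscale (u c) (s c)"
      have "?y \<in> ss.span (s ` C)"
        by (intro ss.span_sum ss.span_scale ss.span_base imageI)
      moreover have "?y \<in> S" using s(1) by (intro ss.subspace_sum[OF S] ss.subspace_scale[OF S])
      then have "x - ?y \<in> ss.span K"
        unfolding K(3) using x by (simp add: ss.subspace_diff[OF S] F.diff Fs u)
      ultimately have "(x - ?y) + ?y \<in> ss.span (K \<union> s ` C)"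
        using ss.span_mono[OF Un_upper1[of K "s ` C"]] ss.span_mono[OF Un_upper2[of "s ` C" K]]
        by (intro ss.span_add) auto
      then show "x \<in> ss.span (K \<union> s ` C)" by simp
    qed
  qed
  moreover have "card (K \<union> s ` C) = m + n"
    by (simp add: card_Un_disjoint card_image[OF inj] K(1,4) C(1,4) disj)
  ultimately show ?thesis
    unfolding has_dim_def using K(1) C(1) by (intro exI[of _ "K \<union> s ` C"] conjI finite_UnI finite_imageI)
qed

lemma has_dim_inj_image:
  assumes F: "slinear F" and S: "ss.subspace S" and inj: "\<And>x. x \<in> S \<Longrightarrow> F x = 0 \<Longrightarrow> x = 0"
    and dim: "has_dim S n"
  shows "has_dim (F ` S) n"
proof -
  interpret F: Vector_Spaces.linear sscale sscale F by fact
  obtain C where C: "finite C" "ss.independent C" "ss.span C = S" "card C = n"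
    using dim unfolding has_dim_def by blast
  have "inj_on F S"
  proof (rule inj_onI)
    fix x y assume "x \<in> S" "y \<in> S" "F x = F y"
    then have "x - y = 0" using inj[of "x - y"] by (simp add: F.diff ss.subspace_diff[OF S])
    then show "x = y" by simp
  qed
  then have inj: "inj_on F (ss.span C)" by (simp only: C(3))
  show ?thesis
    unfolding has_dim_def
  proof (intro exI[of _ "F ` C"] conjI)
    show "finite (F ` C)" using C(1) by simp
    show "ss.independent (F ` C)"
      by (rule ss_pair.linear_independent_injective_image[OF F C(2) inj])
    show "ss.span (F ` C) = F ` S" by (simp only: F.span_image C(3))
    show "card (F ` C) = n"
      using card_image[OF inj_on_subset[OF inj ss.span_superset]] C(4) by simp
  qed
qed

text \<open>The three summands are the dimensions of the restrictions to \<open>x\<^sub>a = \<theta>\<^sub>a = 0\<close>, of the coefficients of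
  \<open>\<theta>\<^sub>a\<close>, and of the multiples of \<open>x\<^sub>a\<close>.\<close>

function hdim :: "('a::field ^ 'n) list \<Rightarrow> nat \<Rightarrow> nat \<Rightarrow> nat" where
  "hdim [] i j = (if i = 0 \<and> j = 0 then 1 else 0)"
| "hdim (a # L) i j = (if a = 0 then hdim L i j else
    hdim (map (contract a) L) i j + (if j = 0 then 0 else hdim (map (contract a) L) i (j - 1)) +
    (if i = 0 then 0 else hdim L (i - 1) j))"
  by pat_completeness auto
termination by (relation "Wellfounded.measure (\<lambda>(L, i, j). length L)") auto

lemma subspace_homogeneous: "ss.subspace (inverse_system L \<inter> bideg i j)"
  by (intro ss.subspace_inter subspace_inverse_system subspace_bideg)

text \<open>Rank-nullity twice. Restriction has kernel \<open>K\<close> and maps onto the inverse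
  system of the contracted list; \<open>ii\<close> along e followed by restriction maps
  \<open>K\<close> onto the same space in fermionic degree \<open>j - 1\<close>; what remains is x_a
  times the inverse system of \<open>L0\<close>.\<close>

theorem has_dim_inverse_system:
  fixes L :: "(complex ^ 'a::{finite, linorder}) list"
  shows "has_dim (inverse_system L \<inter> bideg i j) (hdim L i j)"
proof (induction "length L" arbitrary: L i j)
  case 0
  then have L: "L = []" by simp
  have mem: "f \<in> inverse_system [] \<inter> bideg i j \<longleftrightarrow> product_span [] i j f" for f
    using inverse_system_product_span product_span_inverse_system by blast
  show ?case
  proof (cases "i = 0 \<and> j = 0")
    case True
    then have ij: "i = 0" "j = 0" by simp_all
    have eq: "inverse_system [] \<inter> bideg 0 0 = ss.span {1}"
    proof
      show "inverse_system [] \<inter> bideg 0 0 \<subseteq> ss.span {1}"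
        using inverse_system_Nil ss.span_scale ss.span_base by (metis IntD1 insertI1 subsetI)
      have "1 \<in> inverse_system [] \<inter> bideg 0 0"
        using product_span_inverse_system[OF product_span.const[of 1]] by simp
      then show "ss.span {1} \<subseteq> inverse_system [] \<inter> bideg 0 0"
        by (intro ss.span_minimal subspace_homogeneous) simp
    qed
    then show ?thesis
      unfolding has_dim_def L ij eq by (intro exI[of _ "{1}"]) simp
  next
    case False
    have "f = 0" if "f \<in> inverse_system L" "f \<in> bideg i j" for f
    proof -
      have f: "f = sscale (coef f {} 0) 1"
        by (rule inverse_system_Nil) (use that(1) L in simp)
      have "coef f {} 0 = 0"
      proof (rule ccontr)
        assume "coef f {} 0 \<noteq> 0"
        with that(2) have "monom_degree (0 :: 'a \<Rightarrow>\<^sub>0 nat) = i" "card ({} :: 'a set) = j"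
          unfolding bideg_iff by blast+
        with False show False by (simp add: monom_degree_def)
      qed
      with f show "f = 0" by simp
    qed
    then have "inverse_system L \<inter> bideg i j = {0}"
      using ss.subspace_0[OF subspace_homogeneous[of L i j]] by auto
    then show ?thesis using False L by (auto simp: has_dim_zero)
  qed
next
  case (Suc n)
  from Suc(2) obtain a L0 where L: "L = a # L0" "length L0 = n" by (metis length_Suc_conv)
  show ?case
  proof (cases "a = 0")
    case True
    then show ?thesis using Suc(1)[of L0 i j] L by (simp add: inverse_system_Cons_0)
  next
    case a: False
    let ?e = "pivot_dual a" and ?L = "map (contract a) L0"
    let ?R = "restrict_along a ?e i" and ?S = "inverse_system L \<inter> bideg i j"
    define K where "K = {x \<in> ?S. ?R x = 0}"
    have K: "ss.subspace K"
      unfolding K_def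
      by (rule ss.subspaceI) (auto simp: restrict_along.add restrict_along.scale
          intro: ss.subspace_0[OF subspace_inverse_system] ss.subspace_add[OF subspace_inverse_system]
            ss.subspace_scale[OF subspace_inverse_system] bideg_closed)
    have lift: "\<exists>g. g \<in> inverse_system L0 \<inter> bideg i j' \<and> ?R g = f"
      if "f \<in> inverse_system ?L" "f \<in> bideg i j'" for f j'
      using product_span_lift[OF inverse_system_product_span[OF that] order_refl]
        product_span_inverse_system by blast
    have "?R ` ?S = inverse_system ?L \<inter> bideg i j"
    proof
      show "?R ` ?S \<subseteq> inverse_system ?L \<inter> bideg i j"
      proof (rule image_subsetI)
        fix x assume "x \<in> ?S"
        then have x: "x \<in> inverse_system (a # L0)" "x \<in> bideg i j"
          using L(1) by simp_all
        from inverse_system_restrict[OF a x order_refl] restrict_along_component[OF x(2)]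
        show "?R x \<in> inverse_system ?L \<inter> bideg i j" by simp
      qed
      show "inverse_system ?L \<inter> bideg i j \<subseteq> ?R ` ?S"
      proof
        fix f assume "f \<in> inverse_system ?L \<inter> bideg i j"
        then obtain g where g: "g \<in> inverse_system L0" "g \<in> bideg i j" "?R g = f"
          using lift by blast
        then have "g \<in> ?S" using inverse_system_Cons_mono[of g L0 a] L(1) by simp
        with g(3) show "f \<in> ?R ` ?S" by blast
      qed
    qed
    then have im: "has_dim (?R ` ?S) (hdim ?L i j)" using Suc(1)[of ?L i j] L(2) by simp
    let ?R' = "\<lambda>f. ?R (ii ?e f)"
    have R': "slinear ?R'"
      by (rule slinearI) (simp_all add: ii.add ii.scale restrict_along.add restrict_along.scale)
    have im': "has_dim (?R' ` K) (if j = 0 then 0 else hdim ?L i (j - 1))"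
    proof (cases j)
      case 0
      then have "?R' x = 0" if "x \<in> K" for x
        using that ii_component_0[of x i ?e] by (simp add: K_def)
      then have "?R' ` K = {0}" using ss.subspace_0[OF K] by force
      with 0 show ?thesis by (simp add: has_dim_zero)
    next
      case (Suc j')
      have "?R' ` K = inverse_system ?L \<inter> bideg i j'"
      proof
        show "?R' ` K \<subseteq> inverse_system ?L \<inter> bideg i j'"
        proof (rule image_subsetI)
          fix x assume "x \<in> K"
          then have x: "x \<in> inverse_system (a # L0)" "x \<in> bideg i (Suc j')"
            using L(1) Suc by (simp_all add: K_def)
          note x' = inverse_system_ii[OF x(1), of ?e] ii_component[OF x(2), of ?e]
          from inverse_system_restrict[OF a x' order_refl] restrict_along_component[OF x'(2)]
          show "?R' x \<in> inverse_system ?L \<inter> bideg i j'" by simp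
        qed
        show "inverse_system ?L \<inter> bideg i j' \<subseteq> ?R' ` K"
        proof
          fix f assume "f \<in> inverse_system ?L \<inter> bideg i j'"
          then obtain g where g: "g \<in> inverse_system L0" "g \<in> bideg i j'" "?R g = f"
            using lift by blast
          \<comment> \<open>The preimage \<open>mulT a g\<close> restricts to 0, and contracting it
            by e returns \<open>g\<close> up to a multiple of theta_a, which restriction
            kills.\<close>
          have "mulT a g \<in> K"
            using inverse_system_mulT[OF g(1), of a] mulT_component[OF g(2), of a] L(1) Suc
            by (simp add: K_def restrict_along_mulT dotp_pivot_dual_self[OF a])
          moreover have "?R' (mulT a g) = f"
            by (simp add: ii_mulT restrict_along.diff restrict_along_mulT dotp_pivot_dual_self[OF a] g(3))
          ultimately show "f \<in> ?R' ` K" by blast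
        qed
      qed
      then show ?thesis using Suc.hyps(1)[of ?L i j'] L(2) Suc by simp
    qed
    have ker: "has_dim {x \<in> K. ?R' x = 0} (if i = 0 then 0 else hdim L0 (i - 1) j)"
    proof (cases i)
      case 0
      have "x = 0" if "x \<in> K" "?R' x = 0" for x
        by (rule restrict_along_kernel_0[where f = x and j = j and e = ?e and N = i]) (use that 0 in \<open>simp_all add: K_def\<close>)
      then have "{x \<in> K. ?R' x = 0} = {0}" using ss.subspace_0[OF K] by auto
      with 0 show ?thesis by (simp add: has_dim_zero)
    next
      case (Suc i')
      have "{x \<in> K. ?R' x = 0} = mulX a ` (inverse_system L0 \<inter> bideg i' j)"
      proof
        show "{x \<in> K. ?R' x = 0} \<subseteq> mulX a ` (inverse_system L0 \<inter> bideg i' j)"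
        proof
          fix x assume "x \<in> {x \<in> K. ?R' x = 0}"
          then have x: "x \<in> inverse_system (a # L0)" "x \<in> bideg (Suc i') j"
            "?R x = 0" "?R (ii ?e x) = 0" using L(1) Suc by (auto simp: K_def)
          from restrict_along_kernel_Suc[OF x(2-4)] obtain g where
            g: "g \<in> bideg i' j" "x = mulX a g" by blast
          have "g \<in> inverse_system L0"
            by (rule inverse_system_mulX_cancel[OF a g(1)]) (use x(1) g(2) in simp)
          with g show "x \<in> mulX a ` (inverse_system L0 \<inter> bideg i' j)" by simp
        qed
        show "mulX a ` (inverse_system L0 \<inter> bideg i' j) \<subseteq> {x \<in> K. ?R' x = 0}"
        proof safe
          fix g assume g: "g \<in> inverse_system L0" "g \<in> bideg i' j"
          have van: "?R (mulX a h) = 0" if "h \<in> bideg i' j'" for h j'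
          proof -
            have "(dd ?e ^^ i) h = 0" by (rule dd_pow_nilpotent[OF that]) (simp add: Suc)
            from restrict_along_mulX[OF this, of a a] show ?thesis
              by (simp add: dotp_pivot_dual_self[OF a])
          qed
          show "mulX a g \<in> K"
            using van[OF g(2)] inverse_system_mulX[OF g(1), of a] mulX_component[OF g(2), of a] L(1) Suc
            by (simp add: K_def)
          show "?R' (mulX a g) = 0"
            using van[OF ii_component_pred[OF g(2)]] by (simp add: ii_mulX)
        qed
      qed
      moreover have "has_dim (mulX a ` (inverse_system L0 \<inter> bideg i' j)) (hdim L0 i' j)"
      proof (rule has_dim_inj_image[OF slinear_ops(1) subspace_homogeneous])
        show "x = 0" if "x \<in> inverse_system L0 \<inter> bideg i' j" "mulX a x = 0" for x
          by (rule mulX_zero_imp[where i = i' and j = j, OF a _ that(2)]) (use that(1) in simp)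
        show "has_dim (inverse_system L0 \<inter> bideg i' j) (hdim L0 i' j)"
          by (rule Suc.hyps(1)) (simp add: L(2))
      qed
      ultimately show ?thesis using Suc by simp
    qed
    have "has_dim ?S (((if i = 0 then 0 else hdim L0 (i - 1) j) +
        (if j = 0 then 0 else hdim ?L i (j - 1))) + hdim ?L i j)"
      using has_dim_kernel_image[OF R' K ker im']
      unfolding K_def by (rule has_dim_kernel_image[OF slinear_restrict subspace_homogeneous _ im])
    then show ?thesis using a L(1) by (simp add: add_ac)
  qed
qed

section \<open>The recursion for doubled families\<close>

text \<open>Each step of the recursion removes one vector and accounts for at most 1 of
  \<open>i + j\<close>.\<close>

lemma hdim_support:
  fixes L :: "('a::field ^ 'n) list"
  shows "hdim L i j \<noteq> 0 \<Longrightarrow> i + j \<le> length L"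
proof (induction "length L" arbitrary: L i j)
  case (Suc n)
  from Suc(2) obtain a L0 where L: "L = a # L0" "length L0 = n" by (metis length_Suc_conv)
  have *: "i' + j' \<le> n" if "hdim L' i' j' \<noteq> 0" "length L' = n"
    for L' :: "('a ^ 'n) list" and i' j'
    using Suc(1)[of L' i' j'] that by simp
  show ?case
    using Suc(3) *[of L0 i j] *[of "map (contract a) L0" i j] *[of "map (contract a) L0" i "j - 1"]
      *[of L0 "i - 1" j] L by (auto split: if_splits)
qed (auto split: if_splits)

fun doubled :: "'a list \<Rightarrow> 'a list" where
  "doubled [] = []"
| "doubled (a # L) = a # a # doubled L"

lemma doubled_map: "doubled (map f L) = map f (doubled L)"
  by (induction L) auto

lemma mset_doubled: "mset (doubled L) = mset L + mset L"
  by (induction L) auto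

text \<open>The coefficient of \<open>q\<^sup>k\<close> after the specialization \<open>(q, t) = (q\<^sup>2, q)\<close>.\<close>

definition weighted_hdim :: "('a::field ^ 'n) list \<Rightarrow> nat \<Rightarrow> nat"
  where "weighted_hdim L k = (\<Sum>j\<le>k. if even (k - j) then hdim L ((k - j) div 2) j else 0)"

lemma weighted_hdim_eq_sum:
  "weighted_hdim L k = (\<Sum>(i, j)\<in>{(i, j). 2 * i + j = k}. hdim L i j)"
proof -
  have "weighted_hdim L k = (\<Sum>j\<in>{j\<in>{..k}. even (k - j)}. hdim L ((k - j) div 2) j)"
    unfolding weighted_hdim_def by (rule sum.inter_filter[symmetric]) simp
  also have "\<dots> = (\<Sum>(i, j)\<in>{(i, j). 2 * i + j = k}. hdim L i j)"
    by (rule sum.reindex_bij_witness[where i = snd and j = "\<lambda>j. ((k - j) div 2, j)"]) auto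
  finally show ?thesis .
qed

lemma contract_self: "a \<noteq> 0 \<Longrightarrow> contract a a = 0"
  by (simp add: contract_def pivot_nonzero)

text \<open>Under the specialization the factor 1 + t becomes 1 + q and the factor q becomes q^2,
  whence the shifts by 1 and 2.\<close>

lemma weighted_hdim_Cons:
  assumes "a \<noteq> 0"
  shows "weighted_hdim (a # L) k = weighted_hdim (map (contract a) L) k +
    (if k = 0 then 0 else weighted_hdim (map (contract a) L) (k - 1)) +
    (if k < 2 then 0 else weighted_hdim L (k - 2))"
proof -
  let ?L = "map (contract a) L"
  let ?w = "\<lambda>f j. if even (k - j) then f ((k - j) div 2) j else 0"
  have "weighted_hdim (a # L) k = (\<Sum>j\<le>k. ?w (hdim ?L) j) +
      (\<Sum>j\<le>k. ?w (\<lambda>i j. if j = 0 then 0 else hdim ?L i (j - 1)) j) +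
      (\<Sum>j\<le>k. ?w (\<lambda>i j. if i = 0 then 0 else hdim L (i - 1) j) j)"
    unfolding weighted_hdim_def sum.distrib[symmetric] using assms by (intro sum.cong) auto
  also have "(\<Sum>j\<le>k. ?w (\<lambda>i j. if j = 0 then 0 else hdim ?L i (j - 1)) j) =
      (if k = 0 then 0 else weighted_hdim ?L (k - 1))"
  proof (cases k)
    case (Suc k')
    show ?thesis unfolding Suc by (subst sum.atMost_Suc_shift) (auto simp: weighted_hdim_def intro: sum.cong)
  qed simp
  also have "(\<Sum>j\<le>k. ?w (\<lambda>i j. if i = 0 then 0 else hdim L (i - 1) j) j) =
      (if k < 2 then 0 else weighted_hdim L (k - 2))"
  proof (cases "k < 2")
    case True
    then have "(k - j) div 2 = 0" for j by simp
    with True show ?thesis by simp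
  next
    case False
    then obtain k' where k: "k = Suc (Suc k')" by (metis Suc_1 less_iff_Suc_add not_less_eq not_less0 not0_implies_Suc numeral_2_eq_2)
    have "(\<Sum>j\<le>k. ?w (\<lambda>i j. if i = 0 then 0 else hdim L (i - 1) j) j) =
        (\<Sum>j\<le>k'. ?w (\<lambda>i j. if i = 0 then 0 else hdim L (i - 1) j) j)"
      unfolding k by (simp add: Suc_diff_le)
    also have "\<dots> = weighted_hdim L k'"
      unfolding weighted_hdim_def k by (rule sum.cong) (auto simp: Suc_diff_le)
    finally show ?thesis using k by simp
  qed
  finally show ?thesis by (simp add: weighted_hdim_def)
qed

text \<open>Contraction by \<open>a\<close> sends the second copy of \<open>a\<close> to the zero
  vector, which \<open>hdim\<close> discards. Expanding both copies therefore produces the shifts 0,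
  1 and 2 of \<open>weighted_hdim_Cons\<close>.\<close>

theorem weighted_hdim_doubled: "weighted_hdim L k = hdim (doubled L) k 0"
proof (induction "length L" arbitrary: L k)
  case 0
  then show ?case
    by (cases "k = 0") (auto simp: weighted_hdim_def intro!: sum.neutral elim: oddE evenE)
next
  case (Suc n)
  from Suc(2) obtain a L0 where L: "L = a # L0" "length L0 = n" by (metis length_Suc_conv)
  have IH: "weighted_hdim L0 k = hdim (doubled L0) k 0"
    "weighted_hdim (map (contract a) L0) k = hdim (map (contract a) (doubled L0)) k 0" for k
    using Suc(1)[of L0] Suc(1)[of "map (contract a) L0"] L by (simp_all add: doubled_map)
  show ?case
  proof (cases "a = 0")
    case True
    have "weighted_hdim (0 # L0) k = weighted_hdim L0 k"
      unfolding weighted_hdim_def by (simp only: hdim.simps if_True simp_thms)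
    then show ?thesis unfolding L(1) True using IH(1) by simp
  next
    case False
    then show ?thesis
      unfolding L(1) weighted_hdim_Cons[OF False] IH by (simp add: contract_self numeral_2_eq_2)
  qed
qed

definition total_hdim :: "('a::field ^ 'n) list \<Rightarrow> nat"
  where "total_hdim L = (\<Sum>k\<le>length L. hdim L k 0)"

lemma total_hdim_bound: "length L \<le> N \<Longrightarrow> total_hdim L = (\<Sum>k\<le>N. hdim L k 0)"
  unfolding total_hdim_def
  by (rule sum.mono_neutral_left) (use hdim_support[of L _ 0] in auto)

lemma total_hdim_Nil: "total_hdim [] = 1"
  by (simp add: total_hdim_def)

text \<open>The recursion at q = 1 and t = 0. Read on subfamilies, the summands count those without
  \<open>a\<close> and those with it; a zero vector belongs to no independent one.\<close>

lemma total_hdim_Cons: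
  "total_hdim (a # L) = total_hdim L + (if a = 0 then 0 else total_hdim (map (contract a) L))"
proof (cases "a = 0")
  case True
  then show ?thesis using total_hdim_bound[of L "Suc (length L)"] by (simp add: total_hdim_def)
next
  case False
  have "total_hdim (a # L) = (\<Sum>k\<le>Suc (length L). hdim (map (contract a) L) k 0) +
      (\<Sum>k\<le>Suc (length L). if k = 0 then 0 else hdim L (k - 1) 0)"
    unfolding total_hdim_def sum.distrib[symmetric] using False by simp
  also have "(\<Sum>k\<le>Suc (length L). if k = 0 then 0 else hdim L (k - 1) 0) = total_hdim L"
    by (subst sum.atMost_Suc_shift) (simp add: total_hdim_def)
  also have "(\<Sum>k\<le>Suc (length L). hdim (map (contract a) L) k 0) = total_hdim (map (contract a) L)"
    by (rule total_hdim_bound[symmetric]) simp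
  finally show ?thesis using False by simp
qed

text \<open>At q = 1 the specialization (q^2, q) is (1, 1), so grouping the pairs by
  \<open>2 * i + j\<close> loses nothing. This weight is at most \<open>3 * N\<close> on the
  square.\<close>

lemma hdim_total_sum:
  assumes "length L \<le> N"
  shows "(\<Sum>i\<le>N. \<Sum>j\<le>N. hdim L i j) = total_hdim (doubled L)"
proof -
  have len: "length (doubled L) = 2 * length L" by (induction L) auto
  have supp: "i \<le> N \<and> j \<le> N" if "hdim L i j \<noteq> 0" for i j
    using hdim_support[OF that] assms by linarith
  have "(\<Sum>(i, j)\<in>{p \<in> {..N} \<times> {..N}. (\<lambda>(i, j). 2 * i + j) p = k}. hdim L i j) = weighted_hdim L k" for k
    unfolding weighted_hdim_eq_sum
  proof (rule sum.mono_neutral_left)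
    have "{(i, j). 2 * i + j = k} \<subseteq> {..k} \<times> {..k}" by auto
    then show "finite {(i, j). 2 * i + j = k}" by (rule finite_subset) simp
  qed (use supp in auto)
  moreover have img: "(\<lambda>(i, j). 2 * i + j) ` ({..N} \<times> {..N}) \<subseteq> {..3 * N}" by auto
  ultimately have "(\<Sum>k\<le>3 * N. weighted_hdim L k) = (\<Sum>(i, j)\<in>{..N} \<times> {..N}. hdim L i j)"
    using sum.group[of "{..N} \<times> {..N}" "{..3 * N}" "\<lambda>(i, j). 2 * i + j" "\<lambda>(i, j). hdim L i j"] img
    by simp
  also have "\<dots> = (\<Sum>i\<le>N. \<Sum>j\<le>N. hdim L i j)"
    by (rule sum.cartesian_product[symmetric])
  also have "(\<Sum>k\<le>3 * N. weighted_hdim L k) = total_hdim (doubled L)"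
    unfolding weighted_hdim_doubled by (rule total_hdim_bound[symmetric]) (use assms len in simp)
  finally show ?thesis ..
qed

section \<open>Dimensions of quotients by ideals\<close>

lemma ring_type_ring: "ring (type_ring :: 'a::ring_1 ring)"
proof -
  have "\<exists>y. x + y = 0" for x :: 'a by (rule exI[of _ "- x"]) simp
  moreover have "\<exists>y. y + x = 0" for x :: 'a by (rule exI[of _ "- x"]) simp
  ultimately show ?thesis
    unfolding ring_of_type_algebra_def
    by unfold_locales (auto simp: algebra_simps Units_def)
qed

lemma type_ring_simps [simp]:
  "carrier type_ring = UNIV" "mult type_ring = (*)" "one type_ring = 1"
  "zero type_ring = 0" "add type_ring = (+)"
  by (auto simp: ring_of_type_algebra_def)

lemma ideal_type_ringI:
  fixes J :: "'a::ring_1 set"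
  assumes "0 \<in> J" "\<And>x y. x \<in> J \<Longrightarrow> y \<in> J \<Longrightarrow> x + y \<in> J"
    and "\<And>r x. x \<in> J \<Longrightarrow> r * x \<in> J" "\<And>r x. x \<in> J \<Longrightarrow> x * r \<in> J"
  shows "ideal J type_ring"
proof (rule idealI)
  interpret ring "type_ring :: 'a ring" by (rule ring_type_ring)
  show "subgroup J (add_monoid type_ring)"
  proof (rule add.subgroupI)
    fix x assume "x \<in> J"
    then have "- x \<in> J" using assms(3)[of x "- 1"] by simp
    moreover have "\<ominus>\<^bsub>type_ring\<^esub> x = - x" by (rule minus_equality) simp_all
    ultimately show "\<ominus>\<^bsub>type_ring\<^esub> x \<in> J" by simp
  qed (use assms in auto)
qed (use assms ring_type_ring in auto)

lemma ideal_generated_ideal: "ideal (generated_ideal G) (type_ring :: 'a::ring_1 ring)"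
  unfolding generated_ideal_def by (rule ring.genideal_ideal[OF ring_type_ring]) simp

lemma generated_ideal_base: "G \<subseteq> generated_ideal G"
  unfolding generated_ideal_def by (rule ring.genideal_self[OF ring_type_ring]) simp

lemma generated_ideal_minimal:
  assumes "0 \<in> J" "\<And>x y. x \<in> J \<Longrightarrow> y \<in> J \<Longrightarrow> x + y \<in> J"
    and "\<And>r x. x \<in> J \<Longrightarrow> r * x \<in> J" "\<And>r x. x \<in> J \<Longrightarrow> x * r \<in> J" and "G \<subseteq> J"
  shows "generated_ideal G \<subseteq> J"
  unfolding generated_ideal_def
  by (rule ring.genideal_minimal[OF ring_type_ring ideal_type_ringI]) (use assms in auto)

lemma ideal_closed:
  fixes I :: "'a::ring_1 set"
  assumes "ideal I type_ring"
  shows "0 \<in> I" "x \<in> I \<Longrightarrow> y \<in> I \<Longrightarrow> x + y \<in> I" "x \<in> I \<Longrightarrow> r * x \<in> I" "x \<in> I \<Longrightarrow> x * r \<in> I"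
    "x \<in> I \<Longrightarrow> y \<in> I \<Longrightarrow> x - y \<in> I"
proof -
  interpret ideal I type_ring by fact
  show 1: "0 \<in> I" "x \<in> I \<Longrightarrow> y \<in> I \<Longrightarrow> x + y \<in> I" "x \<in> I \<Longrightarrow> r * x \<in> I" "x \<in> I \<Longrightarrow> x * r \<in> I" for x y r
    using additive_subgroup.zero_closed[OF is_additive_subgroup]
      additive_subgroup.a_closed[OF is_additive_subgroup] I_l_closed I_r_closed by auto
  show "x \<in> I \<Longrightarrow> y \<in> I \<Longrightarrow> x - y \<in> I"
    using 1(2)[of x "- 1 * y"] 1(3)[of y "- 1"] by simp
qed

text \<open>Shared by both quotients. The assumption \<open>proper\<close> makes the complex scalars
  a subfield of the quotient, over which its dimension is taken.\<close>

locale scalar_quotient =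
  fixes cs :: "complex \<Rightarrow> 'a::ring_1" and I :: "'a set"
  assumes cs_add: "cs (a + b) = cs a + cs b"
    and cs_mult: "cs (a * b) = cs a * cs b"
    and cs_one: "cs 1 = 1"
    and ideal: "ideal I type_ring"
    and proper: "1 \<notin> I"
begin

abbreviation coset :: "'a \<Rightarrow> 'a set"
  where "coset x \<equiv> I +>\<^bsub>type_ring\<^esub> x"

lemma cs_zero: "cs 0 = 0" using cs_add[of 0 0] by simp
lemma cs_uminus: "cs (- a) = - cs a" using cs_add[of a "- a"] by (simp add: cs_zero eq_neg_iff_add_eq_0 add.commute)
lemma coset_eq_iff: "coset x = coset y \<longleftrightarrow> x - y \<in> I"
proof -
  have coset: "coset x = {i + x |i. i \<in> I}" for x
    by (auto simp: a_r_coset_def r_coset_def)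
  show ?thesis
  proof
    assume "coset x = coset y"
    moreover have "0 + x \<in> coset x" unfolding coset using ideal_closed(1)[OF ideal] by blast
    ultimately show "x - y \<in> I" unfolding coset by auto
  next
    assume xy: "x - y \<in> I"
    have "\<exists>j. i + x = j + y \<and> j \<in> I" "\<exists>j. i + y = j + x \<and> j \<in> I" if "i \<in> I" for i
      using ideal_closed(2)[OF ideal that xy] ideal_closed(5)[OF ideal that xy]
      by (auto intro: exI[of _ "i + (x - y)"] exI[of _ "i - (x - y)"])
    then show "coset x = coset y" unfolding coset by blast
  qed
qed

lemma coset_hom: "coset \<in> ring_hom type_ring (quotient_by I)"
  unfolding quotient_by_def by (rule ideal.rcos_ring_hom[OF ideal])

lemma ring_quotient: "ring (quotient_by I)"
  unfolding quotient_by_def by (rule ideal.quotient_is_ring[OF ideal])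

lemma coset_simps:
  "coset (x + y) = coset x \<oplus>\<^bsub>quotient_by I\<^esub> coset y"
  "coset (x * y) = coset x \<otimes>\<^bsub>quotient_by I\<^esub> coset y"
  "coset 1 = \<one>\<^bsub>quotient_by I\<^esub>" "coset 0 = \<zero>\<^bsub>quotient_by I\<^esub>" "coset x \<in> carrier (quotient_by I)"
proof -
  interpret ring_hom_ring "type_ring :: 'a ring" "quotient_by I" coset
    by (rule ring_hom_ringI2[OF ring_type_ring ring_quotient coset_hom])
  show "coset (x + y) = coset x \<oplus>\<^bsub>quotient_by I\<^esub> coset y"
    "coset (x * y) = coset x \<otimes>\<^bsub>quotient_by I\<^esub> coset y"
    "coset 1 = \<one>\<^bsub>quotient_by I\<^esub>" "coset 0 = \<zero>\<^bsub>quotient_by I\<^esub>" "coset x \<in> carrier (quotient_by I)"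
    using hom_add[of x y] hom_mult[of x y] hom_one hom_zero hom_closed[of x] by simp_all
qed

lemma subfield_scalars: "subfield (quotient_image I (range cs)) (quotient_by I)"
proof -
  let ?h = "\<lambda>c. coset (cs c)"
  interpret C: field "type_ring :: complex ring" by (rule field_from_type_algebra)
  interpret ring_hom_ring "type_ring :: complex ring" "quotient_by I" ?h
    by (rule ring_hom_ringI[OF C.ring_axioms ring_quotient])
      (simp_all add: coset_simps(5) coset_simps(1-4)[symmetric] cs_add cs_mult cs_one)
  have "\<one>\<^bsub>quotient_by I\<^esub> \<noteq> \<zero>\<^bsub>quotient_by I\<^esub>"
    unfolding coset_simps(3,4)[symmetric] coset_eq_iff using proper by simp
  from img_is_subfield(2)[OF C.carrier_is_subfield this] show ?thesis
    by (simp add: quotient_image_def image_image)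
qed

text \<open>A basis of the image of \<open>V\<close> in the quotient, expressed by representatives;
  independence modulo \<open>I\<close> also forces the cosets to be distinct.\<close>

definition basis_mod :: "'a set \<Rightarrow> 'a set \<Rightarrow> bool"
  where "basis_mod B V \<longleftrightarrow> finite B \<and>
    (\<forall>c. (\<Sum>b\<in>B. cs (c b) * b) \<in> I \<longrightarrow> (\<forall>b\<in>B. c b = 0)) \<and>
    (\<forall>c. (\<Sum>b\<in>B. cs (c b) * b) \<in> V) \<and>
    (\<forall>v\<in>V. \<exists>c. v - (\<Sum>b\<in>B. cs (c b) * b) \<in> I)"

text \<open>The dimension predicate grows by line extensions, so the members of \<open>B\<close> are
  adjoined one at a time.\<close>

lemma dimension_combinations:
  assumes "finite B" "\<And>c. (\<Sum>b\<in>B. cs (c b) * b) \<in> I \<Longrightarrow> \<forall>b\<in>B. c b = 0"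
  shows "ring.dimension (quotient_by I) (card B) (quotient_image I (range cs))
    (range (\<lambda>c. coset (\<Sum>b\<in>B. cs (c b) * b)))"
  using assms
proof (induction B)
  case empty
  then show ?case
    using ring.zero_dim[OF ring_quotient] by (simp add: coset_simps)
next
  case (insert x B)
  have sum: "(\<Sum>b\<in>insert x B. cs ((c(x := k)) b) * b) = cs k * x + (\<Sum>b\<in>B. cs (c b) * b)" for c k
    unfolding sum.insert[OF insert.hyps] using insert.hyps(2)
    by (intro arg_cong2[of _ _ _ _ "(+)"] sum.cong) auto
  have indep: "\<forall>b\<in>B. c b = 0" if "(\<Sum>b\<in>B. cs (c b) * b) \<in> I" for c
  proof -
    have "(\<Sum>b\<in>insert x B. cs ((c(x := 0)) b) * b) \<in> I"
      unfolding sum using that by (simp add: cs_zero)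
    from insert.prems[OF this] show ?thesis using insert.hyps(2) by (auto split: if_splits)
  qed
  let ?E = "range (\<lambda>c. coset (\<Sum>b\<in>B. cs (c b) * b))"
  have "coset x \<notin> ?E"
  proof
    assume "coset x \<in> ?E"
    then obtain c where "x - (\<Sum>b\<in>B. cs (c b) * b) \<in> I" by (auto simp: coset_eq_iff)
    then have "(\<Sum>b\<in>insert x B. cs (((\<lambda>b. - c b)(x := 1)) b) * b) \<in> I"
      unfolding sum by (simp add: cs_one cs_uminus sum_negf)
    from insert.prems[OF this] show False by auto
  qed
  from ring.Suc_dim[OF ring_quotient coset_simps(5) this insert.IH[OF indep]]
  have "ring.dimension (quotient_by I) (Suc (card B)) (quotient_image I (range cs))
    (ring.line_extension (quotient_by I) (quotient_image I (range cs)) (coset x) ?E)" .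
  also have "ring.line_extension (quotient_by I) (quotient_image I (range cs)) (coset x) ?E =
      range (\<lambda>c. coset (\<Sum>b\<in>insert x B. cs (c b) * b))"
  proof (rule Set.set_eqI)
    fix u
    have "u \<in> ring.line_extension (quotient_by I) (quotient_image I (range cs)) (coset x) ?E \<longleftrightarrow>
        (\<exists>k c. u = coset (cs k * x + (\<Sum>b\<in>B. cs (c b) * b)))"
      by (auto simp: ring.line_extension_mem_iff[OF ring_quotient] quotient_image_def coset_simps)
    also have "\<dots> \<longleftrightarrow> u \<in> range (\<lambda>c. coset (\<Sum>b\<in>insert x B. cs (c b) * b))"
    proof
      assume "\<exists>k c. u = coset (cs k * x + (\<Sum>b\<in>B. cs (c b) * b))"
      then obtain k c where "u = coset (cs k * x + (\<Sum>b\<in>B. cs (c b) * b))" by blast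
      then have u: "u = coset (\<Sum>b\<in>insert x B. cs ((c(x := k)) b) * b)" by (simp only: sum)
      show "u \<in> range (\<lambda>c. coset (\<Sum>b\<in>insert x B. cs (c b) * b))"
        unfolding u by (rule rangeI)
    next
      assume "u \<in> range (\<lambda>c. coset (\<Sum>b\<in>insert x B. cs (c b) * b))"
      then obtain c where "u = coset (\<Sum>b\<in>insert x B. cs (c b) * b)" by blast
      then have "u = coset (cs (c x) * x + (\<Sum>b\<in>B. cs (c b) * b))"
        by (simp only: sum.insert[OF insert.hyps])
      then show "\<exists>k c. u = coset (cs k * x + (\<Sum>b\<in>B. cs (c b) * b))" by blast
    qed
    finally show "u \<in> ring.line_extension (quotient_by I) (quotient_image I (range cs)) (coset x) ?E \<longleftrightarrow>
        u \<in> range (\<lambda>c. coset (\<Sum>b\<in>insert x B. cs (c b) * b))" .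
  qed
  finally show ?case using insert.hyps by simp
qed

lemma dimension_basis_mod:
  assumes "basis_mod B V"
  shows "ring.dimension (quotient_by I) (card B) (quotient_image I (range cs)) (quotient_image I V)"
proof -
  have "quotient_image I V = range (\<lambda>c. coset (\<Sum>b\<in>B. cs (c b) * b))"
  proof
    show "quotient_image I V \<subseteq> range (\<lambda>c. coset (\<Sum>b\<in>B. cs (c b) * b))"
    proof
      fix u assume "u \<in> quotient_image I V"
      then obtain v where v: "v \<in> V" "u = coset v" unfolding quotient_image_def by blast
      with assms obtain c where "v - (\<Sum>b\<in>B. cs (c b) * b) \<in> I"
        unfolding basis_mod_def by blast
      then have eq: "coset v = coset (\<Sum>b\<in>B. cs (c b) * b)" by (simp only: coset_eq_iff)
      show "u \<in> range (\<lambda>c. coset (\<Sum>b\<in>B. cs (c b) * b))"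
        unfolding v(2) eq by (rule rangeI)
    qed
    show "range (\<lambda>c. coset (\<Sum>b\<in>B. cs (c b) * b)) \<subseteq> quotient_image I V"
      using assms unfolding basis_mod_def quotient_image_def by blast
  qed
  then show ?thesis using dimension_combinations[of B] assms by (simp add: basis_mod_def)
qed

lemma dim_basis_mod:
  assumes "basis_mod B V"
  shows "ring.dim (quotient_by I) (quotient_image I (range cs)) (quotient_image I V) = card B"
  using ring.dimI[OF ring_quotient subfield_scalars dimension_basis_mod[OF assms]]
  by (simp add: over_def)

lemma carrier_quotient: "carrier (quotient_by I) = quotient_image I UNIV"
  by (auto simp: quotient_by_def quotient_image_def FactRing_def A_RCOSETS_def RCOSETS_def
      a_r_coset_def)

end

section \<open>Monomials and the apolar pairing\<close>

definition exponent_fact :: "('n::finite \<Rightarrow>\<^sub>0 nat) \<Rightarrow> complex"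
  where "exponent_fact m = (\<Prod>i\<in>UNIV. fact (Poly_Mapping.lookup m i))"

lemma exponent_fact_nonzero [simp]: "exponent_fact m \<noteq> 0"
  by (simp add: exponent_fact_def)

lemma exponent_fact_Suc:
  "exponent_fact (m + Poly_Mapping.single i 1) =
    of_nat (Suc (Poly_Mapping.lookup m i)) * exponent_fact m"
proof -
  have "exponent_fact (m + Poly_Mapping.single i 1) =
      fact (Suc (Poly_Mapping.lookup m i)) * (\<Prod>k\<in>UNIV - {i}. fact (Poly_Mapping.lookup m k))"
    unfolding exponent_fact_def
    by (subst prod.remove[of _ i]) (auto simp: lookup_add lookup_single when_def intro!: prod.cong)
  also have "\<dots> = of_nat (Suc (Poly_Mapping.lookup m i)) * exponent_fact m"
    unfolding exponent_fact_def by (subst prod.remove[of UNIV i]) (simp_all del: of_nat_Suc)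
  finally show ?thesis .
qed

text \<open>Bilinear without conjugation, so that \<open>mulX a\<close> has adjoint
  \<open>dd a\<close> for complex \<open>a\<close>. Summing over the keys of \<open>f\<close> keeps
  the sum finite; the apparent asymmetry is removed by \<open>pairing_sym\<close>.\<close>

definition pairing :: "'n::{finite, linorder} superspace \<Rightarrow> 'n superspace \<Rightarrow> complex"
  where "pairing f g = (\<Sum>S\<in>UNIV. \<Sum>m\<in>Poly_Mapping.keys (theta_coeff f S).
    exponent_fact m * coef f S m * coef g S m)"

lemma pairing_sym: "pairing f g = pairing g f"
proof -
  have *: "pairing f g = (\<Sum>S\<in>UNIV. \<Sum>m\<in>Poly_Mapping.keys (theta_coeff f S) \<inter>
      Poly_Mapping.keys (theta_coeff g S). exponent_fact m * coef f S m * coef g S m)" for f g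
    unfolding pairing_def
    by (intro sum.cong refl sum.mono_neutral_right) (auto simp: in_keys_iff)
  show ?thesis unfolding *[of f g] *[of g f] by (intro sum.cong) auto
qed

lemma pairing_add_right: "pairing f (g + h) = pairing f g + pairing f h"
  by (simp add: pairing_def algebra_simps sum.distrib)

lemma pairing_scale_right: "pairing f (sscale c g) = c * pairing f g"
  by (simp add: pairing_def sum_distrib_left mult_ac)

lemma pairing_zero_right [simp]: "pairing f 0 = 0"
  using pairing_scale_right[of f 0 0] by simp

lemma pairing_sum_right: "pairing f (sum G A) = (\<Sum>a\<in>A. pairing f (G a))"
  by (induction A rule: infinite_finite_induct) (simp_all add: pairing_add_right)

lemma pairing_diff_right: "pairing f (g - h) = pairing f g - pairing f h"
  by (simp add: pairing_def algebra_simps sum_subtractf)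

lemma pairing_add_left: "pairing (f + g) h = pairing f h + pairing g h"
  by (simp only: pairing_sym[of _ h] pairing_add_right)

lemma pairing_scale_left: "pairing (sscale c f) g = c * pairing f g"
  by (simp only: pairing_sym[of _ g] pairing_scale_right)

lemma pairing_zero_left [simp]: "pairing 0 g = 0"
  by (simp only: pairing_sym[of _ g] pairing_zero_right)

lemma pairing_sum_left: "pairing (sum G A) f = (\<Sum>a\<in>A. pairing (G a) f)"
  by (simp only: pairing_sym[of _ f] pairing_sum_right)

lemma pairing_diff_left: "pairing (f - g) h = pairing f h - pairing g h"
  by (simp only: pairing_sym[of _ h] pairing_diff_right)

lemma pairing_component_orthogonal:
  assumes "f \<in> bideg i j" "g \<in> bideg i' j'" "(i, j) \<noteq> (i', j')"
  shows "pairing f g = 0"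
  unfolding pairing_def
proof (intro sum.neutral ballI)
  fix S m
  show "exponent_fact m * coef f S m * coef g S m = 0"
  proof (rule ccontr)
    assume "exponent_fact m * coef f S m * coef g S m \<noteq> 0"
    then have "coef f S m \<noteq> 0" "coef g S m \<noteq> 0" by simp_all
    with assms show False unfolding bideg_iff by metis
  qed
qed

text \<open>The weight \<open>exponent_fact\<close> is made for this: raising the exponent of the
  variable \<open>i\<close> by one multiplies it by the new exponent, which is the coefficient that
  the derivative produces.\<close>

lemma pairing_mulx: "pairing (mulx i f) g = pairing f (spderiv i g)"
  unfolding pairing_def
proof (rule sum.cong[OF refl])
  fix S
  let ?e = "Poly_Mapping.single i (1::nat)"
  have c: "coef (mulx i f) S (m + ?e) = coef f S m" for m
    by (simp add: coef_mulx lookup_add)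
  have "bij_betw (\<lambda>m. m + ?e) (Poly_Mapping.keys (theta_coeff f S))
      (Poly_Mapping.keys (theta_coeff (mulx i f) S))"
  proof (rule bij_betwI')
    fix m assume "m \<in> Poly_Mapping.keys (theta_coeff (mulx i f) S)"
    then have nz: "coef (mulx i f) S m \<noteq> 0" by (simp add: in_keys_iff)
    then have "Poly_Mapping.lookup m i \<noteq> 0" by (simp add: coef_mulx split: if_splits)
    from exponent_split[OF this] have m: "m = (m - ?e) + ?e" by (simp only: add.commute)
    then have "m - ?e \<in> Poly_Mapping.keys (theta_coeff f S)"
      using nz c[of "m - ?e"] by (simp only: in_keys_iff) simp
    with m show "\<exists>k\<in>Poly_Mapping.keys (theta_coeff f S). m = k + ?e" by blast
  qed (simp_all add: in_keys_iff c del: One_nat_def)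
  from sum.reindex_bij_betw[OF this, of "\<lambda>m. exponent_fact m * coef (mulx i f) S m * coef g S m"]
  show "(\<Sum>m\<in>Poly_Mapping.keys (theta_coeff (mulx i f) S).
      exponent_fact m * coef (mulx i f) S m * coef g S m) =
    (\<Sum>m\<in>Poly_Mapping.keys (theta_coeff f S). exponent_fact m * coef f S m * coef (spderiv i g) S m)"
    by (simp only: c exponent_fact_Suc coef_spderiv mult_ac)
qed

lemma pairing_multheta: "pairing (multheta i f) g = pairing f (contract_theta i g)"
proof -
  let ?h = "\<lambda>f g S. \<Sum>m\<in>Poly_Mapping.keys (theta_coeff f S). exponent_fact m * coef f S m * coef g S m"
  have "pairing (multheta i f) g = (\<Sum>S\<in>{S. i \<in> S}. ?h (multheta i f) g S)"
    unfolding pairing_def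
    by (intro sum.mono_neutral_right ballI sum.neutral) (auto simp: coef_multheta)
  also have "\<dots> = (\<Sum>S\<in>{S. i \<notin> S}. ?h f (contract_theta i g) S)"
  proof (rule sum.reindex_bij_witness[where i = "insert i" and j = "\<lambda>S. S - {i}"])
    fix S assume "S \<in> {S. i \<in> S}"
    then have S: "i \<in> S" by simp
    have keys: "Poly_Mapping.keys (theta_coeff (multheta i f) S) =
        Poly_Mapping.keys (theta_coeff f (S - {i}))"
      using S by (auto simp: in_keys_iff coef_multheta position_sign_def)
    show "?h f (contract_theta i g) (S - {i}) = ?h (multheta i f) g S"
      unfolding keys using S by (simp add: coef_multheta coef_contract_theta insert_absorb mult_ac)
  qed auto
  also have "\<dots> = pairing f (contract_theta i g)"
    unfolding pairing_def
    by (intro sum.mono_neutral_left ballI sum.neutral) (auto simp: coef_contract_theta)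
  finally show ?thesis .
qed

lemma pairing_op_comb:
  assumes "\<And>i. pairing (F i f) g = pairing f (G i g)"
  shows "pairing (op_comb F v f) g = pairing f (op_comb G v g)"
  by (simp add: op_comb_def pairing_sum_left pairing_sum_right pairing_scale_left
      pairing_scale_right assms)

lemma pairing_mulX: "pairing (mulX a f) g = pairing f (dd a g)"
  unfolding mulX_def dd_def by (intro pairing_op_comb pairing_mulx)

lemma pairing_mulT: "pairing (mulT a f) g = pairing f (ii a g)"
  unfolding mulT_def ii_def by (intro pairing_op_comb pairing_multheta)

lemma pairing_mulX_pow: "pairing ((mulX a ^^ n) f) g = pairing f ((dd a ^^ n) g)"
  by (induction n arbitrary: g) (simp_all add: pairing_mulX funpow_swap1[of "dd a"])

section \<open>Monomials, nondegeneracy and the representation of functionals\<close>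

definition monomial :: "('n \<Rightarrow>\<^sub>0 nat) \<Rightarrow> 'n set \<Rightarrow> 'n superspace"
  where "monomial m S = Superspace (\<lambda>U. if U = S then Poly_Mapping.single m 1 else 0)"

lemma coef_monomial: "coef (monomial m S) U k = (if U = S \<and> k = m then 1 else 0)"
  by (auto simp: monomial_def Superspace_inverse lookup_single when_def)

lemma keys_monomial:
  "Poly_Mapping.keys (theta_coeff (monomial m S) U) = (if U = S then {m} else {})"
  by (simp add: monomial_def Superspace_inverse)

lemma monomial_component: "monomial m S \<in> bideg (monom_degree m) (card S)"
  by (auto simp: bideg_iff coef_monomial split: if_splits)

lemma pairing_monomial: "pairing (monomial m S) f = exponent_fact m * coef f S m"
proof -
  have "pairing (monomial m S) f = (\<Sum>U\<in>UNIV. if U = S then exponent_fact m * coef f S m else 0)"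
    unfolding pairing_def by (rule sum.cong) (auto simp: keys_monomial coef_monomial)
  then show ?thesis by simp
qed

lemma pairing_nondegenerate:
  assumes "\<And>i j w. w \<in> bideg i j \<Longrightarrow> pairing w f = 0"
  shows "f = 0"
proof (rule superspace_coef_eqI)
  fix S m
  from assms[OF monomial_component] show "coef f S m = coef 0 S m"
    by (simp add: pairing_monomial)
qed

lemma monomial_expansion:
  assumes "finite P" "\<And>S m. coef f S m \<noteq> 0 \<Longrightarrow> (S, m) \<in> P"
  shows "f = (\<Sum>(S, m)\<in>P. sscale (coef f S m) (monomial m S))"
proof (rule superspace_coef_eqI)
  fix U k
  have "coef (\<Sum>(S, m)\<in>P. sscale (coef f S m) (monomial m S)) U k =
      (\<Sum>p\<in>P. if p = (U, k) then coef f U k else 0)"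
    unfolding coef_sum by (rule sum.cong) (auto simp: coef_monomial split: if_splits)
  then show "coef f U k = coef (\<Sum>(S, m)\<in>P. sscale (coef f S m) (monomial m S)) U k"
    using assms by (auto simp: sum.delta)
qed

lemma finite_monom_degree: "finite {m :: 'n::finite \<Rightarrow>\<^sub>0 nat. monom_degree m = i}"
proof (rule finite_imageD)
  have le: "Poly_Mapping.lookup m k \<le> i" if "monom_degree m = i" for m :: "'n \<Rightarrow>\<^sub>0 nat" and k
    using that member_le_sum[of k UNIV "Poly_Mapping.lookup m"] by (simp add: monom_degree_def)
  have "finite (UNIV \<rightarrow>\<^sub>E {..i} :: ('n \<Rightarrow> nat) set)" by (rule finite_PiE) simp_all
  moreover have "Poly_Mapping.lookup ` {m :: 'n \<Rightarrow>\<^sub>0 nat. monom_degree m = i} \<subseteq> (UNIV \<rightarrow>\<^sub>E {..i})"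
    by (rule image_subsetI) (simp add: PiE_UNIV_domain le)
  ultimately show "finite (Poly_Mapping.lookup ` {m :: 'n \<Rightarrow>\<^sub>0 nat. monom_degree m = i})"
    by (rule rev_finite_subset)
  show "inj_on Poly_Mapping.lookup {m :: 'n \<Rightarrow>\<^sub>0 nat. monom_degree m = i}"
    by (rule inj_onI) (simp only: poly_mapping_eq_iff)
qed

lemma finite_monomials:
  "finite {(S, m). card (S :: 'n::finite set) = j \<and> monom_degree (m :: 'n \<Rightarrow>\<^sub>0 nat) = i}"
proof (rule finite_subset)
  show "finite ((UNIV :: 'n set set) \<times> {m :: 'n \<Rightarrow>\<^sub>0 nat. monom_degree m = i})"
    by (rule finite_cartesian_product[OF finite finite_monom_degree])
qed blast

interpretation ss_functional: vector_space_pair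
  "sscale :: complex \<Rightarrow> 'n::{finite, linorder} superspace \<Rightarrow> 'n superspace"
  "(*) :: complex \<Rightarrow> complex \<Rightarrow> complex"
  by (rule vector_space_pair.intro[OF ss.vector_space_axioms
      vector_space_over_itself.vector_space_axioms])

text \<open>Monomials are orthogonal with squares \<open>exponent_fact m\<close>, which dictates the
  coefficients; a component has finitely many of them.\<close>

lemma functional_representation:
  fixes \<phi> :: "'a::{finite, linorder} superspace \<Rightarrow> complex"
  assumes "Vector_Spaces.linear sscale (*) \<phi>"
  obtains b where "b \<in> bideg i j"
    "\<And>v. v \<in> bideg i j \<Longrightarrow> \<phi> v = pairing b v"
proof -
  interpret Vector_Spaces.linear sscale "(*)" \<phi> by fact
  define P where "P = {(S :: 'a set, m :: 'a \<Rightarrow>\<^sub>0 nat). card S = j \<and> monom_degree m = i}"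
  have P: "finite P" unfolding P_def by (rule finite_monomials)
  let ?b = "\<Sum>(S, m)\<in>P. sscale (\<phi> (monomial m S) / exponent_fact m) (monomial m S)"
  show ?thesis
  proof
    show "?b \<in> bideg i j"
    proof (rule bideg_closed(6))
      fix p assume "p \<in> P"
      then obtain S m where "p = (S, m)" "card S = j" "monom_degree m = i"
        unfolding P_def by blast
      with monomial_component[of m S]
      show "(case p of (S, m) \<Rightarrow> sscale (\<phi> (monomial m S) / exponent_fact m) (monomial m S))
          \<in> bideg i j"
        by (simp add: bideg_closed(5))
    qed
    fix v :: "'a superspace" assume v: "v \<in> bideg i j"
    have v_eq: "v = (\<Sum>(S, m)\<in>P. sscale (coef v S m) (monomial m S))"
      by (rule monomial_expansion[OF P]) (use v in \<open>auto simp: P_def bideg_iff\<close>)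
    from arg_cong[OF v_eq, of \<phi>]
    have "\<phi> v = \<phi> (\<Sum>(S, m)\<in>P. sscale (coef v S m) (monomial m S))" .
    also have "\<dots> = (\<Sum>(S, m)\<in>P. coef v S m * \<phi> (monomial m S))"
      unfolding sum by (rule sum.cong) (auto simp: scale)
    also have "\<dots> = pairing ?b v"
      unfolding pairing_sum_left
      by (rule sum.cong) (auto simp: pairing_scale_left pairing_monomial)
    finally show "\<phi> v = pairing ?b v" .
  qed
qed

section \<open>The ideal and its orthogonal complement\<close>

text \<open>Reduces closure under multiplication by arbitrary elements to scalars,
  \<open>mulx\<close> and \<open>multheta\<close>. A monomial is built by attaching its odd factors
  and then its variables, and any element is a finite sum of monomials.\<close>

lemma superspace_induct [case_names scalar add mulx multheta]:
  assumes scalar: "\<And>c. P (sscale c 1)"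
    and add: "\<And>f g. P f \<Longrightarrow> P g \<Longrightarrow> P (f + g)"
    and mulx: "\<And>i f. P f \<Longrightarrow> P (mulx i f)"
    and multheta: "\<And>i f. P f \<Longrightarrow> P (multheta i f)"
  shows "P f"
proof -
  have P0: "P 0" using scalar[of 0] by simp
  have theta: "P (sscale c (monomial 0 S))" for c S
    using finite[of S]
  proof (induction S arbitrary: c)
    case empty
    have "monomial 0 {} = (1 :: 'a superspace)"
      by (rule superspace_coef_eqI) (auto simp: coef_monomial coef_one)
    then show ?case using scalar by simp
  next
    case (insert i S)
    have "multheta i (sscale (c * position_sign i S) (monomial 0 S)) = sscale c (monomial 0 (insert i S))"
    proof (rule superspace_coef_eqI)
      fix U k
      have "U - {i} = S \<longleftrightarrow> U = insert i S" if "i \<in> U"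
        using that insert.hyps(2) by blast
      then show "coef (multheta i (sscale (c * position_sign i S) (monomial 0 S))) U k =
          coef (sscale c (monomial 0 (insert i S))) U k"
        using insert.hyps(2) position_sign_cancel[of i S c]
        by (cases "i \<in> U") (auto simp: coef_multheta coef_monomial mult_ac simp del: position_sign_cancel)
    qed
    with multheta[OF insert.IH] show ?case by metis
  qed
  have mon: "P (sscale c (monomial m S))" for c m S
  proof (induction "monom_degree m" arbitrary: m)
    case 0
    then show ?case using theta by simp
  next
    case (Suc d)
    then have "m \<noteq> 0" by (auto simp: monom_degree_def)
    then obtain i where i: "Poly_Mapping.lookup m i \<noteq> 0"
      by (metis lookup_zero poly_mapping_eqI)
    let ?m = "m - Poly_Mapping.single i 1"
    note m = exponent_split[OF i]
    have "mulx i (sscale c (monomial ?m S)) = sscale c (monomial m S)"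
    proof (rule superspace_coef_eqI)
      fix U k
      have "k - Poly_Mapping.single i 1 = ?m \<longleftrightarrow> k = m" if "Poly_Mapping.lookup k i \<noteq> 0"
        using exponent_split[OF that] m by metis
      then show "coef (mulx i (sscale c (monomial ?m S))) U k = coef (sscale c (monomial m S)) U k"
        using i unfolding coef_mulx coef_sscale coef_monomial by auto
    qed
    moreover have "monom_degree m = Suc (monom_degree ?m)"
      using m by (metis monom_degree_add monom_degree_single plus_1_eq_Suc)
    ultimately show ?case using mulx Suc by (metis nat.inject)
  qed
  have sum: "P (\<Sum>a\<in>A. F a)" if "\<And>a. P (F a)" for A :: "('a set \<times> ('a \<Rightarrow>\<^sub>0 nat)) set" and F
    by (induction A rule: infinite_finite_induct) (simp_all add: P0 add that)
  let ?Q = "Sigma UNIV (\<lambda>S. Poly_Mapping.keys (theta_coeff f S))"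
  have "f = (\<Sum>(S, m)\<in>?Q. sscale (coef f S m) (monomial m S))"
    by (rule monomial_expansion) (auto simp: in_keys_iff)
  then show "P f" using sum[of "\<lambda>(S, m). sscale (coef f S m) (monomial m S)" ?Q] mon by auto
qed

section \<open>The grading automorphism and right multiplication\<close>

definition parity :: "'n::{finite, linorder} superspace \<Rightarrow> 'n superspace"
  where "parity f = Superspace (\<lambda>S. mconst ((- 1) ^ card S) * theta_coeff f S)"

lemma coef_parity: "coef (parity f) S m = (- 1) ^ card S * coef f S m"
  by (simp add: parity_def Superspace_inverse lookup_mconst_mult)

lemma slinear_parity: "slinear parity"
  by (rule slinearI; rule superspace_coef_eqI) (auto simp: coef_parity algebra_simps)

lemma parity_dd: "parity (dd l f) = dd l (parity f)"
proof -
  interpret Vector_Spaces.linear sscale sscale parity by (rule slinear_parity)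
  have "parity (spderiv i f) = spderiv i (parity f)" for i
    by (rule superspace_coef_eqI) (simp add: coef_parity coef_spderiv mult_ac)
  then show ?thesis by (simp add: dd_def op_comb_def sum scale)
qed

lemma parity_ii: "ii l (parity f) = - parity (ii l f)"
proof -
  interpret Vector_Spaces.linear sscale sscale parity by (rule slinear_parity)
  have "contract_theta i (parity f) = - parity (contract_theta i f)" for i
    by (rule superspace_coef_eqI) (auto simp: coef_parity coef_contract_theta)
  then show ?thesis by (simp add: ii_def op_comb_def sum scale sum_negf)
qed

lemma pairing_parity: "pairing (parity f) g = pairing f (parity g)"
proof -
  have "Poly_Mapping.keys (theta_coeff (parity f) S) = Poly_Mapping.keys (theta_coeff f S)" for S
    by (auto simp: in_keys_iff coef_parity)
  then show ?thesis by (simp add: pairing_def coef_parity mult_ac)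
qed

text \<open>Moving \<open>theta i\<close> from the right end to the left passes one odd factor for
  each element of the index set, which is the sign of \<open>parity\<close>. This is how the
  two-sidedness of the ideal is handled.\<close>

lemma right_mult_theta: "f * theta i = multheta i (parity f)"
proof (rule superspace_coef_eqI)
  fix U and m :: "'a \<Rightarrow>\<^sub>0 nat"
  have "theta_coeff (f * theta i) U =
      (\<Sum>S\<in>Pow U. if S = U - {i} then (if i \<in> U then theta_sign S (U - S) * theta_coeff f S else 0) else 0)"
    unfolding times_superspace.rep_eq theta_coeff_theta by (rule sum.cong) auto
  also have "\<dots> = (if i \<in> U then theta_sign (U - {i}) {i} * theta_coeff f (U - {i}) else 0)"
    by (auto simp: sum.delta double_diff)
  finally have *: "theta_coeff (f * theta i) U = \<dots>" .
  show "coef (f * theta i) U m = coef (multheta i (parity f)) U m"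
  proof (cases "i \<in> U")
    case True
    let ?R = "U - {i}"
    have "inversions ?R {i} = (\<lambda>s. (s, i)) ` {s \<in> ?R. i < s}"
      by (auto simp: inversions_def)
    then have inv: "card (inversions ?R {i}) = card {s \<in> ?R. i < s}"
      by (simp add: card_image inj_on_def)
    have "card ?R = card ({s \<in> ?R. s < i} \<union> {s \<in> ?R. i < s})"
      by (rule arg_cong[where f = card]) auto
    also have "\<dots> = card {s \<in> ?R. s < i} + card {s \<in> ?R. i < s}"
      by (rule card_Un_disjoint) auto
    finally have "(- 1) ^ card ?R = position_sign i ?R * (- 1) ^ card {s \<in> ?R. i < s}"
      by (simp only: position_sign_def power_add)
    then have "position_sign i ?R * (- 1) ^ card ?R = (- 1) ^ card {s \<in> ?R. i < s}"
      by (simp only: position_sign_cancel)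
    then show ?thesis
      using True by (simp add: * coef_multheta coef_parity theta_sign_def inv
          lookup_neg_one_power_mult flip: mult.assoc)
  qed (simp add: * coef_multheta)
qed

lemma of_mpoly_central: "f * of_mpoly p = of_mpoly p * f"
proof (rule superspace_eqI)
  fix U
  have "theta_coeff (f * of_mpoly p) U =
      (\<Sum>S\<in>Pow U. if S = U then theta_sign U {} * theta_coeff f U * p else 0)"
    unfolding times_superspace.rep_eq theta_coeff_of_mpoly by (rule sum.cong) auto
  then show "theta_coeff (f * of_mpoly p) U = theta_coeff (of_mpoly p * f) U"
    by (simp add: sum.delta theta_sign_def inversions_def theta_coeff_of_mpoly_mult mult.commute)
qed

lemma of_mpoly_add: "of_mpoly (p + q) = of_mpoly p + of_mpoly q"
  by (rule superspace_eqI) (simp add: theta_coeff_of_mpoly plus_superspace.rep_eq)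

lemma of_mpoly_zero: "of_mpoly 0 = 0"
  by (rule superspace_eqI) (simp add: theta_coeff_of_mpoly zero_superspace.rep_eq)

lemma of_mpoly_one: "of_mpoly 1 = 1"
  by (rule superspace_eqI) (simp add: theta_coeff_of_mpoly one_superspace.rep_eq)

lemma of_mpoly_sum: "of_mpoly (sum F A) = (\<Sum>a\<in>A. of_mpoly (F a))"
  by (induction A rule: infinite_finite_induct) (simp_all add: of_mpoly_zero of_mpoly_add)

lemma of_mpoly_linform_power: "of_mpoly (linform l ^ n) * f = (mulX l ^^ n) f"
proof (induction n)
  case (Suc n)
  have "of_mpoly (linform l) * f = mulX l f" for f
    by (simp add: linform_def mulX_def op_comb_def of_mpoly_sum of_mpoly_mult sscale_def mulx_def
        sum_distrib_right mult.assoc)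
  moreover have "of_mpoly (linform l ^ Suc n) * f = of_mpoly (linform l) * (of_mpoly (linform l ^ n) * f)"
    by (simp only: power_Suc of_mpoly_mult mult.assoc)
  ultimately show ?case using Suc by simp
qed (simp add: of_mpoly_one)

lemma euler_linform_power:
  "euler (of_mpoly (linform l ^ Suc n)) = sscale (of_nat (Suc n)) (mulT l ((mulX l ^^ n) 1))"
proof -
  have pow: "of_mpoly (linform l ^ Suc n) = (mulX l ^^ Suc n) 1"
    using of_mpoly_linform_power[of l "Suc n" 1] by simp
  have dotp: "dotp l (axis i 1) = l $ i" for i
  proof -
    have "dotp l (axis i 1) = (\<Sum>k\<in>UNIV. if k = i then l $ k else 0)"
      unfolding dotp_def by (rule sum.cong) (auto simp: axis_def)
    then show ?thesis by simp
  qed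
  have "spderiv i ((mulX l ^^ Suc n) 1) = sscale (of_nat (Suc n) * l $ i) ((mulX l ^^ n) 1)" for i
    unfolding spderiv_eq_dd dd_mulX_pow dotp by (simp del: of_nat_Suc funpow.simps)
  then have "euler (of_mpoly (linform l ^ Suc n)) =
      (\<Sum>i\<in>UNIV. sscale (of_nat (Suc n) * l $ i) ((mulX l ^^ n) 1) * theta i)"
    by (simp only: euler_def pow)
  also have "\<dots> = (\<Sum>i\<in>UNIV. sscale (of_nat (Suc n) * l $ i) ((mulX l ^^ n) (multheta i 1)))"
    by (simp add: sscale_def mult.assoc multheta_def flip: of_mpoly_linform_power)
  also have "\<dots> = sscale (of_nat (Suc n)) ((mulX l ^^ n) (mulT l 1))"
    by (simp add: mulT_def op_comb_def mulX_pow.sum mulX_pow.scale ss.scale_sum_right del: of_nat_Suc)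
  finally show ?thesis by (simp add: mulX_pow_mulT)
qed

lemma inverse_system_dd:
  assumes "f \<in> inverse_system L"
  shows "dd e f \<in> inverse_system L"
proof (rule inverse_systemI)
  fix l
  show "(dd l ^^ Suc (nonzero_count L l)) (dd e f) = 0"
    unfolding dd_pow_dd inverse_systemD(1)[OF assms order_refl] by simp
  show "(dd l ^^ nonzero_count L l) (ii l (dd e f)) = 0"
    unfolding dd_ii[symmetric] dd_pow_dd inverse_systemD(2)[OF assms order_refl] by simp
qed

lemma inverse_system_parity:
  assumes "f \<in> inverse_system L"
  shows "parity f \<in> inverse_system L"
proof -
  interpret Vector_Spaces.linear sscale sscale parity by (rule slinear_parity)
  have pow: "(dd l ^^ n) (parity g) = parity ((dd l ^^ n) g)" for l n g
    by (rule funpow_commute) (simp add: parity_dd)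
  show ?thesis
  proof (rule inverse_systemI)
    fix l
    show "(dd l ^^ Suc (nonzero_count L l)) (parity f) = 0"
      unfolding pow inverse_systemD(1)[OF assms order_refl] by (rule zero)
    show "(dd l ^^ nonzero_count L l) (ii l (parity f)) = 0"
      unfolding parity_ii dd_pow.neg pow inverse_systemD(2)[OF assms order_refl] by (simp add: zero)
  qed
qed

definition orthogonal_complement :: "'n::{finite, linorder} superspace set \<Rightarrow> 'n superspace set"
  where "orthogonal_complement D = {w. \<forall>u\<in>D. pairing w u = 0}"

lemma orthogonal_complement_steps:
  fixes L :: "(complex ^ 'n::{finite, linorder}) list"
  assumes "w \<in> orthogonal_complement (inverse_system L)"
  shows "mulx i w \<in> orthogonal_complement (inverse_system L)"
    and "multheta i w \<in> orthogonal_complement (inverse_system L)"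
    and "parity w \<in> orthogonal_complement (inverse_system L)"
    and "sscale c w \<in> orthogonal_complement (inverse_system L)"
proof -
  have w: "pairing w u = 0" if "u \<in> inverse_system L" for u
    using assms that by (simp add: orthogonal_complement_def)
  show "mulx i w \<in> orthogonal_complement (inverse_system L)"
    by (simp add: orthogonal_complement_def pairing_mulx spderiv_eq_dd w inverse_system_dd)
  show "multheta i w \<in> orthogonal_complement (inverse_system L)"
    by (simp add: orthogonal_complement_def pairing_multheta contract_theta_eq_ii w inverse_system_ii)
  show "parity w \<in> orthogonal_complement (inverse_system L)"
    by (simp add: orthogonal_complement_def pairing_parity w inverse_system_parity)
  show "sscale c w \<in> orthogonal_complement (inverse_system L)"
    by (simp add: orthogonal_complement_def pairing_scale_left w)
qed

text \<open>The inverse system is stable under \<open>dd\<close>, \<open>ii\<close> and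
  \<open>parity\<close>, whose adjoints generate all left and right multiplications.\<close>

lemma orthogonal_complement_mult:
  fixes L :: "(complex ^ 'n::{finite, linorder}) list"
  assumes "w \<in> orthogonal_complement (inverse_system L)"
  shows "r * w \<in> orthogonal_complement (inverse_system L)"
    and "w * r \<in> orthogonal_complement (inverse_system L)"
proof -
  let ?N = "orthogonal_complement (inverse_system L)"
  note steps = orthogonal_complement_steps[where L = L]
  have plus: "f + g \<in> ?N" if "f \<in> ?N" "g \<in> ?N" for f g
    using that by (simp add: orthogonal_complement_def pairing_add_left)
  show "r * w \<in> ?N"
  proof (induction r rule: superspace_induct)
    case (scalar c)
    show ?case using steps(4)[OF assms, of c] by (simp add: sscale_def)
  next
    case (add f g)
    then show ?case using plus by (simp add: distrib_right)
  next
    case (mulx i f)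
    then show ?case using steps(1) by (simp add: mulx_def mult.assoc)
  next
    case (multheta i f)
    then show ?case using steps(2) by (simp add: multheta_def mult.assoc)
  qed
  \<comment> \<open>Generalized over \<open>w\<close>, because a right factor
    \<open>mulx i f\<close> or \<open>multheta i f\<close> is absorbed by changing \<open>w\<close>
    first.\<close>
  have "\<forall>w\<in>?N. w * r \<in> ?N"
  proof (induction r rule: superspace_induct)
    case (scalar c)
    show ?case using steps(4) by (simp add: sscale_def of_mpoly_central)
  next
    case (add f g)
    then show ?case using plus by (simp add: distrib_left)
  next
    case (mulx i f)
    have "w * mulx i f = mulx i w * f" for w
      by (simp only: mulx_def mult.assoc[symmetric] of_mpoly_central[of w])
    then show ?case using mulx steps(1) by simp
  next
    case (multheta i f)
    have "w * multheta i f = multheta i (parity w) * f" for w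
      by (simp add: right_mult_theta[symmetric]) (simp add: multheta_def mult.assoc)
    then show ?case using multheta steps(2,3) by simp
  qed
  with assms show "w * r \<in> ?N" by blast
qed

text \<open>The orthogonal complement is a two-sided ideal, so generators suffice, and by
  adjointness they test the defining conditions of the inverse system.\<close>

lemma I_ideal_orthogonal:
  fixes A :: "(real ^ 'n::{finite, linorder}) set multiset" and L :: "(complex, 'n) vec list"
  assumes rho: "\<And>l. rho A (cline l) = nonzero_count L l"
  shows "I_ideal A \<subseteq> orthogonal_complement (inverse_system L)"
  unfolding I_ideal_def
proof (rule generated_ideal_minimal)
  show "{of_mpoly (power_gen A l) |l. l \<noteq> 0} \<union> {euler (of_mpoly (power_gen A l)) |l. l \<noteq> 0}
      \<subseteq> orthogonal_complement (inverse_system L)"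
  proof -
    have 1: "pairing (of_mpoly (power_gen A l)) u = 0"
      and 2: "pairing (euler (of_mpoly (power_gen A l))) u = 0" if u: "u \<in> inverse_system L" for l u
    proof -
      let ?n = "nonzero_count L l"
      have "of_mpoly (power_gen A l) = (mulX l ^^ Suc ?n) 1"
        using of_mpoly_linform_power[of l "Suc ?n" 1] by (simp add: power_gen_def rho)
      then show "pairing (of_mpoly (power_gen A l)) u = 0"
        using inverse_systemD(1)[OF u order_refl, of l] by (simp only: pairing_mulX_pow pairing_zero_right)
      have "euler (of_mpoly (power_gen A l)) = sscale (of_nat (Suc ?n)) (mulT l ((mulX l ^^ ?n) 1))"
        using euler_linform_power[of l ?n] by (simp only: power_gen_def rho Suc_eq_plus1)
      then show "pairing (euler (of_mpoly (power_gen A l))) u = 0"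
        using inverse_systemD(2)[OF u order_refl, of l]
        by (simp only: pairing_scale_left pairing_mulT pairing_mulX_pow pairing_zero_right mult_zero_right)
    qed
    show ?thesis by (auto simp: orthogonal_complement_def 1 2)
  qed
  show "0 \<in> orthogonal_complement (inverse_system L)" by (simp add: orthogonal_complement_def)
  show "x + y \<in> orthogonal_complement (inverse_system L)"
    if "x \<in> orthogonal_complement (inverse_system L)" "y \<in> orthogonal_complement (inverse_system L)" for x y
    using that by (simp add: orthogonal_complement_def pairing_add_left)
qed (rule orthogonal_complement_mult; assumption)+

lemma ideal_I_ideal: "ideal (I_ideal A) type_ring"
  unfolding I_ideal_def by (rule ideal_generated_ideal)

lemma ideal_J_ideal: "ideal (J_ideal A) type_ring"
  unfolding J_ideal_def by (rule ideal_generated_ideal)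

text \<open>Members of the ideal in other bidegrees are orthogonal to \<open>u\<close> anyway. By
  adjointness the two expressions are thus orthogonal to every homogeneous \<open>w\<close>, and
  nondegeneracy makes them vanish.\<close>

lemma orthogonal_imp_inverse_system:
  fixes A :: "(real ^ 'n::{finite, linorder}) set multiset" and L :: "(complex, 'n) vec list"
  assumes rho: "\<And>l. rho A (cline l) = nonzero_count L l"
    and u: "u \<in> bideg i j"
    and orth: "\<And>w. w \<in> I_ideal A \<Longrightarrow> w \<in> bideg i j \<Longrightarrow> pairing w u = 0"
  shows "u \<in> inverse_system L"
proof (rule inverse_systemI)
  fix l
  let ?n = "nonzero_count L l"
  have perp: "pairing w u = 0" if "w \<in> I_ideal A" "w \<in> bideg i' j'" for w i' j'
  proof (cases "(i', j') = (i, j)")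
    case True
    then show ?thesis using orth[OF that(1)] that(2) by simp
  next
    case False
    show ?thesis by (rule pairing_component_orthogonal[OF that(2) u False])
  qed
  have gen: "of_mpoly (power_gen A l) \<in> I_ideal A" "euler (of_mpoly (power_gen A l)) \<in> I_ideal A"
    if "l \<noteq> 0"
    unfolding I_ideal_def by (rule subsetD[OF generated_ideal_base], use that in blast)+
  note closed = ideal_closed[OF ideal_I_ideal[of A]]
  show "(dd l ^^ Suc ?n) u = 0"
  \<comment> \<open>The ideal has no generator for the zero vector, but \<open>dd 0\<close> and
    \<open>ii 0\<close> are the zero map.\<close>
  proof (cases "l = 0")
    case False
    show ?thesis
    proof (rule pairing_nondegenerate)
      fix i' j' and w :: "'n superspace" assume w: "w \<in> bideg i' j'"
      have "(mulX l ^^ Suc ?n) w = of_mpoly (power_gen A l) * w"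
        using of_mpoly_linform_power[of l "Suc ?n" w] by (simp add: power_gen_def rho)
      then have "(mulX l ^^ Suc ?n) w \<in> I_ideal A"
        using closed(4)[OF gen(1)[OF False]] by (simp only:)
      from perp[OF this mulX_pow_component[OF w]] show "pairing w ((dd l ^^ Suc ?n) u) = 0"
        by (simp only: pairing_mulX_pow)
    qed
  qed simp
  show "(dd l ^^ ?n) (ii l u) = 0"
  proof (cases "l = 0")
    case False
    show ?thesis
    proof (rule pairing_nondegenerate)
      fix i' j' and w :: "'n superspace" assume w: "w \<in> bideg i' j'"
      let ?g = "mulT l ((mulX l ^^ ?n) 1)"
      have g: "euler (of_mpoly (power_gen A l)) = sscale (of_nat (Suc ?n)) ?g"
        using euler_linform_power[of l ?n] by (simp only: power_gen_def rho Suc_eq_plus1)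
      \<comment> \<open>Removes the factor \<open>Suc ?n\<close> that differentiating the power
        introduced.\<close>
      have "?g = sscale (1 / of_nat (Suc ?n)) (sscale (of_nat (Suc ?n)) ?g)"
        by (simp del: of_nat_Suc)
      then have "?g = of_mpoly (mconst (1 / of_nat (Suc ?n))) * euler (of_mpoly (power_gen A l))"
        by (simp only: g sscale_def)
      then have "?g * w \<in> I_ideal A"
        using closed(4)[OF closed(3)[OF gen(2)[OF False]]] by (simp only:)
      moreover have "?g * w = mulT l ((mulX l ^^ ?n) w)"
      proof -
        have T: "mulT l f * w = mulT l (f * w)" for f
          by (simp add: mulT_def op_comb_def sum_distrib_right sscale_def multheta_def mult.assoc)
        have "(mulX l ^^ ?n) 1 * w = of_mpoly (linform l ^ ?n) * w"
          by (simp only: of_mpoly_linform_power[symmetric] mult_1_right)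
        then show ?thesis by (simp only: T of_mpoly_linform_power)
      qed
      ultimately have "mulT l ((mulX l ^^ ?n) w) \<in> I_ideal A" by (simp only:)
      from perp[OF this mulT_component[OF mulX_pow_component[OF w]]]
      show "pairing w ((dd l ^^ ?n) (ii l u)) = 0"
        by (simp only: pairing_mulT pairing_mulX_pow)
    qed
  qed simp
qed

text \<open>\<open>B\<close> is dual to a basis \<open>U\<close> of the inverse system in this
  bidegree. Subtracting from \<open>v\<close> its projection leaves an element \<open>z\<close>
  orthogonal to the inverse system, and a double annihilator argument in the finite-dimensional
  component puts \<open>z\<close> into the ideal.\<close>

lemma biorthogonal_basis:
  fixes A :: "(real ^ 'n::{finite, linorder}) set multiset" and L :: "(complex, 'n) vec list"
  assumes rho: "\<And>l. rho A (cline l) = nonzero_count L l"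
  obtains B u where "finite B" "card B = hdim L i j" "B \<subseteq> bideg i j"
    "\<And>b. b \<in> B \<Longrightarrow> u b \<in> inverse_system L \<inter> bideg i j"
    "\<And>b b'. b \<in> B \<Longrightarrow> b' \<in> B \<Longrightarrow> pairing b' (u b) = (if b' = b then 1 else 0)"
    "\<And>v. v \<in> bideg i j \<Longrightarrow> \<exists>c. v - (\<Sum>b\<in>B. sscale (c b) b) \<in> I_ideal A"
proof -
  let ?V = "bideg i j :: 'n superspace set"
  obtain U where U: "finite U" "ss.independent U" "ss.span U = inverse_system L \<inter> ?V" "card U = hdim L i j"
    using has_dim_inverse_system[of L i j] unfolding has_dim_def by blast
  have UD: "x \<in> inverse_system L \<inter> ?V" if "x \<in> U" for x using ss.span_base[OF that] U(3) by simp
  have "\<exists>b. b \<in> ?V \<and> (\<forall>y\<in>U. pairing b y = (if y = x then 1 else 0))" for x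
  proof -
    \<comment> \<open>The coordinate functional of \<open>x\<close> with respect to
      \<open>U\<close>, extended linearly and then represented by the pairing.\<close>
    from ss_functional.linear_independent_extend[OF U(2), of "\<lambda>y. if y = x then 1 else 0"]
    obtain \<phi> where \<phi>: "Vector_Spaces.linear sscale (*) \<phi>" "\<forall>y\<in>U. \<phi> y = (if y = x then 1 else 0)"
      by (elim exE conjE)
    obtain b where b: "b \<in> ?V" "\<And>v. v \<in> ?V \<Longrightarrow> \<phi> v = pairing b v"
      by (fact functional_representation[OF \<phi>(1), where i = i and j = j])
    have "pairing b y = (if y = x then 1 else 0)" if y: "y \<in> U" for y
    proof -
      have "\<phi> y = pairing b y" using UD[OF y] by (intro b(2)) simp
      with bspec[OF \<phi>(2) y] show ?thesis by simp
    qed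
    with b(1) show ?thesis by (intro exI[of _ b]) simp
  qed
  then have "\<exists>b. \<forall>x. b x \<in> ?V \<and> (\<forall>y\<in>U. pairing (b x) y = (if y = x then 1 else 0))"
    by (intro choice allI)
  then obtain b where b': "\<forall>x. b x \<in> ?V \<and> (\<forall>y\<in>U. pairing (b x) y = (if y = x then 1 else 0))"
    by (elim exE)
  have b: "b x \<in> ?V" "y \<in> U \<Longrightarrow> pairing (b x) y = (if y = x then 1 else 0)" for x y
    using spec[OF b', of x] by simp_all
  have inj: "inj_on b U"
  proof (rule inj_onI)
    fix x y assume "x \<in> U" and y: "y \<in> U" and eq: "b x = b y"
    have "(if y = x then 1 else 0 :: complex) = 1"
      using b(2)[OF y, of x] b(2)[OF y, of y] unfolding eq by (simp only: if_True refl)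
    then show "x = y" by (cases "y = x") simp_all
  qed
  define u where "u = inv_into U b"
  have u: "u (b x) = x" if "x \<in> U" for x using that inj by (simp add: u_def)
  show ?thesis
  proof (rule that[of "b ` U" u])
    show "finite (b ` U)" using U(1) by simp
    show "card (b ` U) = hdim L i j" using card_image[OF inj] U(4) by simp
    show "b ` U \<subseteq> ?V" using b(1) by blast
    show "u c \<in> inverse_system L \<inter> ?V" if c: "c \<in> b ` U" for c
    proof -
      obtain x where "x \<in> U" "c = b x" using c by blast
      with UD u show ?thesis by simp
    qed
    show "pairing c' (u c) = (if c' = c then 1 else 0)" if c: "c \<in> b ` U" "c' \<in> b ` U" for c c'
    proof -
      obtain x x' where x: "x \<in> U" "c = b x" "x' \<in> U" "c' = b x'" using c by blast
      have "b x' = b x \<longleftrightarrow> x = x'" using inj_on_eq_iff[OF inj x(3) x(1)] by blast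
      then show ?thesis unfolding x(2,4) u[OF x(1)] b(2)[OF x(1)] by simp
    qed
    fix v assume v: "v \<in> ?V"
    define z where "z = v - (\<Sum>x\<in>U. sscale (pairing v x) (b x))"
    have z: "z \<in> ?V"
      unfolding z_def using v b(1) by (intro bideg_closed)
    have zU: "pairing z y = 0" if "y \<in> U" for y
    proof -
      have "(\<Sum>x\<in>U. pairing v x * pairing (b x) y) = (\<Sum>x\<in>U. if y = x then pairing v x else 0)"
        by (rule sum.cong) (simp_all add: b(2)[OF that])
      then show ?thesis
        using that U(1)
        by (simp add: z_def pairing_diff_left pairing_sum_left pairing_scale_left)
    qed
    have zspan: "pairing z y = 0" if y: "y \<in> ss.span U" for y
    proof -
      obtain c where "y = (\<Sum>x\<in>U. sscale (c x) x)" using y unfolding ss.span_finite[OF U(1)] by blast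
      then show ?thesis by (simp add: pairing_sum_right pairing_scale_right zU)
    qed
    have zI: "z \<in> I_ideal A"
    proof (rule ccontr)
      \<comment> \<open>Otherwise some functional vanishes on \<open>W\<close> and is 1 at
        \<open>z\<close>. Its representative \<open>y\<close> is orthogonal to the ideal, hence lies
        in the inverse system, to which \<open>z\<close> is orthogonal.\<close>
      assume nz: "z \<notin> I_ideal A"
      define W where "W = I_ideal A \<inter> ?V"
      note closed = ideal_closed[OF ideal_I_ideal[of A]]
      have W: "ss.subspace W"
        unfolding W_def
      proof (rule ss.subspace_inter[OF ss.subspaceI subspace_bideg])
        show "sscale c x \<in> I_ideal A" if "x \<in> I_ideal A" for c x
          unfolding sscale_def by (rule closed(3)[OF that])
      qed (rule closed; assumption)+
      obtain C where C: "C \<subseteq> W" "ss.independent C" "W \<subseteq> ss.span C"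
        by (fact ss.maximal_independent_subset[of W])
      have "ss.span C \<subseteq> W" by (rule ss.span_minimal[OF C(1) W])
      then have zC: "z \<notin> ss.span C" using nz unfolding W_def by blast
      then have "ss.independent (insert z C)" by (rule ss.independent_insertI[OF _ C(2)])
      from ss_functional.linear_independent_extend[OF this, of "\<lambda>y. if y = z then 1 else 0"]
      obtain \<phi> where \<phi>: "Vector_Spaces.linear sscale (*) \<phi>"
        "\<forall>y\<in>insert z C. \<phi> y = (if y = z then 1 else 0)" by (elim exE conjE)
      interpret phi: Vector_Spaces.linear sscale "(*)" \<phi> by fact
      obtain y where y: "y \<in> ?V" "\<And>v. v \<in> ?V \<Longrightarrow> \<phi> v = pairing y v"
        by (fact functional_representation[OF \<phi>(1), where i = i and j = j])
      have "z \<notin> C" using zC ss.span_base[of z C] by blast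
      then have phiC: "\<phi> w = 0" if "w \<in> C" for w using bspec[OF \<phi>(2), of w] that by auto
      have "\<phi> w = 0" if "w \<in> W" for w
        by (rule phi.eq_0_on_span[OF phiC]) (use C(3) that in blast)+
      then have "pairing w y = 0" if "w \<in> I_ideal A" "w \<in> ?V" for w
        using y(2)[of w] that by (simp add: W_def pairing_sym)
      with orthogonal_imp_inverse_system[OF rho y(1)] have "y \<in> ss.span U"
        unfolding U(3) using y(1) by simp
      then have "pairing y z = 0" using zspan[of y] by (simp add: pairing_sym[of y z])
      moreover have "\<phi> z = 1" using \<phi>(2) by simp
      ultimately show False using y(2)[OF z] by simp
    qed
    have "(\<Sum>c\<in>b ` U. sscale (pairing v (u c)) c) = (\<Sum>x\<in>U. sscale (pairing v x) (b x))"
      unfolding sum.reindex[OF inj] by (rule sum.cong) (simp_all add: u)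
    with zI show "\<exists>c. v - (\<Sum>b\<in>b ` U. sscale (c b) b) \<in> I_ideal A"
      unfolding z_def by (intro exI[of _ "\<lambda>c. pairing v (u c)"]) (simp only:)
  qed
qed

text \<open>The constant lies in the inverse system of every list and has nonzero pairing with
  itself.\<close>

lemma one_notin_I_ideal:
  fixes A :: "(real ^ 'n::{finite, linorder}) set multiset" and L :: "(complex, 'n) vec list"
  assumes rho: "\<And>l. rho A (cline l) = nonzero_count L l"
  shows "1 \<notin> I_ideal A"
proof
  assume "1 \<in> I_ideal A"
  then have "1 \<in> orthogonal_complement (inverse_system L)"
    using I_ideal_orthogonal[OF rho] by blast
  moreover have "1 \<in> inverse_system L"
  proof (induction L)
    case Nil
    show ?case by (rule inverse_systemI) (simp_all add: nonzero_count_def)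
  qed (rule inverse_system_Cons_mono)
  ultimately have "pairing (1 :: 'n superspace) 1 = 0" by (simp add: orthogonal_complement_def)
  moreover have "(1 :: 'n superspace) = monomial 0 {}"
    by (rule superspace_coef_eqI) (auto simp: coef_monomial coef_one)
  ultimately show False by (metis coef_monomial exponent_fact_nonzero mult_eq_0_iff pairing_monomial zero_neq_one)
qed

lemma super_scalar_quotient:
  fixes A :: "(real ^ 'n::{finite, linorder}) set multiset" and L :: "(complex, 'n) vec list"
  assumes "\<And>l. rho A (cline l) = nonzero_count L l"
  shows "scalar_quotient (\<lambda>c. of_mpoly (mconst c)) (I_ideal A)"
proof (rule scalar_quotient.intro)
  show "of_mpoly (mconst 1) = (1 :: 'n superspace)"
    by (simp add: mconst_def of_mpoly_one)
  show "of_mpoly (mconst (a + b)) = of_mpoly (mconst a) + (of_mpoly (mconst b) :: 'n superspace)" for a b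
    by (simp add: mconst_def single_add of_mpoly_add)
  show "of_mpoly (mconst (a * b)) = of_mpoly (mconst a) * (of_mpoly (mconst b) :: 'n superspace)" for a b
    by (simp add: mconst_def mult_single flip: of_mpoly_mult)
qed (rule ideal_I_ideal one_notin_I_ideal[OF assms])+

section \<open>Hilbert series of the two quotients\<close>

text \<open>The generators of both ideals depend on an arrangement only through these numbers, so no
  closer link between \<open>A\<close> and a list of normals is required.\<close>

definition counts :: "(real ^ 'n) set multiset \<Rightarrow> (complex ^ 'n) list \<Rightarrow> bool"
  where "counts A L \<longleftrightarrow> (\<forall>l. rho A (cline l) = nonzero_count L l)"

lemma countsD: "counts A L \<Longrightarrow> rho A (cline l) = nonzero_count L l"
  by (simp add: counts_def)

lemma pairing_combination:
  assumes "finite B" "b \<in> B" "\<And>b'. b' \<in> B \<Longrightarrow> pairing b' y = (if b' = b then 1 else 0)"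
  shows "pairing (\<Sum>b'\<in>B. sscale (c b') b') y = c b"
proof -
  have "(\<Sum>b'\<in>B. c b' * pairing b' y) = (\<Sum>b'\<in>B. if b' = b then c b' else 0)"
    by (rule sum.cong) (simp_all add: assms(3))
  then show ?thesis using assms(1,2) by (simp add: pairing_sum_left pairing_scale_left)
qed

lemma super_component_basis:
  fixes A :: "(real ^ 'n::{finite, linorder}) set multiset"
  assumes "counts A L"
  obtains B where
    "scalar_quotient.basis_mod (\<lambda>c. of_mpoly (mconst c)) (I_ideal A) B (bideg i j)"
    "card B = hdim L i j" "B \<subseteq> bideg i j"
proof -
  note rho = countsD[OF assms]
  interpret S: scalar_quotient "\<lambda>c. of_mpoly (mconst c)" "I_ideal A"
    by (rule super_scalar_quotient[OF rho])
  obtain B u where B: "finite B" "card B = hdim L i j" "B \<subseteq> bideg i j"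
    "\<And>b. b \<in> B \<Longrightarrow> u b \<in> inverse_system L \<inter> bideg i j"
    "\<And>b b'. b \<in> B \<Longrightarrow> b' \<in> B \<Longrightarrow> pairing b' (u b) = (if b' = b then 1 else 0)"
    "\<And>v. v \<in> bideg i j \<Longrightarrow> \<exists>c. v - (\<Sum>b\<in>B. sscale (c b) b) \<in> I_ideal A"
    by (fact biorthogonal_basis[OF rho, where i = i and j = j])
  have "S.basis_mod B (bideg i j)"
    unfolding S.basis_mod_def sscale_def[symmetric]
  proof (intro conjI allI impI ballI)
    show "finite B" by (rule B(1))
    show "c b = 0" if c: "(\<Sum>b\<in>B. sscale (c b) b) \<in> I_ideal A" and b: "b \<in> B" for c b
    proof -
      have "pairing (\<Sum>b\<in>B. sscale (c b) b) (u b) = 0"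
        using subsetD[OF I_ideal_orthogonal[OF rho] c] B(4)[OF b]
        by (simp add: orthogonal_complement_def)
      then show ?thesis using pairing_combination[OF B(1) b B(5)[OF b], of c] by simp
    qed
    show "(\<Sum>b\<in>B. sscale (c b) b) \<in> bideg i j" for c
      using B(3) by (intro bideg_closed) blast
  qed (rule B(6))
  with that B(2,3) show ?thesis by blast
qed

text \<open>Union of the component bases. It stays independent because the dual elements of one
  bidegree are orthogonal to all other bidegrees.\<close>

lemma super_total_basis:
  fixes A :: "(real ^ 'n::{finite, linorder}) set multiset"
  assumes "counts A L"
  obtains B where
    "scalar_quotient.basis_mod (\<lambda>c. of_mpoly (mconst c)) (I_ideal A) B UNIV"
    "card B = (\<Sum>i\<le>length L. \<Sum>j\<le>length L. hdim L i j)"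
proof -
  note rho = countsD[OF assms]
  interpret S: scalar_quotient "\<lambda>c. of_mpoly (mconst c)" "I_ideal A"
    by (rule super_scalar_quotient[OF rho])
  note closed = ideal_closed[OF ideal_I_ideal[of A]]
  \<comment> \<open>Packs the whole output of \<open>biorthogonal_basis\<close>, so that one
    application of choice yields bases and dual families for all bidegrees at once.\<close>
  define good where "good p B u \<longleftrightarrow> finite B \<and> card B = hdim L (fst p) (snd p) \<and>
    B \<subseteq> bideg (fst p) (snd p) \<and>
    (\<forall>b\<in>B. u b \<in> inverse_system L \<inter> bideg (fst p) (snd p) \<and>
      (\<forall>b'\<in>B. pairing b' (u b) = (if b' = b then 1 else 0))) \<and>
    (\<forall>v\<in>bideg (fst p) (snd p). \<exists>c. v - (\<Sum>b\<in>B. sscale (c b) b) \<in> I_ideal A)"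
    for p B u
  have "\<forall>p. \<exists>Bu. good p (fst Bu) (snd Bu)"
  proof
    fix p :: "nat \<times> nat"
    obtain B u where B: "finite B" "card B = hdim L (fst p) (snd p)"
      "B \<subseteq> bideg (fst p) (snd p)"
      "\<And>b. b \<in> B \<Longrightarrow> u b \<in> inverse_system L \<inter> bideg (fst p) (snd p)"
      "\<And>b b'. b \<in> B \<Longrightarrow> b' \<in> B \<Longrightarrow> pairing b' (u b) = (if b' = b then 1 else 0)"
      "\<And>v. v \<in> bideg (fst p) (snd p) \<Longrightarrow>
        \<exists>c. v - (\<Sum>b\<in>B. sscale (c b) b) \<in> I_ideal A"
      by (fact biorthogonal_basis[OF rho, where i = "fst p" and j = "snd p"])
    have "good p (fst (B, u)) (snd (B, u))"
      unfolding good_def fst_conv snd_conv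
      by (intro conjI ballI B(1) B(2) B(3) B(4) B(5) B(6))
    then show "\<exists>Bu. good p (fst Bu) (snd Bu)" by (rule exI)
  qed
  from choice[OF this] obtain Bu where Bu: "\<forall>p. good p (fst (Bu p)) (snd (Bu p))" by (elim exE)
  define B where "B p = fst (Bu p)" for p
  define u where "u p = snd (Bu p)" for p
  have good: "good p (B p) (u p)" for p using Bu unfolding B_def u_def by (rule spec)
  note gd = good[unfolded good_def]
  have fin: "finite (B p)" for p by (rule conjunct1[OF gd])
  have card: "card (B p) = hdim L (fst p) (snd p)" for p by (rule conjunct1[OF conjunct2[OF gd]])
  have sub: "B p \<subseteq> bideg (fst p) (snd p)" for p
    by (rule conjunct1[OF conjunct2[OF conjunct2[OF gd]]])
  note gd4 = conjunct2[OF conjunct2[OF conjunct2[OF gd]]]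
  have uD: "u p b \<in> inverse_system L \<inter> bideg (fst p) (snd p)" if "b \<in> B p" for p b
    by (rule conjunct1[OF bspec[OF conjunct1[OF gd4] that]])
  have dual: "pairing b' (u p b) = (if b' = b then 1 else 0)" if "b \<in> B p" "b' \<in> B p" for p b b'
    by (rule bspec[OF conjunct2[OF bspec[OF conjunct1[OF gd4] that(1)]] that(2)])
  have span: "\<exists>c. v - (\<Sum>b\<in>B p. sscale (c b) b) \<in> I_ideal A"
    if "v \<in> bideg (fst p) (snd p)" for p v
    by (rule bspec[OF conjunct2[OF gd4] that])
  have cross: "pairing b' (u p b) = 0" if "b \<in> B p" "b' \<in> B q" "p \<noteq> q" for p q b b'
    by (rule pairing_component_orthogonal[OF subsetD[OF sub that(2)] IntD2[OF uD[OF that(1)]]])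
      (use that(3) in \<open>auto simp: prod_eq_iff\<close>)
  have disj: "B p \<inter> B q = {}" if "p \<noteq> q" for p q
  proof (rule ccontr)
    assume "B p \<inter> B q \<noteq> {}"
    then obtain b where b: "b \<in> B p" "b \<in> B q" by blast
    from cross[OF b that] dual[OF b(1) b(1)] show False by simp
  qed
  let ?P = "{..length L} \<times> {..length L}"
  let ?B = "\<Union>p\<in>?P. B p"
  have empty: "B p = {}" if "p \<notin> ?P" for p
  proof -
    have "hdim L (fst p) (snd p) = 0"
      using that hdim_support[of L "fst p" "snd p"] by (cases p) force
    with fin[of p] card[of p] show ?thesis by simp
  qed
  have finB: "finite ?B" by (intro finite_UN_I finite_cartesian_product finite_atMost fin)
  have comb: "(\<Sum>b\<in>?B. sscale (if b \<in> B p then c b else 0) b) = (\<Sum>b\<in>B p. sscale (c b) b)" for p c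
  proof (cases "p \<in> ?P")
    case True
    then have "B p \<subseteq> ?B" by blast
    then show ?thesis
      by (intro sum.mono_neutral_cong_right[OF finB]) auto
  next
    case False
    then show ?thesis by (simp add: empty)
  qed
  define Z where "Z = {v. \<exists>c. v - (\<Sum>b\<in>?B. sscale (c b) b) \<in> I_ideal A}"
  have Z_add: "v + w \<in> Z" if vw: "v \<in> Z" "w \<in> Z" for v w
  proof -
    from vw(1) obtain c where c: "v - (\<Sum>b\<in>?B. sscale (c b) b) \<in> I_ideal A"
      unfolding Z_def mem_Collect_eq by (elim exE)
    from vw(2) obtain d where d: "w - (\<Sum>b\<in>?B. sscale (d b) b) \<in> I_ideal A"
      unfolding Z_def mem_Collect_eq by (elim exE)
    from closed(2)[OF c d] have "v + w - (\<Sum>b\<in>?B. sscale (c b + d b) b) \<in> I_ideal A"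
      by (simp add: ss.scale_left_distrib sum.distrib algebra_simps)
    then show ?thesis unfolding Z_def mem_Collect_eq by (rule exI[of _ "\<lambda>b. c b + d b"])
  qed
  have Z_comp: "v \<in> Z" if v: "v \<in> bideg i j" for v i j
  proof -
    obtain c where "v - (\<Sum>b\<in>B (i, j). sscale (c b) b) \<in> I_ideal A"
      using span[of v "(i, j)"] v by auto
    then have "v - (\<Sum>b\<in>?B. sscale (if b \<in> B (i, j) then c b else 0) b) \<in> I_ideal A"
      by (simp only: comb)
    then show ?thesis
      unfolding Z_def mem_Collect_eq by (rule exI[of _ "\<lambda>b. if b \<in> B (i, j) then c b else 0"])
  qed
  have Z_sum: "(\<Sum>p\<in>Q. G p) \<in> Z" if "\<And>p. G p \<in> Z" for Q :: "('n set \<times> ('n \<Rightarrow>\<^sub>0 nat)) set" and G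
    by (induction Q rule: infinite_finite_induct)
      (simp_all add: that Z_add Z_comp[of 0 0 0] bideg_closed)
  have Z: "v \<in> Z" for v
  proof -
    let ?Q = "Sigma UNIV (\<lambda>S. Poly_Mapping.keys (theta_coeff v S))"
    have eq: "v = (\<Sum>(S, m)\<in>?Q. sscale (coef v S m) (monomial m S))"
      by (rule monomial_expansion) (auto simp: in_keys_iff)
    have "(case p of (S, m) \<Rightarrow> sscale (coef v S m) (monomial m S)) \<in> Z" for p
      by (cases p) (auto intro: Z_comp bideg_closed(5) monomial_component)
    then have "(\<Sum>(S, m)\<in>?Q. sscale (coef v S m) (monomial m S)) \<in> Z" by (rule Z_sum)
    then show ?thesis unfolding eq[symmetric] .
  qed
  have "S.basis_mod ?B UNIV"
    unfolding S.basis_mod_def sscale_def[symmetric]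
  proof (intro conjI allI impI ballI)
    show "finite ?B" by (rule finB)
    show "c b = 0" if c: "(\<Sum>b\<in>?B. sscale (c b) b) \<in> I_ideal A" and b: "b \<in> ?B" for c b
    proof -
      obtain p where p: "p \<in> ?P" "b \<in> B p" using b by blast
      have "pairing (\<Sum>b\<in>?B. sscale (c b) b) (u p b) = 0"
        using subsetD[OF I_ideal_orthogonal[OF rho] c] uD[OF p(2)]
        by (simp add: orthogonal_complement_def)
      moreover have "pairing b' (u p b) = (if b' = b then 1 else 0)" if b': "b' \<in> ?B" for b'
      proof -
        obtain q where q: "b' \<in> B q" using b' by blast
        show ?thesis
        proof (cases "p = q")
          case True
          with q dual[OF p(2), of b'] show ?thesis by simp
        next
          case False
          with disj p(2) q have "b' \<noteq> b" by blast
          with cross[OF p(2) q False] show ?thesis by simp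
        qed
      qed
      ultimately show ?thesis using pairing_combination[OF finB b, of "u p b" c] by simp
    qed
    show "\<exists>c. v - (\<Sum>b\<in>?B. sscale (c b) b) \<in> I_ideal A" for v
      using Z[of v] unfolding Z_def mem_Collect_eq .
  qed simp
  moreover have "card ?B = (\<Sum>p\<in>?P. card (B p))"
    by (rule card_UN_disjoint) (simp_all add: fin disj)
  then have "card ?B = (\<Sum>i\<le>length L. \<Sum>j\<le>length L. hdim L i j)"
    by (simp add: card sum.cartesian_product case_prod_beta)
  ultimately show ?thesis using that by blast
qed

section \<open>Fermionic degree zero and the polynomial quotient\<close>

lemma theta_coeff_mult_empty:
  "theta_coeff (f * g) {} = theta_coeff f {} * theta_coeff g {}"
  by (simp add: times_superspace.rep_eq theta_sign_def inversions_def)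

lemma theta_coeff_sum: "theta_coeff (sum F B) S = (\<Sum>b\<in>B. theta_coeff (F b) S)"
  by (induction B rule: infinite_finite_induct)
    (simp_all add: zero_superspace.rep_eq plus_superspace.rep_eq)

text \<open>Taking the theta-free part is multiplicative, sends the even generators to those of
  \<open>J_ideal\<close>, and kills everything of the form \<open>euler f\<close>.\<close>

lemma theta_coeff_I_ideal:
  assumes "w \<in> I_ideal A"
  shows "theta_coeff w {} \<in> J_ideal A"
proof -
  note closed = ideal_closed[OF ideal_J_ideal[of A]]
  have "I_ideal A \<subseteq> {w. theta_coeff w {} \<in> J_ideal A}"
    unfolding I_ideal_def
  proof (rule generated_ideal_minimal)
    have "power_gen A l \<in> J_ideal A" if "l \<noteq> 0" for l
      unfolding J_ideal_def by (rule subsetD[OF generated_ideal_base]) (use that in blast)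
    moreover have "theta_coeff (euler f) {} = 0" for f :: "'a superspace"
      by (simp add: euler_def theta_coeff_sum theta_coeff_mult_empty theta_coeff_theta)
    ultimately show "{of_mpoly (power_gen A l) |l. l \<noteq> 0} \<union> {euler (of_mpoly (power_gen A l)) |l. l \<noteq> 0}
        \<subseteq> {w. theta_coeff w {} \<in> J_ideal A}"
      using closed(1) by (auto simp: theta_coeff_of_mpoly)
  qed (use closed in \<open>auto simp: theta_coeff_mult_empty zero_superspace.rep_eq plus_superspace.rep_eq\<close>)
  with assms show ?thesis by blast
qed

lemma of_mpoly_J_ideal:
  assumes "p \<in> J_ideal A"
  shows "of_mpoly p \<in> I_ideal A"
proof -
  note closed = ideal_closed[OF ideal_I_ideal[of A]]
  have "J_ideal A \<subseteq> {p. of_mpoly p \<in> I_ideal A}"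
    unfolding J_ideal_def
  proof (rule generated_ideal_minimal)
    have "of_mpoly (power_gen A l) \<in> I_ideal A" if "l \<noteq> 0" for l
      unfolding I_ideal_def by (rule subsetD[OF generated_ideal_base]) (use that in blast)
    then show "{power_gen A l |l. l \<noteq> 0} \<subseteq> {p. of_mpoly p \<in> I_ideal A}" by blast
  qed (use closed in \<open>auto simp: of_mpoly_mult of_mpoly_add of_mpoly_zero\<close>)
  with assms show ?thesis by blast
qed

lemma mpoly_scalar_quotient:
  fixes A :: "(real ^ 'n::{finite, linorder}) set multiset"
  assumes "counts A L"
  shows "scalar_quotient mconst (J_ideal A)"
proof (rule scalar_quotient.intro)
  show "1 \<notin> J_ideal A"
    using of_mpoly_J_ideal[of 1 A] one_notin_I_ideal[OF countsD[OF assms]] by (simp add: of_mpoly_one) blast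
qed (simp_all add: ideal_J_ideal mconst_def single_add mult_single)

lemma of_mpoly_component_iff:
  "of_mpoly p \<in> bideg k 0 \<longleftrightarrow> p \<in> mpoly_component k"
  by (auto simp: superspace_component_def mpoly_component_def theta_coeff_of_mpoly split: if_splits)

lemma of_mpoly_theta_coeff:
  assumes "f \<in> bideg k 0"
  shows "of_mpoly (theta_coeff f {}) = f"
proof (rule superspace_coef_eqI)
  fix S m
  have "coef f S m = 0" if "S \<noteq> {}"
    using assms that unfolding bideg_iff by (metis card_0_eq finite)
  then show "coef (of_mpoly (theta_coeff f {})) S m = coef f S m"
    by (simp add: theta_coeff_of_mpoly)
qed

text \<open>The basis for bidegree \<open>(k, 0)\<close> is transported by the theta-free part,
  whose inverse there is \<open>of_mpoly\<close>; the two ideals correspond under these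
  maps.\<close>

lemma mpoly_component_basis:
  fixes A :: "(real ^ 'n::{finite, linorder}) set multiset"
  assumes "counts A L"
  obtains B where "scalar_quotient.basis_mod mconst (J_ideal A) B (mpoly_component k)"
    "card B = hdim L k 0"
proof -
  interpret J: scalar_quotient mconst "J_ideal A" by (rule mpoly_scalar_quotient[OF assms])
  interpret S: scalar_quotient "\<lambda>c. of_mpoly (mconst c)" "I_ideal A"
    by (rule super_scalar_quotient[OF countsD[OF assms]])
  obtain B where B: "S.basis_mod B (bideg k 0)" "card B = hdim L k 0"
    "B \<subseteq> bideg k 0"
    by (fact super_component_basis[OF assms, where i = k and j = 0])
  let ?h = "\<lambda>f. theta_coeff f {}"
  have inj: "inj_on ?h B"
    by (rule inj_on_inverseI[of _ of_mpoly]) (use B(3) of_mpoly_theta_coeff in blast)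
  have sum: "of_mpoly (\<Sum>p\<in>?h ` B. mconst (c p) * p) = (\<Sum>b\<in>B. of_mpoly (mconst (c (?h b))) * b)" for c
    unfolding sum.reindex[OF inj] of_mpoly_sum comp_def of_mpoly_mult
    by (rule sum.cong) (simp_all add: of_mpoly_theta_coeff[OF subsetD[OF B(3)]])
  have sum': "?h (\<Sum>b\<in>B. of_mpoly (mconst (c b)) * b) = (\<Sum>b\<in>B. mconst (c b) * ?h b)" for c
    by (simp add: theta_coeff_sum theta_coeff_of_mpoly_mult)
  note bm = B(1)[unfolded S.basis_mod_def]
  note indep = conjunct1[OF conjunct2[OF bm]]
    and comb = conjunct1[OF conjunct2[OF conjunct2[OF bm]]]
    and span = conjunct2[OF conjunct2[OF conjunct2[OF bm]]]
  have "J.basis_mod (?h ` B) (mpoly_component k)"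
    unfolding J.basis_mod_def
  proof (intro conjI allI impI ballI)
    show "finite (?h ` B)" by (rule finite_imageI[OF conjunct1[OF bm]])
    show "c p = 0" if c: "(\<Sum>p\<in>?h ` B. mconst (c p) * p) \<in> J_ideal A" and p: "p \<in> ?h ` B" for c p
    proof -
      obtain b where b: "b \<in> B" "p = ?h b" using p by blast
      have "(\<Sum>b\<in>B. of_mpoly (mconst (c (?h b))) * b) \<in> I_ideal A"
        using of_mpoly_J_ideal[OF c] unfolding sum .
      from bspec[OF mp[OF spec[OF indep, of "\<lambda>b. c (?h b)"] this] b(1)]
      show ?thesis unfolding b(2) .
    qed
    show "(\<Sum>p\<in>?h ` B. mconst (c p) * p) \<in> mpoly_component k" for c
      unfolding of_mpoly_component_iff[symmetric] sum
      by (rule spec[OF comb])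
    show "\<exists>c. p - (\<Sum>b\<in>?h ` B. mconst (c b) * b) \<in> J_ideal A" if p: "p \<in> mpoly_component k" for p
    proof -
      from p have "of_mpoly p \<in> bideg k 0" by (simp add: of_mpoly_component_iff)
      from bspec[OF span this]
      obtain c where "of_mpoly p - (\<Sum>b\<in>B. of_mpoly (mconst (c b)) * b) \<in> I_ideal A"
        by (elim exE)
      from theta_coeff_I_ideal[OF this]
      have "p - (\<Sum>b\<in>B. mconst (c b) * ?h b) \<in> J_ideal A"
        by (simp only: minus_superspace.rep_eq sum' theta_coeff_of_mpoly if_True refl)
      also have "(\<Sum>b\<in>B. mconst (c b) * ?h b) = (\<Sum>q\<in>?h ` B. mconst (c (inv_into B ?h q)) * q)"
        unfolding sum.reindex[OF inj] by (rule sum.cong) (simp_all add: inv_into_f_f[OF inj])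
      finally show ?thesis by (rule exI[of _ "\<lambda>q. c (inv_into B ?h q)"])
    qed
  qed
  with that show ?thesis using B(2) card_image[OF inj] by simp
qed

lemma fps_nth_super_quotient_hilb:
  assumes "counts A L"
  shows "fps_nth (fps_nth (super_quotient_hilb A) j) i = int (hdim L i j)"
proof -
  interpret S: scalar_quotient "\<lambda>c. of_mpoly (mconst c)" "I_ideal A"
    by (rule super_scalar_quotient[OF countsD[OF assms]])
  obtain B where B: "S.basis_mod B (bideg i j)" "card B = hdim L i j"
    "B \<subseteq> bideg i j"
    by (fact super_component_basis[OF assms, where i = i and j = j])
  show ?thesis
    using S.dim_basis_mod[OF B(1)] B(2)
    by (simp add: super_quotient_hilb_def hilb2_def super_quotient_def super_quotient_scalars_def)
qed

lemma fps_nth_mpoly_quotient_hilb: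
  fixes A :: "(real ^ 'n::{finite, linorder}) set multiset"
  assumes "counts A L"
  shows "fps_nth (mpoly_quotient_hilb A) k = int (hdim L k 0)"
proof -
  interpret S: scalar_quotient mconst "J_ideal A" by (rule mpoly_scalar_quotient[OF assms])
  obtain B where B: "S.basis_mod B (mpoly_component k)" "card B = hdim L k 0"
    by (fact mpoly_component_basis[OF assms, where k = k])
  show ?thesis
    using S.dim_basis_mod[OF B(1)] B(2)
    by (simp add: mpoly_quotient_hilb_def hilb_def mpoly_quotient_def mpoly_quotient_scalars_def)
qed

lemma dimension_super_quotient:
  assumes "counts A L"
  shows "ring.dimension (super_quotient A) (total_hdim (doubled L)) (super_quotient_scalars A)
    (carrier (super_quotient A))"
proof -
  interpret S: scalar_quotient "\<lambda>c. of_mpoly (mconst c)" "I_ideal A"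
    by (rule super_scalar_quotient[OF countsD[OF assms]])
  obtain B where B: "S.basis_mod B UNIV" "card B = (\<Sum>i\<le>length L. \<Sum>j\<le>length L. hdim L i j)"
    by (fact super_total_basis[OF assms])
  show ?thesis
    using S.dimension_basis_mod[OF B(1)] B(2) hdim_total_sum[OF order_refl, of L]
    by (simp add: super_quotient_def super_quotient_scalars_def S.carrier_quotient)
qed

section \<open>Coefficients of the specialized series\<close>

lemma fps_nth_compose_X_square:
  fixes F :: "int fps"
  shows "fps_nth (F oo fps_X ^ 2) n = (if even n then fps_nth F (n div 2) else 0)"
proof -
  have "fps_nth (F oo fps_X ^ 2) n = (\<Sum>i\<in>{0..n}. if n = 2 * i then fps_nth F i else 0)"
    unfolding fps_compose_nth power_mult[symmetric] fps_X_power_nth by (rule sum.cong) simp_all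
  also have "\<dots> = (if even n then fps_nth F (n div 2) else 0)"
  proof (cases "even n")
    case True
    then have "n = 2 * i \<longleftrightarrow> i = n div 2" for i by auto
    with True show ?thesis by (simp add: sum.delta)
  next
    case False
    then have "n \<noteq> 2 * i" for i by auto
    with False show ?thesis by simp
  qed
  finally show ?thesis .
qed

lemma specialize_super_quotient_hilb:
  assumes "counts A L"
  shows "fps_nth (fps_specialize (super_quotient_hilb A) (fps_X ^ 2) fps_X) k = int (weighted_hdim L k)"
proof -
  let ?F = "super_quotient_hilb A"
  have hz: "hdim L i j = 0" if "length L < j" for i j
    using that hdim_support[of L i j] by (cases "hdim L i j = 0") simp_all
  have zero: "fps_nth ?F j = 0" if "j \<notin> {..length L}" for j
    by (rule fps_ext) (use that hz in \<open>simp add: fps_nth_super_quotient_hilb[OF assms]\<close>)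
  have "fps_specialize ?F (fps_X ^ 2) fps_X =
      (\<Sum>j\<in>{..length L}. (fps_nth ?F j oo fps_X ^ 2) * fps_X ^ j)"
    unfolding fps_specialize_def by (rule suminf_finite) (simp_all add: zero)
  note eq = this
  have "fps_nth (fps_specialize ?F (fps_X ^ 2) fps_X) k =
      (\<Sum>j\<le>length L. if k < j then 0 else
        if even (k - j) then int (hdim L ((k - j) div 2) j) else 0)"
    unfolding eq fps_sum_nth fps_X_power_mult_right_nth fps_nth_compose_X_square
      fps_nth_super_quotient_hilb[OF assms] by (rule refl)
  \<comment> \<open>A common range for the bounds \<open>length L\<close> and \<open>k\<close>; the
    added terms vanish by \<open>hdim_support\<close>.\<close>
  also have "\<dots> = (\<Sum>j\<le>length L + k. if k < j then 0 else
        if even (k - j) then int (hdim L ((k - j) div 2) j) else 0)"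
    by (rule sum.mono_neutral_left) (simp_all add: hz)
  also have "\<dots> = (\<Sum>j\<le>k. if even (k - j) then int (hdim L ((k - j) div 2) j) else 0)"
    by (intro sum.mono_neutral_cong_right) auto
  also have "\<dots> = int (weighted_hdim L k)"
    unfolding weighted_hdim_def of_nat_sum by (rule sum.cong) auto
  finally show ?thesis .
qed

text \<open>Both sides are the dimension of the same component of the polynomial quotient, whatever
  normals and pivots the recursion used.\<close>

lemma hdim_cong_counts:
  fixes A :: "(real ^ 'n::{finite, linorder}) set multiset"
  assumes "counts A L" "counts A L'"
  shows "hdim L k 0 = hdim L' k 0"
  using fps_nth_mpoly_quotient_hilb[OF assms(1), of k] fps_nth_mpoly_quotient_hilb[OF assms(2), of k]
  by simp

section \<open>Independent subfamilies and regions\<close>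

lemma independent_family_iff:
  fixes a :: "'i \<Rightarrow> 'v::real_vector"
  assumes "finite S"
  shows "inj_on a S \<and> independent (a ` S) \<longleftrightarrow>
    (\<forall>c. (\<Sum>s\<in>S. c s *\<^sub>R a s) = 0 \<longrightarrow> (\<forall>s\<in>S. c s = 0))"
proof
  assume a: "inj_on a S \<and> independent (a ` S)"
  show "\<forall>c. (\<Sum>s\<in>S. c s *\<^sub>R a s) = 0 \<longrightarrow> (\<forall>s\<in>S. c s = 0)"
  proof (intro allI impI ballI)
    fix c s assume c: "(\<Sum>s\<in>S. c s *\<^sub>R a s) = 0" and s: "s \<in> S"
    have "(\<Sum>v\<in>a ` S. c (inv_into S a v) *\<^sub>R v) = (\<Sum>s\<in>S. c s *\<^sub>R a s)"
      unfolding sum.reindex[OF conjunct1[OF a]] using a by (intro sum.cong) simp_all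
    then have "c (inv_into S a (a s)) = 0"
      using independentD[OF conjunct2[OF a] finite_imageI[OF assms] subset_refl, of "\<lambda>v. c (inv_into S a v)" "a s"]
        c s by simp
    then show "c s = 0" using a s by simp
  qed
next
  assume c: "\<forall>c. (\<Sum>s\<in>S. c s *\<^sub>R a s) = 0 \<longrightarrow> (\<forall>s\<in>S. c s = 0)"
  have inj: "inj_on a S"
  proof (rule inj_onI, rule ccontr)
    fix s t assume st: "s \<in> S" "t \<in> S" "a s = a t" "s \<noteq> t"
    let ?c = "\<lambda>r. (if r = s then 1 else 0) - (if r = t then 1 else 0 :: real)"
    have "(\<Sum>r\<in>S. ?c r *\<^sub>R a r) = (\<Sum>r\<in>S. (if r = s then a r else 0) - (if r = t then a r else 0))"
      by (rule sum.cong) (simp_all add: scaleR_left_diff_distrib)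
    also have "\<dots> = 0" using st assms by (simp add: sum_subtractf)
    finally have "(\<Sum>r\<in>S. ?c r *\<^sub>R a r) = 0" .
    from bspec[OF mp[OF spec[OF c, of ?c] this] st(1)] st(4) show False by simp
  qed
  moreover have "independent (a ` S)"
  proof (rule independent_if_scalars_zero)
    fix f v assume "(\<Sum>v\<in>a ` S. f v *\<^sub>R v) = 0" "v \<in> a ` S"
    then have "(\<Sum>s\<in>S. f (a s) *\<^sub>R a s) = 0" by (simp add: sum.reindex[OF inj])
    from mp[OF spec[OF c, of "\<lambda>s. f (a s)"] this] \<open>v \<in> a ` S\<close> show "f v = 0" by blast
  qed (use assms in simp)
  ultimately show "inj_on a S \<and> independent (a ` S)" by blast
qed

definition independent_family :: "('i \<Rightarrow> real ^ 'n) \<Rightarrow> 'i set \<Rightarrow> bool"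
  where "independent_family a S \<longleftrightarrow> (\<forall>c. (\<Sum>s\<in>S. c s *\<^sub>R a s) = 0 \<longrightarrow> (\<forall>s\<in>S. c s = 0))"

lemma contract_sum:
  fixes a :: "real ^ 'n"
  shows "contract a (\<Sum>s\<in>S. c s *\<^sub>R f s) = (\<Sum>s\<in>S. c s *\<^sub>R contract a (f s))"
  by (simp add: contract_def vec_eq_iff sum_divide_distrib sum_distrib_right sum_subtractf
      right_diff_distrib mult.assoc)

lemma contract_eq_0_imp:
  fixes a :: "real ^ 'n"
  assumes "contract a b = 0"
  obtains t where "b = t *\<^sub>R a"
  using assms that[of "b $ pivot a / a $ pivot a"]
  by (simp add: contract_def scalar_mult_eq_scaleR)

text \<open>A combination contracts to 0 exactly when it is a multiple of \<open>a i\<close>, so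
  relations among the contracted vectors are relations modulo \<open>a i\<close>.\<close>

lemma independent_family_insert:
  fixes a :: "'i \<Rightarrow> real ^ 'n"
  assumes "finite S" "i \<notin> S"
  shows "independent_family a (insert i S) \<longleftrightarrow>
    a i \<noteq> 0 \<and> independent_family (\<lambda>s. contract (a i) (a s)) S"
proof
  assume ind: "independent_family a (insert i S)"
  have upd: "(\<Sum>s\<in>insert i S. (c(i := t)) s *\<^sub>R a s) = t *\<^sub>R a i + (\<Sum>s\<in>S. c s *\<^sub>R a s)" for c t
  proof -
    have "(\<Sum>s\<in>S. (c(i := t)) s *\<^sub>R a s) = (\<Sum>s\<in>S. c s *\<^sub>R a s)"
      using assms(2) by (intro sum.cong) auto
    then show ?thesis using assms by simp
  qed
  have zero: "c s = 0" if "t *\<^sub>R a i + (\<Sum>s\<in>S. c s *\<^sub>R a s) = 0" "s \<in> S" for c t s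
  proof -
    have "(\<Sum>s\<in>insert i S. (c(i := t)) s *\<^sub>R a s) = 0" unfolding upd by (rule that(1))
    from bspec[OF mp[OF spec[OF ind[unfolded independent_family_def], of "c(i := t)"] this], of s] that(2)
    have "(c(i := t)) s = 0" by blast
    with assms(2) that(2) show ?thesis by (auto split: if_splits)
  qed
  show "a i \<noteq> 0 \<and> independent_family (\<lambda>s. contract (a i) (a s)) S"
  proof
    show "a i \<noteq> 0"
    proof
      assume "a i = 0"
      then have "(\<Sum>s\<in>insert i S. ((\<lambda>_. 0)(i := 1)) s *\<^sub>R a s) = 0" unfolding upd by simp
      from bspec[OF mp[OF spec[OF ind[unfolded independent_family_def], of "(\<lambda>_. 0)(i := 1)"] this], of i]
      show False by simp
    qed
    show "independent_family (\<lambda>s. contract (a i) (a s)) S"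
      unfolding independent_family_def
    proof (intro allI impI ballI)
      fix c s assume c: "(\<Sum>s\<in>S. c s *\<^sub>R contract (a i) (a s)) = 0" and s: "s \<in> S"
      then have "contract (a i) (\<Sum>s\<in>S. c s *\<^sub>R a s) = 0" by (simp only: contract_sum)
      then obtain t where "(\<Sum>s\<in>S. c s *\<^sub>R a s) = t *\<^sub>R a i" by (rule contract_eq_0_imp)
      then have "(- t) *\<^sub>R a i + (\<Sum>s\<in>S. c s *\<^sub>R a s) = 0" by simp
      from zero[OF this s] show "c s = 0" .
    qed
  qed
next
  assume ind: "a i \<noteq> 0 \<and> independent_family (\<lambda>s. contract (a i) (a s)) S"
  show "independent_family a (insert i S)"
    unfolding independent_family_def
  proof (intro allI impI)
    fix c assume c: "(\<Sum>s\<in>insert i S. c s *\<^sub>R a s) = 0"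
    have "contract (a i) (\<Sum>s\<in>insert i S. c s *\<^sub>R a s) = 0" unfolding c by (simp add: contract_def)
    then have "(\<Sum>s\<in>S. c s *\<^sub>R contract (a i) (a s)) = 0"
      unfolding contract_sum using assms ind by (simp add: contract_self)
    from mp[OF spec[OF conjunct2[OF ind, unfolded independent_family_def], of c] this]
    have S: "\<forall>s\<in>S. c s = 0" .
    then have "c i *\<^sub>R a i = 0" using c assms by simp
    with ind S show "\<forall>s\<in>insert i S. c s = 0" by simp
  qed
qed

lemma card_subsets_insert:
  assumes "finite I" "i \<notin> I"
  shows "card {T. T \<subseteq> insert i I \<and> P T} = card {T. T \<subseteq> I \<and> P T} + card {T. T \<subseteq> I \<and> P (insert i T)}"
proof -
  let ?A = "{T. T \<subseteq> I \<and> P T}" and ?B = "{T. T \<subseteq> I \<and> P (insert i T)}"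
  have "{T. T \<subseteq> insert i I \<and> P T} = ?A \<union> insert i ` ?B"
  proof (intro equalityI subsetI)
    fix T assume T: "T \<in> {T. T \<subseteq> insert i I \<and> P T}"
    show "T \<in> ?A \<union> insert i ` ?B"
    proof (cases "i \<in> T")
      case True
      then have "T = insert i (T - {i})" by blast
      moreover have "T - {i} \<in> ?B" using T True by (auto simp: insert_absorb)
      ultimately show ?thesis by blast
    next
      case False
      with T show ?thesis by blast
    qed
  qed auto
  moreover have "?A \<inter> insert i ` ?B = {}" using assms(2) by blast
  moreover have "inj_on (insert i) ?B"
    using assms(2) by (intro inj_onI) (metis (no_types, lifting) insert_ident mem_Collect_eq subsetD)
  moreover have "finite ?A" "finite ?B" using assms(1) by simp_all
  ultimately show ?thesis by (simp add: card_Un_disjoint card_image)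
qed

text \<open>The same recursion as \<open>total_hdim_Cons\<close>; the family \<open>a\<close> is
  kept general because each step also passes to the contracted family.\<close>

lemma card_independent_subfamilies:
  fixes a :: "'i \<Rightarrow> real ^ 'n"
  shows "distinct is \<Longrightarrow> card {T. T \<subseteq> set is \<and> independent_family a T} = total_hdim (map a is)"
proof (induction "is" arbitrary: a)
  case Nil
  have "{T. T \<subseteq> set [] \<and> independent_family a T} = {{}}"
    by (auto simp: independent_family_def)
  then show ?case by (simp add: total_hdim_Nil)
next
  case (Cons i "is")
  have i: "finite (set is)" "i \<notin> set is" using Cons.prems by simp_all
  have "independent_family a (insert i T) \<longleftrightarrow>
      a i \<noteq> 0 \<and> independent_family (\<lambda>s. contract (a i) (a s)) T" if "T \<subseteq> set is" for T
    using independent_family_insert[of T i a] that i finite_subset by blast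
  then have "{T. T \<subseteq> set is \<and> independent_family a (insert i T)} =
      (if a i = 0 then {} else {T. T \<subseteq> set is \<and> independent_family (\<lambda>s. contract (a i) (a s)) T})"
    by auto
  then show ?case
    using card_subsets_insert[OF i, of "independent_family a"] Cons.IH[of a]
      Cons.IH[of "\<lambda>s. contract (a i) (a s)"] Cons.prems
    by (simp add: total_hdim_Cons comp_def)
qed

section \<open>Sign vectors, cells and regions\<close>

definition sign_vector :: "('i \<Rightarrow> real ^ 'n) \<Rightarrow> ('i \<Rightarrow> real) \<Rightarrow> 'i set \<Rightarrow> real ^ 'n \<Rightarrow> 'i \<Rightarrow> real"
  where "sign_vector a b I x = (\<lambda>i. if i \<in> I then sgn (a i \<bullet> x - b i) else 0)"

text \<open>The cells of the arrangement induced on \<open>W\<close>, recorded by sign vectors.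
  Since these are 0 outside \<open>I\<close>, they can be compared when \<open>I\<close>
  grows.\<close>

definition cells :: "('i \<Rightarrow> real ^ 'n) \<Rightarrow> ('i \<Rightarrow> real) \<Rightarrow> 'i set \<Rightarrow> (real ^ 'n) set \<Rightarrow> ('i \<Rightarrow> real) set"
  where "cells a b I W = sign_vector a b I ` {x \<in> W. \<forall>i\<in>I. a i \<bullet> x \<noteq> b i}"

lemma finite_cells:
  assumes "finite I"
  shows "finite (cells a b I W)"
proof (rule finite_subset)
  show "cells a b I W \<subseteq> {f. \<forall>i. (i \<in> I \<longrightarrow> f i \<in> {-1, 0, 1}) \<and> (i \<notin> I \<longrightarrow> f i = 0)}"
  proof
    have sgn: "sgn r \<in> {-1, 0, 1}" for r :: real by (simp add: sgn_if)
    fix f assume "f \<in> cells a b I W"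
    then obtain x where "f = sign_vector a b I x" unfolding cells_def by blast
    then show "f \<in> {f. \<forall>i. (i \<in> I \<longrightarrow> f i \<in> {-1, 0, 1}) \<and> (i \<notin> I \<longrightarrow> f i = 0)}"
      using sgn by (simp add: sign_vector_def)
  qed
  show "finite {f. \<forall>i. (i \<in> I \<longrightarrow> f i \<in> {-1, 0, 1 :: real}) \<and> (i \<notin> I \<longrightarrow> f i = 0)}"
    by (rule finite_set_of_finite_funs[OF assms]) simp
qed

lemma sign_vector_perturb:
  assumes "finite I" "\<forall>i\<in>I. a i \<bullet> x \<noteq> b i"
  obtains e where "e > 0" "\<And>t i. \<bar>t\<bar> < e \<Longrightarrow> i \<in> I \<Longrightarrow>
    sgn (a i \<bullet> (x + t *\<^sub>R v) - b i) = sgn (a i \<bullet> x - b i)"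
proof -
  have "\<forall>i\<in>I. \<forall>\<^sub>F t in nhds 0. sgn (a i \<bullet> (x + t *\<^sub>R v) - b i) = sgn (a i \<bullet> x - b i)"
  proof
    fix i assume "i \<in> I"
    with assms(2) have nz: "a i \<bullet> x - b i \<noteq> 0" by auto
    have "((\<lambda>t. a i \<bullet> (x + t *\<^sub>R v) - b i) \<longlongrightarrow> a i \<bullet> (x + 0 *\<^sub>R v) - b i) (nhds 0)"
      by (intro tendsto_intros filterlim_ident)
    then have lim: "((\<lambda>t. a i \<bullet> (x + t *\<^sub>R v) - b i) \<longlongrightarrow> a i \<bullet> x - b i) (nhds 0)"
      by (simp only: scaleR_zero_left add_0_right)
    show "\<forall>\<^sub>F t in nhds 0. sgn (a i \<bullet> (x + t *\<^sub>R v) - b i) = sgn (a i \<bullet> x - b i)"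
    proof (cases "a i \<bullet> x - b i > 0")
      case True
      from order_tendstoD(1)[OF lim this] show ?thesis
        by (rule eventually_mono) (use True in simp)
    next
      case False
      with nz have neg: "a i \<bullet> x - b i < 0" by simp
      from order_tendstoD(2)[OF lim this] show ?thesis
        by (rule eventually_mono) (use neg in simp)
    qed
  qed
  then have "\<forall>\<^sub>F t in nhds 0. \<forall>i\<in>I. sgn (a i \<bullet> (x + t *\<^sub>R v) - b i) = sgn (a i \<bullet> x - b i)"
    using assms(1) by (simp add: eventually_ball_finite_distrib)
  then obtain e where "e > 0" "\<And>t. dist t 0 < e \<Longrightarrow>
      \<forall>i\<in>I. sgn (a i \<bullet> (x + t *\<^sub>R v) - b i) = sgn (a i \<bullet> x - b i)"
    unfolding eventually_nhds_metric by blast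
  then show ?thesis using that[of e] by (simp add: dist_real_def)
qed

lemma sgn_convex:
  fixes p q u :: real
  assumes "sgn p = s" "sgn q = s" "s \<noteq> 0" "0 \<le> u" "u \<le> 1"
  shows "sgn ((1 - u) * p + u * q) = s"
proof -
  consider "p > 0" "q > 0" "s = 1" | "p < 0" "q < 0" "s = -1"
    using assms(1-3) by (auto simp: sgn_if split: if_splits)
  then show ?thesis
  proof cases
    case 1
    have "(1 - u) * p + u * q > 0"
    proof (cases "u = 0")
      case False
      then have "u * q > 0" using assms 1 by simp
      moreover have "(1 - u) * p \<ge> 0" using assms 1 by simp
      ultimately show ?thesis by linarith
    qed (use 1 in simp)
    with 1 show ?thesis by simp
  next
    case 2
    have "(1 - u) * p + u * q < 0"
    proof (cases "u = 0")
      case False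
      then have "u * q < 0" using assms 2 by (simp add: mult_pos_neg)
      moreover have "(1 - u) * p \<le> 0" using assms 2 by (simp add: mult_nonneg_nonpos)
      ultimately show ?thesis by linarith
    qed (use 2 in simp)
    with 2 show ?thesis by simp
  qed
qed

lemma inner_segment:
  fixes x y v :: "real ^ 'n"
  shows "v \<bullet> ((1 - u) *\<^sub>R x + u *\<^sub>R y) - c = (1 - u) * (v \<bullet> x - c) + u * (v \<bullet> y - c)"
  by (simp add: inner_add_right algebra_simps)

text \<open>Each sign condition is a half-space, so cells are convex.\<close>

lemma sign_vector_segment:
  assumes "\<forall>i\<in>I. a i \<bullet> x \<noteq> b i" "sign_vector a b I x = sign_vector a b I y" "0 \<le> u" "u \<le> 1"
  shows "(\<forall>i\<in>I. a i \<bullet> ((1 - u) *\<^sub>R x + u *\<^sub>R y) \<noteq> b i) \<and>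
    sign_vector a b I ((1 - u) *\<^sub>R x + u *\<^sub>R y) = sign_vector a b I x"
proof -
  have *: "sgn (a i \<bullet> ((1 - u) *\<^sub>R x + u *\<^sub>R y) - b i) = sgn (a i \<bullet> x - b i)" if i: "i \<in> I" for i
    unfolding inner_segment
  proof (rule sgn_convex)
    show "sgn (a i \<bullet> y - b i) = sgn (a i \<bullet> x - b i)"
      using fun_cong[OF assms(2), of i] i by (simp add: sign_vector_def)
    show "sgn (a i \<bullet> x - b i) \<noteq> 0" using assms(1) i by (simp add: sgn_zero_iff)
  qed (use assms in simp_all)
  have "a i \<bullet> ((1 - u) *\<^sub>R x + u *\<^sub>R y) \<noteq> b i" if "i \<in> I" for i
    using *[OF that] assms(1) that by (metis right_minus_eq sgn_zero_iff)
  with * show ?thesis by (auto simp: sign_vector_def fun_eq_iff)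
qed

text \<open>\<open>P\<close> and \<open>N\<close> are the old cells met by the two open sides of the
  new hyperplane, and |P| + |N| is the size of their union plus that of their intersection. The
  union consists of all old cells, the intersection of those meeting the hyperplane. The condition
  \<open>cut\<close> prevents \<open>W\<close> from lying inside it.\<close>

lemma card_cells_insert:
  assumes I: "finite I" "i \<notin> I" and W: "affine W"
    and cut: "W \<inter> {x. a i \<bullet> x = b i} = {} \<or> (\<exists>x\<in>W. \<exists>y\<in>W. a i \<bullet> x \<noteq> a i \<bullet> y)"
  shows "card (cells a b (insert i I) W) = card (cells a b I W) + card (cells a b I (W \<inter> {x. a i \<bullet> x = b i}))"
proof -
  let ?s = "sign_vector a b I"
  let ?ok = "\<lambda>x. \<forall>k\<in>I. a k \<bullet> x \<noteq> b k"
  define P where "P = ?s ` {x \<in> W. ?ok x \<and> a i \<bullet> x > b i}"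
  define N where "N = ?s ` {x \<in> W. ?ok x \<and> a i \<bullet> x < b i}"
  have sv: "sign_vector a b (insert i I) x = (?s x)(i := sgn (a i \<bullet> x - b i))" for x
    using I(2) by (auto simp: sign_vector_def fun_eq_iff)
  have split: "cells a b (insert i I) W = (\<lambda>f. f(i := 1)) ` P \<union> (\<lambda>f. f(i := - 1)) ` N"
  proof (intro equalityI subsetI)
    fix f assume "f \<in> cells a b (insert i I) W"
    then obtain x where x: "x \<in> W" "?ok x" "a i \<bullet> x \<noteq> b i" "f = sign_vector a b (insert i I) x"
      unfolding cells_def by auto
    show "f \<in> (\<lambda>f. f(i := 1)) ` P \<union> (\<lambda>f. f(i := - 1)) ` N"
    proof (cases "a i \<bullet> x > b i")
      case True
      with x have "?s x \<in> P" unfolding P_def by blast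
      then show ?thesis using x(4) True unfolding sv by simp
    next
      case False
      with x have "?s x \<in> N" unfolding N_def by auto
      then show ?thesis using x(3,4) False unfolding sv by simp
    qed
  next
    fix f assume "f \<in> (\<lambda>f. f(i := 1)) ` P \<union> (\<lambda>f. f(i := - 1)) ` N"
    then obtain x where x: "x \<in> W" "?ok x" "a i \<bullet> x \<noteq> b i" "f = (?s x)(i := sgn (a i \<bullet> x - b i))"
      unfolding P_def N_def by fastforce
    then show "f \<in> cells a b (insert i I) W"
      unfolding cells_def sv[symmetric] by blast
  qed
  have fin: "finite P" "finite N"
    by (rule finite_subset[OF _ finite_cells[OF I(1), of a b W]]; auto simp: P_def N_def cells_def)+
  have inj: "inj_on (\<lambda>f. f(i := c)) Q" if "Q \<subseteq> range ?s" for c :: real and Q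
  proof (rule inj_onI)
    fix f g assume "f \<in> Q" "g \<in> Q" and eq: "f(i := c) = g(i := c)"
    with that have "f i = 0" "g i = 0" using I(2) by (auto simp: sign_vector_def)
    with eq show "f = g" by (metis fun_upd_triv fun_upd_upd)
  qed
  have "(\<lambda>f. f(i := 1)) ` P \<inter> (\<lambda>f. f(i := - 1)) ` N = {}"
  proof (rule ccontr)
    assume "(\<lambda>f. f(i := 1)) ` P \<inter> (\<lambda>f. f(i := - 1)) ` N \<noteq> {}"
    then obtain f g :: "'a \<Rightarrow> real" where "f(i := 1) = g(i := - 1)" by blast
    from fun_cong[OF this, of i] show False by simp
  qed
  then have "card (cells a b (insert i I) W) = card ((\<lambda>f. f(i := 1)) ` P) + card ((\<lambda>f. f(i := - 1)) ` N)"
    unfolding split by (rule card_Un_disjoint[OF finite_imageI[OF fin(1)] finite_imageI[OF fin(2)]])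
  also have "card ((\<lambda>f. f(i := 1)) ` P) = card P"
    by (rule card_image[OF inj]) (auto simp: P_def)
  also have "card ((\<lambda>f. f(i := - 1)) ` N) = card N"
    by (rule card_image[OF inj]) (auto simp: N_def)
  also have "card P + card N = card (P \<union> N) + card (P \<inter> N)"
    by (rule card_Un_Int[OF fin])
  finally have eqs: "card (cells a b (insert i I) W) = card (P \<union> N) + card (P \<inter> N)" .
  \<comment> \<open>A point on the hyperplane is pushed slightly to either side along a line in
    \<open>W\<close>, without changing the other signs.\<close>
  have PN: "?s x \<in> P \<and> ?s x \<in> N" if x: "x \<in> W" "?ok x" "a i \<bullet> x = b i" for x
  proof -
    have "\<exists>p\<in>W. \<exists>q\<in>W. a i \<bullet> p \<noteq> a i \<bullet> q" using cut x(1,3) by blast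
    then obtain y where y: "y \<in> W" "a i \<bullet> y \<noteq> b i" by metis
    obtain e where e: "e > 0" "\<And>t k. \<bar>t\<bar> < e \<Longrightarrow> k \<in> I \<Longrightarrow>
        sgn (a k \<bullet> (x + t *\<^sub>R (y - x)) - b k) = sgn (a k \<bullet> x - b k)"
      by (fact sign_vector_perturb[OF I(1) x(2), where v = "y - x"])
    let ?z = "\<lambda>t. x + t *\<^sub>R (y - x)"
    have z: "?z t \<in> W" "?ok (?z t)" "?s (?z t) = ?s x" if "\<bar>t\<bar> < e" for t
    proof -
      have "(1 - t) *\<^sub>R x + t *\<^sub>R y \<in> W" by (rule mem_affine[OF W x(1) y(1)]) simp
      then show "?z t \<in> W" by (simp add: algebra_simps)
      show "?s (?z t) = ?s x" using e(2)[OF that] by (simp add: sign_vector_def fun_eq_iff)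
      show "?ok (?z t)"
      proof
        fix k assume k: "k \<in> I"
        with e(2)[OF that k] x(2) show "a k \<bullet> ?z t \<noteq> b k" by (metis right_minus_eq sgn_zero_iff)
      qed
    qed
    have val: "a i \<bullet> ?z t = b i + t * (a i \<bullet> y - b i)" for t
      using x(3) by (simp add: inner_add_right inner_diff_right)
    have half: "\<bar>e / 2\<bar> < e" "\<bar>- (e / 2)\<bar> < e" using e(1) by simp_all
    have memP: "?s x \<in> P" if "\<bar>t\<bar> < e" "t * (a i \<bullet> y - b i) > 0" for t
    proof -
      have "?z t \<in> {x \<in> W. ?ok x \<and> a i \<bullet> x > b i}" using z(1,2)[OF that(1)] val[of t] that(2) by simp
      then have "?s (?z t) \<in> P" unfolding P_def by (rule imageI)
      then show ?thesis by (simp only: z(3)[OF that(1)])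
    qed
    have memN: "?s x \<in> N" if "\<bar>t\<bar> < e" "t * (a i \<bullet> y - b i) < 0" for t
    proof -
      have "?z t \<in> {x \<in> W. ?ok x \<and> a i \<bullet> x < b i}" using z(1,2)[OF that(1)] val[of t] that(2) by simp
      then have "?s (?z t) \<in> N" unfolding N_def by (rule imageI)
      then show ?thesis by (simp only: z(3)[OF that(1)])
    qed
    show ?thesis
    proof (cases "a i \<bullet> y - b i > 0")
      case True
      with e(1) have "e / 2 * (a i \<bullet> y - b i) > 0" "- (e / 2) * (a i \<bullet> y - b i) < 0" by simp_all
      with memP[OF half(1)] memN[OF half(2)] show ?thesis by blast
    next
      case False
      with y(2) have "a i \<bullet> y - b i < 0" by simp
      with e(1) have "- (e / 2) * (a i \<bullet> y - b i) > 0" "e / 2 * (a i \<bullet> y - b i) < 0"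
        by (simp_all add: mult_pos_neg mult_neg_neg)
      with memP[OF half(2)] memN[OF half(1)] show ?thesis by blast
    qed
  qed
  have "P \<union> N = cells a b I W"
  proof (intro equalityI subsetI)
    fix f assume "f \<in> cells a b I W"
    then obtain x where x: "x \<in> W" "?ok x" "f = ?s x" unfolding cells_def by blast
    consider "a i \<bullet> x > b i" | "a i \<bullet> x < b i" | "a i \<bullet> x = b i" by linarith
    then show "f \<in> P \<union> N"
    proof cases
      case 1
      with x have "f \<in> P" unfolding P_def by blast
      then show ?thesis by simp
    next
      case 2
      with x have "f \<in> N" unfolding N_def by blast
      then show ?thesis by simp
    next
      case 3
      from PN[OF x(1,2) this] x(3) show ?thesis by simp
    qed
  qed (auto simp: P_def N_def cells_def)
  moreover have "P \<inter> N = cells a b I (W \<inter> {x. a i \<bullet> x = b i})"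
  proof (intro equalityI subsetI)
    fix f assume "f \<in> P \<inter> N"
    then obtain x y where x: "x \<in> W" "?ok x" "a i \<bullet> x > b i" "f = ?s x"
      and y: "y \<in> W" "a i \<bullet> y < b i" "f = ?s y"
      unfolding P_def N_def by blast
    define p where "p = a i \<bullet> x - b i"
    define q where "q = a i \<bullet> y - b i"
    have pq: "p > 0" "q < 0" using x(3) y(2) by (simp_all add: p_def q_def)
    \<comment> \<open>The parameter at which the segment from \<open>x\<close> to \<open>y\<close>
      crosses the new hyperplane.\<close>
    define u where "u = p / (p - q)"
    have u: "0 \<le> u" "u \<le> 1" using pq by (simp_all add: u_def divide_le_eq)
    let ?z = "(1 - u) *\<^sub>R x + u *\<^sub>R y"
    have "(1 - u) * p + u * q = 0" using pq by (simp add: u_def field_simps)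
    then have "a i \<bullet> ?z = b i" using inner_segment[of "a i" u x y "b i"] by (simp add: p_def q_def)
    moreover have "?z \<in> W" by (rule mem_affine[OF W x(1) y(1)]) simp
    moreover have "?ok ?z \<and> ?s ?z = ?s x"
      using sign_vector_segment[OF x(2) _ u] x(4) y(3) by metis
    ultimately show "f \<in> cells a b I (W \<inter> {x. a i \<bullet> x = b i})"
      unfolding cells_def x(4) by (intro image_eqI[of _ _ ?z]) simp_all
  next
    fix f assume "f \<in> cells a b I (W \<inter> {x. a i \<bullet> x = b i})"
    then obtain x where "x \<in> W" "?ok x" "a i \<bullet> x = b i" "f = ?s x" unfolding cells_def by blast
    with PN[of x] show "f \<in> P \<inter> N" by simp
  qed
  ultimately show ?thesis by (simp only: eqs)
qed

definition flat :: "('i \<Rightarrow> real ^ 'n) \<Rightarrow> ('i \<Rightarrow> real) \<Rightarrow> 'i set \<Rightarrow> (real ^ 'n) set"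
  where "flat a b T = (\<Inter>i\<in>T. {x. a i \<bullet> x = b i})"

lemma affine_flat: "affine (flat a b T)"
  unfolding flat_def by (rule affine_Inter) (auto simp: affine_hyperplane)

text \<open>Independence makes the span grow strictly with \<open>a i\<close>; \<open>v\<close> is
  taken in the larger span, orthogonal to the smaller. Moving along it stays in the flat of
  \<open>T\<close> and leaves the hyperplane \<open>i\<close>.\<close>

lemma independent_direction:
  fixes a :: "'i \<Rightarrow> real ^ 'n"
  assumes "i \<notin> T" "inj_on a (insert i T)" "independent (a ` insert i T)"
  obtains v where "\<And>k. k \<in> T \<Longrightarrow> a k \<bullet> v = 0" "a i \<bullet> v \<noteq> 0"
proof -
  have "a i \<notin> a ` T" using assms(1,2) by (auto dest: inj_onD)
  then have "a i \<notin> span (a ` T)"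
    using assms(3) by (simp add: independent_insert)
  then have "span (a ` T) \<subset> span (a ` insert i T)"
    by (metis image_insert insertI1 psubsetI span_base span_mono subset_insertI)
  from orthogonal_to_subspace_exists_gen[OF this] obtain v where
    v: "v \<noteq> 0" "v \<in> span (a ` insert i T)" "\<And>y. y \<in> span (a ` T) \<Longrightarrow> orthogonal v y" by metis
  have zero: "a k \<bullet> v = 0" if "k \<in> T" for k
    using v(3)[of "a k"] span_base[of "a k" "a ` T"] that by (simp add: orthogonal_def inner_commute)
  moreover have "a i \<bullet> v \<noteq> 0"
  proof
    assume "a i \<bullet> v = 0"
    then have "orthogonal v x" if "x \<in> a ` insert i T" for x
      using that zero by (auto simp: orthogonal_def inner_commute)
    then have "orthogonal v v" by (rule orthogonal_to_span[OF v(2)])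
    with v(1) show False by (simp add: orthogonal_def)
  qed
  ultimately show ?thesis using that by blast
qed

text \<open>Deletion and restriction, where \<open>T\<close> collects the hyperplanes to which the
  count has been restricted. Genericity supplies the transversality demanded by
  \<open>card_cells_insert\<close>.\<close>

lemma card_cells_generic:
  fixes a :: "'i \<Rightarrow> real ^ 'n"
  assumes "finite I" "T \<inter> I = {}" "T \<union> I \<subseteq> M"
    and generic: "\<And>S. S \<subseteq> M \<Longrightarrow> flat a b S \<noteq> {} \<Longrightarrow> inj_on a S \<and> independent (a ` S)"
  shows "card (cells a b I (flat a b T)) = card {S. S \<subseteq> I \<and> flat a b (T \<union> S) \<noteq> {}}"
  using assms(1-3)
proof (induction I arbitrary: T)
  case empty
  show ?case
  proof (cases "flat a b T = {}")
    case True
    then show ?thesis by (simp add: cells_def)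
  next
    case False
    then have "cells a b {} (flat a b T) = {\<lambda>_. 0}" by (auto simp: cells_def sign_vector_def)
    moreover have "{S. S \<subseteq> {} \<and> flat a b (T \<union> S) \<noteq> {}} = {{}}" using False by auto
    ultimately show ?thesis by simp
  qed
next
  case (insert i I)
  have ins: "flat a b T \<inter> {x. a i \<bullet> x = b i} = flat a b (insert i T)" by (auto simp: flat_def)
  have "flat a b (insert i T) = {} \<or> (\<exists>x\<in>flat a b T. \<exists>y\<in>flat a b T. a i \<bullet> x \<noteq> a i \<bullet> y)"
  proof (cases "flat a b (insert i T) = {}")
    case False
    then obtain x where x: "x \<in> flat a b (insert i T)" by blast
    from generic[OF _ False] insert.prems have "inj_on a (insert i T)" "independent (a ` insert i T)"
      by auto
    moreover have "i \<notin> T" using insert.prems by blast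
    ultimately obtain v where v: "\<And>k. k \<in> T \<Longrightarrow> a k \<bullet> v = 0" "a i \<bullet> v \<noteq> 0"
      using independent_direction[of i T a] by metis
    have "x \<in> flat a b T" "x + v \<in> flat a b T" "a i \<bullet> x \<noteq> a i \<bullet> (x + v)"
      using x v by (auto simp: flat_def inner_add_right)
    then show ?thesis by blast
  qed simp
  then have cut: "flat a b T \<inter> {x. a i \<bullet> x = b i} = {} \<or>
      (\<exists>x\<in>flat a b T. \<exists>y\<in>flat a b T. a i \<bullet> x \<noteq> a i \<bullet> y)"
    by (simp only: ins)
  have "card (cells a b (insert i I) (flat a b T)) =
      card (cells a b I (flat a b T)) + card (cells a b I (flat a b (insert i T)))"
    unfolding ins[symmetric] by (rule card_cells_insert[where a = a and b = b, OF insert.hyps(1,2) affine_flat cut])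
  also have "card (cells a b I (flat a b T)) = card {S. S \<subseteq> I \<and> flat a b (T \<union> S) \<noteq> {}}"
    by (rule insert.IH) (use insert.prems in auto)
  also have "card (cells a b I (flat a b (insert i T))) = card {S. S \<subseteq> I \<and> flat a b (insert i T \<union> S) \<noteq> {}}"
    by (rule insert.IH) (use insert.prems insert.hyps in auto)
  also have "card {S. S \<subseteq> I \<and> flat a b (T \<union> S) \<noteq> {}} + card {S. S \<subseteq> I \<and> flat a b (insert i T \<union> S) \<noteq> {}} =
      card {S. S \<subseteq> insert i I \<and> flat a b (T \<union> S) \<noteq> {}}"
    using card_subsets_insert[OF insert.hyps, of "\<lambda>S. flat a b (T \<union> S) \<noteq> {}"] by simp
  finally show ?case .
qed

text \<open>Regions are the fibres of the sign vector: the intermediate value theorem keeps signs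
  constant on connected sets, and segments join points with equal signs.\<close>

lemma regions_cells:
  "finite (regions m a b)" "card (regions m a b) = card (cells a b {..<m} UNIV)"
proof -
  let ?s = "sign_vector a b {..<m}" and ?U = "{x. \<forall>i\<in>{..<m}. a i \<bullet> x \<noteq> b i}"
  have U: "- (\<Union>i<m. {x. a i \<bullet> x = b i}) = ?U" by auto
  have comp: "connected_component_set ?U x = {y \<in> ?U. ?s y = ?s x}" if x: "x \<in> ?U" for x
  proof (intro equalityI subsetI)
    fix y assume y: "y \<in> connected_component_set ?U x"
    then obtain C where C: "connected C" "C \<subseteq> ?U" "x \<in> C" "y \<in> C"
      by (auto simp: connected_component_def)
    have "?s y i = ?s x i" for i
    proof (rule ccontr)
      assume neq: "?s y i \<noteq> ?s x i"
      then have i: "i < m" by (auto simp: sign_vector_def split: if_splits)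
      with neq have sgn: "sgn (a i \<bullet> y - b i) \<noteq> sgn (a i \<bullet> x - b i)" by (simp add: sign_vector_def)
      have nz: "a i \<bullet> x \<noteq> b i" using C(2,3) i by auto
      have "\<exists>z\<in>C. a i \<bullet> z = b i"
      proof (cases "a i \<bullet> x \<le> b i")
        case True
        with sgn nz have "b i \<le> a i \<bullet> y" by (auto simp: sgn_if split: if_splits)
        with True show ?thesis using connected_ivt_hyperplane[OF C(1,3,4), of "a i" "b i"] by blast
      next
        case False
        with sgn nz have "a i \<bullet> y \<le> b i" by (auto simp: sgn_if split: if_splits)
        with False show ?thesis using connected_ivt_hyperplane[OF C(1,4,3), of "a i" "b i"] by auto
      qed
      with C(2) i show False by auto
    qed
    then show "y \<in> {y \<in> ?U. ?s y = ?s x}" using C(2,4) by blast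
  next
    fix y assume "y \<in> {y \<in> ?U. ?s y = ?s x}"
    then have y: "\<forall>i\<in>{..<m}. a i \<bullet> y \<noteq> b i" "?s y = ?s x" by simp_all
    have "closed_segment x y \<subseteq> ?U"
    proof
      fix z assume "z \<in> closed_segment x y"
      then obtain u where "0 \<le> u" "u \<le> 1" "z = (1 - u) *\<^sub>R x + u *\<^sub>R y"
        unfolding closed_segment_def by blast
      with sign_vector_segment[of "{..<m}" a x b y u] x y(2) show "z \<in> ?U" by simp
    qed
    then have "connected_component ?U x y"
      unfolding connected_component_def
      by (intro exI[of _ "closed_segment x y"]) simp
    then show "y \<in> connected_component_set ?U x" by simp
  qed
  let ?fib = "\<lambda>f. {y \<in> ?U. ?s y = f}"
  have "regions m a b = (\<lambda>x. connected_component_set ?U x) ` ?U"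
    unfolding regions_def U components_def by blast
  also have "\<dots> = (\<lambda>x. ?fib (?s x)) ` ?U" by (rule image_cong) (simp_all only: comp refl)
  also have "\<dots> = ?fib ` cells a b {..<m} UNIV" by (simp add: cells_def image_image)
  finally have reg: "regions m a b = ?fib ` cells a b {..<m} UNIV" .
  have "inj_on ?fib (cells a b {..<m} UNIV)"
  proof (rule inj_onI)
    fix f g assume f: "f \<in> cells a b {..<m} UNIV" and "?fib f = ?fib g"
    obtain x where "x \<in> ?U" "f = ?s x" using f unfolding cells_def by auto
    then have "x \<in> ?fib f" by simp
    then have "x \<in> ?fib g" using \<open>?fib f = ?fib g\<close> by (simp only:)
    with \<open>f = ?s x\<close> show "f = g" by simp
  qed
  then show "card (regions m a b) = card (cells a b {..<m} UNIV)" unfolding reg by (rule card_image)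
  show "finite (regions m a b)" unfolding reg by (intro finite_imageI finite_cells) simp
qed

theorem card_regions_generic:
  assumes "generic_arrangement C m a b"
  shows "card (regions m a b) = total_hdim (map a [0..<m])"
proof -
  have gen: "flat a b S \<noteq> {} \<longleftrightarrow> inj_on a S \<and> independent (a ` S)" if "S \<subseteq> {..<m}" for S
    using assms that unfolding generic_arrangement_def flat_def by blast
  have "card (regions m a b) = card (cells a b {..<m} (flat a b {}))"
    by (simp add: regions_cells(2) flat_def)
  also have "\<dots> = card {S. S \<subseteq> {..<m} \<and> flat a b ({} \<union> S) \<noteq> {}}"
    by (rule card_cells_generic[where M = "{..<m}"]) (use gen in auto)
  also have "{S. S \<subseteq> {..<m} \<and> flat a b ({} \<union> S) \<noteq> {}} = {S. S \<subseteq> {..<m} \<and> independent_family a S}"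
  proof -
    have "flat a b S \<noteq> {} \<longleftrightarrow> independent_family a S" if S: "S \<subseteq> {..<m}" for S
      unfolding gen[OF S] independent_family_def
      by (rule independent_family_iff[OF finite_subset[OF S]]) simp
    then show ?thesis by auto
  qed
  also have "{..<m} = set [0..<m]" by auto
  also have "card {S. S \<subseteq> set [0..<m] \<and> independent_family a S} = total_hdim (map a [0..<m])"
    by (rule card_independent_subfamilies) simp
  finally show ?thesis .
qed

section \<open>Real hyperplanes\<close>

definition complexify :: "real ^ 'n \<Rightarrow> complex ^ 'n"
  where "complexify a = (\<chi> i. complex_of_real (a $ i))"

lemma complexify_simps:
  "complexify a $ i = complex_of_real (a $ i)" "complexify a = 0 \<longleftrightarrow> a = 0"
  "contract (complexify a) (complexify b) = complexify (contract a b)"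
  by (simp_all add: complexify_def vec_eq_iff contract_def pivot_def)

text \<open>Contraction commutes with the embedding of the reals, including the choice of pivot,
  because an entry and its complex image vanish together.\<close>

lemma hdim_complexify: "hdim (map complexify R) i j = hdim R i j"
proof (induction "length R" arbitrary: R i j)
  case (Suc n)
  then obtain a R0 where R: "R = a # R0" "length R0 = n" by (metis length_Suc_conv)
  have m: "map (contract (complexify a)) (map complexify R0) = map complexify (map (contract a) R0)"
    by (simp add: complexify_simps)
  have IH: "hdim (map complexify R0) i j = hdim R0 i j"
    "hdim (map complexify (map (contract a) R0)) i j = hdim (map (contract a) R0) i j" for i j
    using Suc(1)[of R0] Suc(1)[of "map (contract a) R0"] R(2) by simp_all
  show ?case
    unfolding R(1) list.map hdim.simps m IH complexify_simps(2) by (rule refl)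
qed simp

text \<open>A real form applied to a complex vector has as real and imaginary parts its values at
  the real and imaginary parts of the vector.\<close>

lemma cline_subset_complexification:
  "cline l \<subseteq> complexification {x. a \<bullet> x = 0} \<longleftrightarrow> dotp (complexify a) l = 0"
proof -
  have "c *s l \<in> complexification {x. a \<bullet> x = 0} \<longleftrightarrow> c * dotp (complexify a) l = 0" for c
  proof -
    have "c * dotp (complexify a) l = (\<Sum>i\<in>UNIV. complex_of_real (a $ i) * (c * l $ i))"
      by (simp add: dotp_def complexify_simps(1) sum_distrib_left mult_ac)
    then have "a \<bullet> (\<chi> i. Re ((c *s l) $ i)) = Re (c * dotp (complexify a) l)"
      "a \<bullet> (\<chi> i. Im ((c *s l) $ i)) = Im (c * dotp (complexify a) l)"
      by (simp_all add: inner_vec_def)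
    then show ?thesis by (simp add: complexification_def complex_eq_iff)
  qed
  then have "cline l \<subseteq> complexification {x. a \<bullet> x = 0} \<longleftrightarrow> (\<forall>c. c * dotp (complexify a) l = 0)"
    by (auto simp: cline_def)
  also have "\<dots> \<longleftrightarrow> dotp (complexify a) l = 0" by (metis mult_1 mult_zero_right)
  finally show ?thesis .
qed

lemma counts_complexify: "counts (image_mset (\<lambda>a. {x. a \<bullet> x = 0}) (mset R)) (map complexify R)"
  unfolding counts_def
proof
  fix l
  show "rho (image_mset (\<lambda>a. {x. a \<bullet> x = 0}) (mset R)) (cline l) = nonzero_count (map complexify R) l"
    by (induction R) (simp_all add: rho_def nonzero_count_def cline_subset_complexification)
qed

lemma normals_exist:
  assumes "\<And>H. H \<in># A \<Longrightarrow> linear_hyperplane H"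
  shows "\<exists>R. A = image_mset (\<lambda>a. {x. a \<bullet> x = 0}) (mset R)"
  using assms
proof (induction A)
  case empty
  show ?case by (rule exI[of _ "[]"]) simp
next
  case (add H A)
  then obtain R where "A = image_mset (\<lambda>a. {x. a \<bullet> x = 0}) (mset R)" by auto
  moreover from add.prems[of H] obtain a where "H = {x. a \<bullet> x = 0}"
    unfolding linear_hyperplane_def by auto
  ultimately show ?case by (intro exI[of _ "a # R"]) simp
qed

theorem corollary4p8:
  fixes A :: "(real ^ 'n::{finite, linorder}) set multiset"
  assumes central: "\<And>H. H \<in># A \<Longrightarrow> linear_hyperplane H"
  shows "fps_specialize (super_quotient_hilb A) (fps_X ^ 2) fps_X = mpoly_quotient_hilb (A + A) \<and>
    (\<forall>m a b. generic_arrangement (A + A) m a b \<longrightarrow>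
       finite (regions m a b) \<and>
       ring.dimension (super_quotient A) (card (regions m a b)) (super_quotient_scalars A)
         (carrier (super_quotient A)))"
proof (intro conjI allI impI)
  obtain R where R: "A = image_mset (\<lambda>a. {x. a \<bullet> x = 0}) (mset R)"
    using normals_exist[OF central] by blast
  let ?L = "map complexify R"
  have A: "counts A ?L" unfolding R by (rule counts_complexify)
  have "A + A = image_mset (\<lambda>a. {x. a \<bullet> x = 0}) (mset (doubled R))"
    unfolding R mset_doubled by simp
  then have AA: "counts (A + A) (doubled ?L)"
    using counts_complexify[of "doubled R"] by (simp only: doubled_map)
  show "fps_specialize (super_quotient_hilb A) (fps_X ^ 2) fps_X = mpoly_quotient_hilb (A + A)"
    by (rule fps_ext) (simp only: specialize_super_quotient_hilb[OF A]
        fps_nth_mpoly_quotient_hilb[OF AA] weighted_hdim_doubled)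
  fix m a b assume gen: "generic_arrangement (A + A) m a b"
  show "finite (regions m a b)" by (rule regions_cells)
  \<comment> \<open>These normals may differ from those in \<open>doubled R\<close> by order and by
    nonzero scalars. Both lists satisfy \<open>counts\<close> for \<open>A + A\<close>, and
    \<open>hdim_cong_counts\<close> then identifies their dimensions.\<close>
  let ?R = "map a [0..<m]"
  have "A + A = image_mset (\<lambda>i. {x. a i \<bullet> x = 0}) (mset_set {..<m})"
    using gen by (simp add: generic_arrangement_def)
  also have "\<dots> = image_mset (\<lambda>a. {x. a \<bullet> x = 0}) (mset ?R)"
    by (simp add: image_mset.compositionality comp_def lessThan_atLeast0)
  finally have "counts (A + A) (map complexify ?R)" by (simp only: counts_complexify)
  then have h: "hdim (doubled ?L) k 0 = hdim ?R k 0" for k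
    using hdim_cong_counts[OF AA] by (simp only: hdim_complexify)
  define N where "N = max (length (doubled ?L)) (length ?R)"
  have "total_hdim (doubled ?L) = (\<Sum>k\<le>N. hdim (doubled ?L) k 0)"
    by (rule total_hdim_bound) (simp add: N_def)
  also have "\<dots> = (\<Sum>k\<le>N. hdim ?R k 0)" by (simp only: h)
  also have "\<dots> = total_hdim ?R"
    by (rule total_hdim_bound[symmetric]) (simp only: N_def max.cobounded2)
  also have "\<dots> = card (regions m a b)" by (rule card_regions_generic[OF gen, symmetric])
  finally show "ring.dimension (super_quotient A) (card (regions m a b)) (super_quotient_scalars A)
      (carrier (super_quotient A))"
    using dimension_super_quotient[OF A] by (simp only:)
qed

end
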